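(* Let $Z_1,\dots,Z_m$ be i.i.d. standard normal, and for given reals $c,\lambda_k,d_k,w_k$ ($k=1,\dots,m$) and $w_0$ let $Y=c+\sum_{k=1}^m(d_kZ_k+\lambda_kZ_k^2)$ and $W=w_0+\sum_{k=1}^m w_kZ_k$. Let $(W_j,Y_j)_{j=1}^n$ be i.i.d. copies of $(W,Y)$ with means $\overline W,\overline Y$. Let $v\in\mathbb R$ and let $\hat\eta$ be the solution, in the domain where all $1-2\lambda_k\eta>0$, of $\sum_{k=1}^m\frac{\lambda_k(1-2\lambda_k\eta)+d_k^2(1-\lambda_k\eta)\eta}{(1-2\lambda_k\eta)^2}=v-c$. Then as $n\to\infty$ $$\mathsf E[\overline W\mid\overline Y=v]=w_0+\sum_{k=1}^m\frac{w_kd_k}{(1-2\lambda_k\hat\eta)^3}\Big[\hat\eta(1-2\lambda_k\hat\eta)^2+\frac{\mathcal K_Y^{(3)}(\hat\eta)(1-2\lambda_k\hat\eta)-4\lambda_k\mathcal K_Y''(\hat\eta)}{2n\mathcal K_Y''(\hat\eta)^2+\frac14\mathcal K_Y^{(4)}(\hat\eta)-\frac5{12}\mathcal K_Y^{(3)}(\hat\eta)^2/\mathcal K_Y''(\hat\eta)}\Big]+O(n^{-2}),$$ and, if moreover $\hat\eta\neq0$ and $1-\alpha:=\mathsf P[\overline Y\ge v]$, $$\mathsf E[\overline W\mid\overline Y\ge v]=w_0+\sum_{k=1}^m\frac{\phi(\sqrt n\hat\omega)}{\sqrt n\hat z(1-\alpha)}\frac{w_kd_k}{1-2\lambda_k\hat\eta}\Big[\hat\eta+\frac1n\Big(\Big(\frac{\hat\rho_4}8-\frac{5\hat\rho_3^2}{24}-\frac{\hat\rho_3}{2\hat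 z}-\frac1{\hat z^2}\Big)\hat\eta+\frac{1}{\sqrt{\mathcal K_Y''(\hat\eta)}(1-2\lambda_k\hat\eta)}\Big(\frac{\hat\rho_3}2+\frac1{\hat z}\Big)-\frac{4\lambda_k}{2\mathcal K_Y''(\hat\eta)(1-2\lambda_k\hat\eta)^2}\Big)\Big]+\frac{\phi(\sqrt n\hat\omega)}{\sqrt n(1-\alpha)}O(n^{-2}).$$ In particular (case $n=1$), with $W=\partial Y/\partial\mu_i$ for the delta-gamma loss described in the context and $v=v_\alpha(Y)$, these give the saddlepoint approximations to the VaR sensitivity $\partial v_\alpha(Y)/\partial\mu_i$ and CVaR sensitivity $\partial c_\alpha(Y)/\partial\mu_i$.
   Context: $\mathcal K_Y(\eta)=c\eta-\frac12\sum_k\log(1-2\lambda_k\eta)+\frac12\sum_k\frac{d_k^2\eta^2}{1-2\lambda_k\eta}$ is the CGF of $Y$; $\hat z=\hat\eta\sqrt{\mathcal K_Y''(\hat\eta)}$, $\hat\omega=\mathrm{sign}(\hat\eta)\sqrt{2(\hat\eta v-\mathcal K_Y(\hat\eta))}$, $\hat\rho_3=\mathcal K_Y^{(3)}(\hat\eta)/\mathcal K_Y''(\hat\eta)^{3/2}$, $\hat\rho_4=\mathcal K_Y^{(4)}(\hat\eta)/\mathcal K_Y''(\hat\eta)^2$; $\phi$ is the standard normal density. Delta-gamma setting: risk factors $\mathbf X\sim\mathcal N(\boldsymbol\mu,\boldsymbol\Sigma)$ in $\mathbb R^m$, loss $Y=f(\mathbf 0)+\mathbf a^\top\mathbf X+\mathbf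 X^\top\mathbf B\mathbf X$ with $\mathbf B=(b_{ik})$ symmetric; $\boldsymbol\Sigma=\mathbf H\mathbf H^\top$, $\mathbf H^\top\mathbf B\mathbf H=\mathbf P\boldsymbol\Lambda\mathbf P^\top$ with $\mathbf P$ orthonormal, $\boldsymbol\Lambda=\mathrm{diag}(\lambda_1,\dots,\lambda_m)$; then $Y=c+\sum_k(d_kZ_k+\lambda_kZ_k^2)$ with $c=f(\mathbf 0)+\mathbf a^\top\boldsymbol\mu+\boldsymbol\mu^\top\mathbf B\boldsymbol\mu$, $\mathbf d=\mathbf P^\top\mathbf H^\top(\mathbf a+2\mathbf B\boldsymbol\mu)$, and $\partial Y/\partial\mu_i=a_i+2\sum_kb_{ik}\mu_k+\sum_k[2\mathbf P^\top\mathbf H^\top\mathbf B]_{ki}Z_k$, i.e. $w_0=a_i+2\sum_kb_{ik}\mu_k$, $w_k=[2\mathbf P^\top\mathbf H^\top\mathbf B]_{ki}$. $v_\alpha(Y)=\inf\{l:\mathsf P(Y\le l)\ge\alpha\}$ (VaR) and $c_\alpha(Y)=\mathsf E[Y\mid Y\ge v_\alpha(Y)]$ (CVaR); by results of Hong and Liu these sensitivities equal $\mathsf E[\partial Y/\partial\mu_i\mid Y=v_\alpha]$ and $\mathsf E[\partial Y/\partial\mu_i\mid Y\ge v_\alpha]$ respectively. *)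

theory Defs
  imports "HOL-Probability.Probability"
begin

text \<open>Cumulant generating function of Y = c + sum_k (d_k Z_k + lambda_k Z_k^2).\<close>
definition cgf_Y :: "nat \<Rightarrow> real \<Rightarrow> (nat \<Rightarrow> real) \<Rightarrow> (nat \<Rightarrow> real) \<Rightarrow> real \<Rightarrow> real" where
  "cgf_Y m c lam d \<eta> = c * \<eta> - 1/2 * (\<Sum>k<m. ln (1 - 2 * lam k * \<eta>))
      + 1/2 * (\<Sum>k<m. (d k)\<^sup>2 * \<eta>\<^sup>2 / (1 - 2 * lam k * \<eta>))"

definition cgf_deriv :: "nat \<Rightarrow> nat \<Rightarrow> real \<Rightarrow> (nat \<Rightarrow> real) \<Rightarrow> (nat \<Rightarrow> real) \<Rightarrow> real \<Rightarrow> real" where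
  "cgf_deriv j m c lam d \<eta> = (deriv ^^ j) (cgf_Y m c lam d) \<eta>"

text \<open>Conditional expectation of X given the null event Y = v, defined as the limit
  E[X; |Y - v| < eps] / P(|Y - v| < eps) for eps -> 0+ (L is that conditional expectation).\<close>
definition has_cond_exp_at :: "'a measure \<Rightarrow> ('a \<Rightarrow> real) \<Rightarrow> ('a \<Rightarrow> real) \<Rightarrow> real \<Rightarrow> real \<Rightarrow> bool" where
  "has_cond_exp_at M X Y v L \<longleftrightarrow>
     ((\<lambda>\<epsilon>. (\<integral>x. X x * indicator {x \<in> space M. \<bar>Y x - v\<bar> < \<epsilon>} x \<partial>M)
              / measure M {x \<in> space M. \<bar>Y x - v\<bar> < \<epsilon>}) \<longlongrightarrow> L) (at_right 0)"

definition cond_exp_ge :: "'a measure \<Rightarrow> ('a \<Rightarrow> real) \<Rightarrow> ('a \<Rightarrow> real) \<Rightarrow> real \<Rightarrow> real" where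
  "cond_exp_ge M X Y v = (\<integral>x. X x * indicator {x \<in> space M. Y x \<ge> v} x \<partial>M)
        / measure M {x \<in> space M. Y x \<ge> v}"

end

theory Submission
  imports Defs "HOL-Real_Asymp.Real_Asymp"
begin

text \<open>Write \<open>S = \<Sum>\<^sub>j (Y\<^sub>j - v)\<close>. For \<open>Re s\<close> in the domain, \<open>E[Z\<^sub>k exp (s Y)] = d\<^sub>k s / (1 - 2 \<lambda>\<^sub>k s) E[exp (s Y)]\<close>,
  so along \<open>s = \<eta> + it\<close> the Fourier transforms of the laws of \<open>S\<close> and of \<open>S\<close> weighted by \<open>\<Sum>\<^sub>k w\<^sub>k Z\<^sub>k\<close>,
  both tilted by \<open>exp (\<eta> S)\<close>, are \<open>exp (n \<kappa>\<^sub>0) \<Phi>(t)\<^sup>n\<close> times an explicit rational function of \<open>t\<close>.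
  Fourier inversion at \<open>0\<close> expresses the conditional expectation given \<open>S = 0\<close> as the ratio
  \<open>\<integral> f \<Phi>\<^sup>n / \<integral> \<Phi>\<^sup>n\<close> with \<open>f(t) = \<Sum>\<^sub>k w\<^sub>k d\<^sub>k s / (1 - 2 \<lambda>\<^sub>k s)\<close>. In the tail expectation the half-line
  contributes a factor \<open>1 / s\<close>, which cancels the zero of \<open>f\<close> at \<open>s = 0\<close>; this is why one formula
  covers both signs of \<open>\<eta>\<close>. As \<open>\<eta>\<close> solves the saddlepoint equation, \<open>\<Phi>(t) = exp (- K'' t\<^sup>2 / 2 + O(t\<^sup>3))\<close>,
  and Laplace's method with two terms, where the odd orders integrate to zero, gives both expansions.\<close>

subsection \<open>Gaussian integrals with a quadratic phase\<close>

text \<open>Conditioning on a null event is a limit over shrinking windows. It becomes a point value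
  because integrable transforms have continuous inverse transforms. A single factor
  \<open>\<Phi>\<close> need not be integrable: with one quadratic coordinate its modulus decays
  only like the power -1/2 of \<open>t\<close>. Hence the threshold \<open>n \<ge> 12\<close>, where
  enough factors are present even against the polynomial majorants of the Taylor expansions. No
  contour is moved. The integrals stay on one vertical line, and all Taylor bounds hold for every
  real \<open>t\<close>, since \<open>cmod (1 - z) \<ge> 1\<close> for imaginary \<open>z\<close>.
  The weight built from the \<open>Z j k\<close> changes sign, so its signed law cannot by itself
  exclude atoms of \<open>S\<close>; the positive weight \<open>exp (\<eta> S)\<close> does, and
  this admits discontinuous test functions such as tail and window indicators. The terms in
  \<open>K4\<close> and \<open>K3\<close> squared in the denominator of the first formula come from
  the expansion of the normalizing integral. In the expanded quotient they cancel at order 1/n, so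
  passing between the two forms costs O(1/n^2).\<close>

lemma integral_vector_derivative_eq_zero:
  fixes F f :: "real \<Rightarrow> complex"
  assumes F: "\<And>x. (F has_vector_derivative f x) (at x)" and f: "continuous_on UNIV f"
    and int: "integrable lborel f" and lim: "(F \<longlongrightarrow> 0) at_top" "(F \<longlongrightarrow> 0) at_bot"
  shows "(\<integral>x. f x \<partial>lborel) = 0"
proof -
  have "(LBINT x=-\<infinity>..\<infinity>. f x) = 0 - 0"
  proof (rule interval_integral_FTC_integrable)
    show "set_integrable lborel (einterval (-\<infinity>) \<infinity>) f"
      using int by (simp add: set_integrable_def)
    show "((F \<circ> real_of_ereal) \<longlongrightarrow> 0) (at_right (-\<infinity>))" "((F \<circ> real_of_ereal) \<longlongrightarrow> 0) (at_left \<infinity>)"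
      using lim by (simp_all add: comp_def at_left_PInf at_right_MInf filterlim_filtermap)
    show "isCont f x" for x using f by (simp add: continuous_on_eq_continuous_at)
  qed (use F in auto)
  thus ?thesis by (simp add: interval_lebesgue_integral_def set_lebesgue_integral_def)
qed

text \<open>All orders \<open>j\<close> are kept because differentiation in \<open>t\<close> raises
  the order and integration by parts lowers it again; together the two relations close.\<close>

definition gauss_moment :: "real \<Rightarrow> real \<Rightarrow> nat \<Rightarrow> real \<Rightarrow> complex" where
  "gauss_moment d l j t = (\<integral>x. complex_of_real (std_normal_density x * x ^ j) * iexp (t * (d * x + l * x\<^sup>2)) \<partial>lborel)"

lemma integrable_gauss_moment:
  "integrable lborel (\<lambda>x. complex_of_real (std_normal_density x * x ^ j) * iexp (t * (d * x + l * x\<^sup>2)))"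
  by (rule Bochner_Integration.integrable_bound[OF integrable_std_normal_moment_abs[of j]])
     (auto simp: norm_mult norm_power abs_mult power_abs)

lemma std_normal_density_deriv: "(std_normal_density has_real_derivative - (x * std_normal_density x)) (at x)"
  unfolding std_normal_density_def
  by (auto intro!: derivative_eq_intros simp: field_simps)

text \<open>Integration by parts: the integrand is the derivative of
  \<open>std_normal_density x * x ^ j\<close> times the phase, which vanishes at both ends. At
  \<open>j = 0\<close> the truncated index \<open>j - 1\<close> does no harm, because its
  coefficient \<open>of_nat j\<close> is zero.\<close>

lemma gauss_moment_stein:
  "of_nat j * gauss_moment d l (j - 1) t + \<i> * t * d * gauss_moment d l j t
     + (2 * \<i> * t * l - 1) * gauss_moment d l (Suc j) t = 0"
proof -
  define g where "g j x = complex_of_real (std_normal_density x * x ^ j) * iexp (t * (d * x + l * x\<^sup>2))" for j x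
  have int: "integrable lborel (g j)" for j
    unfolding g_def by (rule integrable_gauss_moment)
  define f where "f x = of_nat j * g (j - 1) x + \<i> * t * d * g j x + (2 * \<i> * t * l - 1) * g (Suc j) x" for x
  have "(\<integral>x. f x \<partial>lborel) = 0"
  proof (rule integral_vector_derivative_eq_zero[of "g j"])
    show "integrable lborel f" unfolding f_def
      by (intro Bochner_Integration.integrable_add integrable_mult_right int)
    show "continuous_on UNIV f" unfolding f_def g_def std_normal_density_def
      by (intro continuous_intros) auto
    fix x
    have "((\<lambda>x. complex_of_real (std_normal_density x * x ^ j)) has_vector_derivative
       of_real (std_normal_density x * (of_nat j * x ^ (j - 1)) - x * std_normal_density x * x ^ j)) (at x)"
      by (intro has_vector_derivative_of_real)
         (auto intro!: derivative_eq_intros std_normal_density_deriv simp flip: has_real_derivative_iff_has_vector_derivative)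
    moreover have "((\<lambda>x. iexp (t * (d * x + l * x\<^sup>2))) has_vector_derivative
       (\<i> * (t * (d + 2 * l * x))) * iexp (t * (d * x + l * x\<^sup>2))) (at x)"
    proof -
      have "((\<lambda>x. \<i> * complex_of_real (t * (d * x + l * x\<^sup>2))) has_vector_derivative \<i> * of_real (t * (d + 2 * l * x))) (at x)"
        by (intro has_vector_derivative_mult_right has_vector_derivative_of_real)
           (auto intro!: derivative_eq_intros simp flip: has_real_derivative_iff_has_vector_derivative)
      from field_vector_diff_chain_at[OF this DERIV_exp] show ?thesis by (simp add: comp_def)
    qed
    ultimately have "(g j has_vector_derivative
        of_real (std_normal_density x * x ^ j) * (\<i> * (t * (d + 2 * l * x)) * iexp (t * (d * x + l * x\<^sup>2)))
       + of_real (std_normal_density x * (of_nat j * x ^ (j - 1)) - x * std_normal_density x * x ^ j) * iexp (t * (d * x + l * x\<^sup>2))) (at x)"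
      unfolding g_def by (rule has_vector_derivative_mult)
    moreover have "of_real (std_normal_density x * x ^ j) * (\<i> * (t * (d + 2 * l * x)) * iexp (t * (d * x + l * x\<^sup>2)))
       + of_real (std_normal_density x * (of_nat j * x ^ (j - 1)) - x * std_normal_density x * x ^ j) * iexp (t * (d * x + l * x\<^sup>2)) = f x"
    proof -
      have "P * XJ * (\<i> * (T * (D + 2 * L * Xx)) * E) + (P * (J * XJ') - Xx * P * XJ) * E
        = J * (P * XJ' * E) + \<i> * T * D * (P * XJ * E) + (2 * \<i> * T * L - 1) * (P * (Xx * XJ) * E)" for P XJ T D L Xx E J XJ' :: complex
        by (simp add: algebra_simps)
      thus ?thesis unfolding f_def g_def power_Suc by simp
    qed
    ultimately show "(g j has_vector_derivative f x) (at x)" by simp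
  next
    have "((\<lambda>x::real. std_normal_density x * x ^ j) \<longlongrightarrow> 0) at_top" "((\<lambda>x::real. std_normal_density x * x ^ j) \<longlongrightarrow> 0) at_bot"
      unfolding std_normal_density_def by real_asymp+
    from this[THEN tendsto_of_real] have "((\<lambda>x. complex_of_real (std_normal_density x * x ^ j)) \<longlongrightarrow> 0) at_top" "((\<lambda>x. complex_of_real (std_normal_density x * x ^ j)) \<longlongrightarrow> 0) at_bot"
      by simp_all
    note lim = this[THEN tendsto_norm_zero]
    show "(g j \<longlongrightarrow> 0) at_top" by (rule Lim_null_comparison[OF _ lim(1)]) (simp add: g_def norm_mult)
    show "(g j \<longlongrightarrow> 0) at_bot" by (rule Lim_null_comparison[OF _ lim(2)]) (simp add: g_def norm_mult)
  qed
  also have "(\<integral>x. f x \<partial>lborel) = of_nat j * gauss_moment d l (j - 1) t + \<i> * t * d * gauss_moment d l j t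
     + (2 * \<i> * t * l - 1) * gauss_moment d l (Suc j) t"
    unfolding f_def gauss_moment_def g_def[symmetric] using int
    by (simp only: Bochner_Integration.integral_add integrable_mult_right integral_mult_right_zero Bochner_Integration.integrable_add)
  finally show ?thesis .
qed

text \<open>This is the form in which differentiability under an integral can be reached by
  dominated convergence along sequences.\<close>

lemma has_vector_derivative_iff_quotient:
  "(f has_vector_derivative D) (at x) \<longleftrightarrow> ((\<lambda>h. (1 / h) *\<^sub>R (f (x + h) - f x)) \<longlongrightarrow> D) (at 0)"
proof -
  have "(f has_vector_derivative D) (at x) \<longleftrightarrow> ((\<lambda>h. norm (f (x + h) - f x - h *\<^sub>R D) / norm h) \<longlongrightarrow> 0) (at 0)"
    by (simp add: has_vector_derivative_def has_derivative_at bounded_linear_scaleR_left)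
  also have "\<dots> \<longleftrightarrow> ((\<lambda>h. norm ((1 / h) *\<^sub>R (f (x + h) - f x) - D)) \<longlongrightarrow> 0) (at 0)"
  proof (rule filterlim_cong[OF refl refl], rule eventually_at_filter[THEN iffD2], rule always_eventually, safe)
    fix h :: real assume "h \<noteq> 0"
    hence "f (x + h) - f x - h *\<^sub>R D = h *\<^sub>R ((1 / h) *\<^sub>R (f (x + h) - f x) - D)"
      by (simp add: algebra_simps)
    thus "norm (f (x + h) - f x - h *\<^sub>R D) / norm h = norm ((1 / h) *\<^sub>R (f (x + h) - f x) - D)"
      using \<open>h \<noteq> 0\<close> by simp
  qed
  also have "\<dots> \<longleftrightarrow> ((\<lambda>h. (1 / h) *\<^sub>R (f (x + h) - f x)) \<longlongrightarrow> D) (at 0)"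
    by (simp add: tendsto_norm_zero_iff LIM_zero_iff)
  finally show ?thesis .
qed

lemma norm_iexp_diff_le: "cmod (iexp x - iexp y) \<le> \<bar>x - y\<bar>"
proof -
  have "iexp x - iexp y = iexp y * (iexp (x - y) - 1)"
    by (simp add: algebra_simps flip: exp_add)
  also have "cmod \<dots> = cmod (iexp (x - y) - 1)" by (simp add: norm_mult)
  also have "\<dots> \<le> \<bar>x - y\<bar>" using iexp_approx1[of "x - y" 0] by simp
  finally show ?thesis .
qed

text \<open>Differentiation under the integral sign: the phase brings down
  \<open>\<i> * (d * x + l * x\<^sup>2)\<close>, which raises the order by one and by two.\<close>

lemma gauss_moment_has_vector_derivative:
  "(gauss_moment d l j has_vector_derivative \<i> * (d * gauss_moment d l (Suc j) t + l * gauss_moment d l (j + 2) t)) (at t)"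
proof -
  define q where "q x = d * x + l * x\<^sup>2" for x :: real
  define g where "g j x = complex_of_real (std_normal_density x * x ^ j)" for j x
  define D where "D = \<i> * (d * gauss_moment d l (Suc j) t + l * gauss_moment d l (j + 2) t)"
  have int: "integrable lborel (\<lambda>x. g j x * iexp (t * q x))" for t j
    unfolding g_def q_def by (rule integrable_gauss_moment)
  have D: "D = (\<integral>x. g j x * (\<i> * q x * iexp (t * q x)) \<partial>lborel)"
  proof -
    have "D = (\<integral>x. \<i> * (d * (g (Suc j) x * iexp (t * q x)) + l * (g (j + 2) x * iexp (t * q x))) \<partial>lborel)"
      unfolding D_def gauss_moment_def g_def[symmetric] q_def[symmetric] using int
      by (simp add: Bochner_Integration.integral_add integrable_mult_right)
    also have "\<dots> = (\<integral>x. g j x * (\<i> * q x * iexp (t * q x)) \<partial>lborel)"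
      by (intro Bochner_Integration.integral_cong refl) (simp add: g_def q_def algebra_simps power2_eq_square)
    finally show ?thesis .
  qed
  have lim: "((\<lambda>h. (1 / h) *\<^sub>R (gauss_moment d l j (t + h) - gauss_moment d l j t)) \<longlongrightarrow> D) (at 0)"
    unfolding tendsto_at_iff_sequentially
  proof safe
    fix h :: "nat \<Rightarrow> real" assume h: "\<forall>i. h i \<in> UNIV - {0}" "h \<longlonglongrightarrow> 0"
    have "(\<lambda>i. \<integral>x. g j x * ((1 / h i) *\<^sub>R (iexp ((t + h i) * q x) - iexp (t * q x))) \<partial>lborel)
            \<longlonglongrightarrow> (\<integral>x. g j x * (\<i> * q x * iexp (t * q x)) \<partial>lborel)"
    \<comment> \<open>The Lipschitz bound for \<open>iexp\<close> limits each difference quotient by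
      \<open>\<bar>q x\<bar>\<close>, independently of the increment, so a Gaussian moment serves as
      majorant.\<close>
    proof (rule integral_dominated_convergence[where w = "\<lambda>x. std_normal_density x * (\<bar>d\<bar> * \<bar>x\<bar>^(Suc j) + \<bar>l\<bar> * \<bar>x\<bar>^(j + 2))"])
      show "integrable lborel (\<lambda>x. std_normal_density x * (\<bar>d\<bar> * \<bar>x\<bar>^(Suc j) + \<bar>l\<bar> * \<bar>x\<bar>^(j + 2)))"
        using integrable_mult_right[OF integrable_std_normal_moment_abs[of "Suc j"], of "\<bar>d\<bar>"]
          integrable_mult_right[OF integrable_std_normal_moment_abs[of "j + 2"], of "\<bar>l\<bar>"]
        by (auto simp: algebra_simps)
      show "AE x in lborel. (\<lambda>i. g j x * ((1 / h i) *\<^sub>R (iexp ((t + h i) * q x) - iexp (t * q x))))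
              \<longlonglongrightarrow> g j x * (\<i> * q x * iexp (t * q x))"
      proof (rule AE_I2, rule tendsto_mult_left)
        fix x
        have "((\<lambda>s. \<i> * complex_of_real (s * q x)) has_vector_derivative \<i> * of_real (q x)) (at t)"
          by (intro has_vector_derivative_mult_right has_vector_derivative_of_real)
             (auto intro!: derivative_eq_intros simp flip: has_real_derivative_iff_has_vector_derivative)
        from field_vector_diff_chain_at[OF this DERIV_exp]
        have "((\<lambda>s. iexp (s * q x)) has_vector_derivative \<i> * q x * iexp (t * q x)) (at t)" by (simp add: comp_def)
        hence "((\<lambda>s. (1 / s) *\<^sub>R (iexp ((t + s) * q x) - iexp (t * q x))) \<longlongrightarrow> \<i> * q x * iexp (t * q x)) (at 0)"
          by (simp only: has_vector_derivative_iff_quotient)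
        thus "(\<lambda>i. (1 / h i) *\<^sub>R (iexp ((t + h i) * q x) - iexp (t * q x))) \<longlonglongrightarrow> \<i> * q x * iexp (t * q x)"
          using h unfolding tendsto_at_iff_sequentially comp_def by blast
      qed
      show "AE x in lborel. cmod (g j x * ((1 / h i) *\<^sub>R (iexp ((t + h i) * q x) - iexp (t * q x))))
            \<le> std_normal_density x * (\<bar>d\<bar> * \<bar>x\<bar>^(Suc j) + \<bar>l\<bar> * \<bar>x\<bar>^(j + 2))" for i
      proof (rule AE_I2)
        fix x
        have "cmod (iexp ((t + h i) * q x) - iexp (t * q x)) \<le> \<bar>h i * q x\<bar>"
          using norm_iexp_diff_le[of "(t + h i) * q x" "t * q x"] by (simp add: algebra_simps)
        hence "cmod ((1 / h i) *\<^sub>R (iexp ((t + h i) * q x) - iexp (t * q x))) \<le> \<bar>q x\<bar>"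
          using h(1) by (simp add: abs_mult divide_le_eq mult.commute del: of_real_mult of_real_add)
        also have "\<bar>q x\<bar> \<le> \<bar>d\<bar> * \<bar>x\<bar> + \<bar>l\<bar> * \<bar>x\<bar>^2"
          unfolding q_def by (rule order_trans[OF abs_triangle_ineq]) (simp add: abs_mult)
        finally have "cmod (g j x * ((1 / h i) *\<^sub>R (iexp ((t + h i) * q x) - iexp (t * q x))))
           \<le> (std_normal_density x * \<bar>x\<bar>^j) * (\<bar>d\<bar> * \<bar>x\<bar> + \<bar>l\<bar> * \<bar>x\<bar>^2)"
          unfolding power2_abs
          by (subst norm_mult) (intro mult_mono, auto simp: g_def norm_mult norm_power power_abs abs_mult)
        thus "cmod (g j x * ((1 / h i) *\<^sub>R (iexp ((t + h i) * q x) - iexp (t * q x))))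
            \<le> std_normal_density x * (\<bar>d\<bar> * \<bar>x\<bar>^(Suc j) + \<bar>l\<bar> * \<bar>x\<bar>^(j + 2))"
          by (rule ord_le_eq_trans) (simp add: power_add power2_eq_square ring_distribs mult_ac)
      qed
    qed (simp_all add: g_def q_def)
    also have "(\<lambda>i. \<integral>x. g j x * ((1 / h i) *\<^sub>R (iexp ((t + h i) * q x) - iexp (t * q x))) \<partial>lborel)
      = (\<lambda>i. (1 / h i) *\<^sub>R (gauss_moment d l j (t + h i) - gauss_moment d l j t))"
    proof
      fix i
      have "(\<integral>x. g j x * ((1 / h i) *\<^sub>R (iexp ((t + h i) * q x) - iexp (t * q x))) \<partial>lborel)
        = (\<integral>x. (1 / h i) *\<^sub>R (g j x * iexp ((t + h i) * q x) - g j x * iexp (t * q x)) \<partial>lborel)"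
        by (simp only: mult_scaleR_right right_diff_distrib)
      also have "\<dots> = (1 / h i) *\<^sub>R ((\<integral>x. g j x * iexp ((t + h i) * q x) \<partial>lborel) - (\<integral>x. g j x * iexp (t * q x) \<partial>lborel))"
        by (simp only: integral_scaleR_right Bochner_Integration.integral_diff[OF int int])
      finally show "(\<integral>x. g j x * ((1 / h i) *\<^sub>R (iexp ((t + h i) * q x) - iexp (t * q x))) \<partial>lborel)
         = (1 / h i) *\<^sub>R (gauss_moment d l j (t + h i) - gauss_moment d l j t)"
        by (simp only: gauss_moment_def g_def q_def)
    qed
    finally show "((\<lambda>h. (1 / h) *\<^sub>R (gauss_moment d l j (t + h) - gauss_moment d l j t)) \<circ> h) \<longlonglongrightarrow> D"
      by (simp add: D comp_def)
  qed
  thus ?thesis unfolding D_def by (simp only: has_vector_derivative_iff_quotient)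
qed

text \<open>Logarithm of the characteristic function of \<open>d * x + l * x\<^sup>2\<close> under
  the standard normal law. For real \<open>z\<close> the argument of \<open>Ln\<close> has real part
  one, so the principal branch stays off its cut. The argument is complex to make complex
  differentiation available.\<close>

definition log_cf :: "real \<Rightarrow> real \<Rightarrow> complex \<Rightarrow> complex" where
  "log_cf d l z = - Ln (1 - 2 * \<i> * l * z) / 2 - (d * z)\<^sup>2 / (2 * (1 - 2 * \<i> * l * z))"

lemma one_minus_imaginary_nonpos: "1 - 2 * \<i> * complex_of_real l * complex_of_real t \<notin> \<real>\<^sub>\<le>\<^sub>0"
  by (auto simp: complex_nonpos_Reals_iff)

lemma one_minus_imaginary_nonzero: "1 - 2 * \<i> * complex_of_real l * complex_of_real t \<noteq> 0"
  using one_minus_imaginary_nonpos[of l t] by (metis nonpos_Reals_zero_I)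

lemma gauss_moment_Suc_0:
  "gauss_moment d l (Suc 0) t = \<i> * t * d / (1 - 2 * \<i> * l * t) * gauss_moment d l 0 t"
  using gauss_moment_stein[of 0 d l t] one_minus_imaginary_nonzero[of l t]
  by (simp add: field_simps)

lemma log_cf_has_field_derivative:
  fixes d l s :: real and q :: complex
  defines "q \<equiv> 1 - 2 * \<i> * complex_of_real l * complex_of_real s"
  shows "(log_cf d l has_field_derivative \<i> * l / q - d\<^sup>2 * s / q - \<i> * l * d\<^sup>2 * s\<^sup>2 / q\<^sup>2) (at (of_real s))"
proof -
  have q: "q \<noteq> 0" "q \<notin> \<real>\<^sub>\<le>\<^sub>0" unfolding q_def
    by (rule one_minus_imaginary_nonzero one_minus_imaginary_nonpos)+
  have dq: "((\<lambda>z. 1 - 2 * \<i> * complex_of_real l * z) has_field_derivative - 2 * \<i> * l) (at (of_real s))"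
    by (auto intro!: derivative_eq_intros)
  have sq: "((\<lambda>z. (d * z)\<^sup>2) has_field_derivative 2 * (complex_of_real d)\<^sup>2 * s) (at (complex_of_real s))"
    by (auto intro!: derivative_eq_intros simp: power2_eq_square)
  have A: "((\<lambda>z. Ln (1 - 2 * \<i> * complex_of_real l * z)) has_field_derivative inverse q * (- 2 * \<i> * l)) (at (of_real s))"
    unfolding q_def by (rule DERIV_chain2[OF has_field_derivative_Ln dq]) (use q in \<open>simp only: q_def not_False_eq_True\<close>)
  have B: "((\<lambda>z. 2 * (1 - 2 * \<i> * complex_of_real l * z)) has_field_derivative 2 * (- 2 * \<i> * l)) (at (of_real s))"
    by (rule DERIV_cmult[OF dq])
  have "2 * (1 - 2 * \<i> * complex_of_real l * complex_of_real s) \<noteq> 0"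
    using q(1) unfolding q_def by (metis mult_eq_0_iff zero_neq_numeral)
  from DERIV_diff[OF DERIV_cdivide[OF DERIV_minus[OF A], of 2] DERIV_divide[OF sq B this], folded q_def]
  have D: "(log_cf d l has_field_derivative - (inverse q * (- 2 * \<i> * l)) / 2 -
      (2 * (complex_of_real d)\<^sup>2 * s * (2 * q) - (complex_of_real d * of_real s)\<^sup>2 * (2 * (- 2 * \<i> * l))) / (2 * q * (2 * q))) (at (of_real s))"
    unfolding log_cf_def[abs_def] .
  have eq: "- (inverse q * (- 2 * \<i> * l)) / 2 -
      (2 * (complex_of_real d)\<^sup>2 * s * (2 * q) - (complex_of_real d * of_real s)\<^sup>2 * (2 * (- 2 * \<i> * l))) / (2 * q * (2 * q))
    = \<i> * l / q - d\<^sup>2 * s / q - \<i> * l * d\<^sup>2 * s\<^sup>2 / q\<^sup>2"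
  proof -
    have "(2 * D\<^sup>2 * S * (2 * q) - (D * S)\<^sup>2 * (2 * (- 2 * \<i> * L))) / (2 * q * (2 * q))
       = D\<^sup>2 * S / q + \<i> * L * D\<^sup>2 * S\<^sup>2 / q\<^sup>2" for D S L :: complex
      using q(1) by (simp add: divide_simps power2_eq_square)
    moreover have "- (inverse q * (- 2 * \<i> * L)) / 2 = \<i> * L / q" for L :: complex
      by (simp add: inverse_eq_divide)
    ultimately show ?thesis by (simp only: diff_diff_eq of_real_mult of_real_power)
  qed
  show ?thesis by (rule DERIV_cong[OF D eq])
qed

text \<open>By the Stein identities the transform solves a linear ordinary differential equation in \<open>t\<close>;
  this fixes the branch of the complex square root.\<close>
lemma gauss_moment_0: "gauss_moment d l 0 t = exp (log_cf d l t)"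
proof -
  define G where "G = gauss_moment d l 0"
  define X where "X s = \<i> * l / (1 - 2 * \<i> * l * s) - d\<^sup>2 * s / (1 - 2 * \<i> * l * s)
       - \<i> * l * d\<^sup>2 * s\<^sup>2 / (1 - 2 * \<i> * l * s)\<^sup>2" for s :: real
  have dG: "(G has_vector_derivative G s * X s) (at s)" for s
  proof -
    define q where "q = 1 - 2 * \<i> * complex_of_real l * complex_of_real s"
    have q: "q \<noteq> 0" unfolding q_def by (rule one_minus_imaginary_nonzero)
    \<comment> \<open>The Stein identities of orders 0 and 1 express the first two moments through
      \<open>G\<close>, which turns the derivative formula into an equation for \<open>G\<close>
      alone.\<close>
    have 1: "gauss_moment d l (Suc 0) s = \<i> * s * d / q * G s"
      using gauss_moment_Suc_0[of d l s] by (simp add: G_def q_def)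
    have "G s + \<i> * s * d * gauss_moment d l (Suc 0) s = q * gauss_moment d l 2 s"
      using gauss_moment_stein[of "Suc 0" d l s] by (simp add: G_def q_def numeral_2_eq_2 algebra_simps)
    hence 2: "gauss_moment d l 2 s = (G s + \<i> * s * d * gauss_moment d l (Suc 0) s) / q"
      using q by simp
    have eq: "\<i> * (D * (\<i> * S * D / q * g) + L * ((g + \<i> * S * D * (\<i> * S * D / q * g)) / q))
        = g * (\<i> * L / q - D\<^sup>2 * S / q - \<i> * L * D\<^sup>2 * S\<^sup>2 / q\<^sup>2)" for D S L g :: complex
      using q by (simp add: divide_simps power2_eq_square) (simp add: algebra_simps)?
    have "(G has_vector_derivative \<i> * (d * gauss_moment d l (Suc 0) s + l * gauss_moment d l 2 s)) (at s)"
      using gauss_moment_has_vector_derivative[of d l 0 s] by (simp add: G_def numeral_2_eq_2)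
    thus ?thesis unfolding 2 1 eq unfolding X_def q_def by simp
  qed
  have dE: "((\<lambda>s. exp (- log_cf d l (of_real s))) has_vector_derivative
     exp (- log_cf d l s) * (- X s)) (at s)" for s
    unfolding X_def
    by (rule has_vector_derivative_real_field[OF DERIV_chain2[OF DERIV_exp DERIV_minus[OF log_cf_has_field_derivative]]])
  have "((\<lambda>s. G s * exp (- log_cf d l s)) has_vector_derivative 0) (at s)" for s
    using has_vector_derivative_mult[OF dG[of s] dE[of s]] by (simp add: mult_ac)
  then obtain c where c: "\<And>s. G s * exp (- log_cf d l s) = c"
    using has_vector_derivative_zero_constant[of UNIV "\<lambda>s. G s * exp (- log_cf d l s)"] by auto
  have "G 0 = 1"
    using integral_normal_density[of 1 0] by (simp add: G_def gauss_moment_def del: integral_normal_density)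
  hence "c = 1" using c[of 0] by (simp add: log_cf_def)
  thus ?thesis using c[of t] by (simp add: G_def exp_minus field_simps)
qed

section \<open>Exponential tilting of one standard normal variable\<close>

lemma gauss_tilt:
  fixes d l \<eta> t :: real and j :: nat
  defines "u \<equiv> 1 - 2 * l * \<eta>"
  assumes u: "u > 0"
  defines "\<mu> \<equiv> d * \<eta> / u" and "\<sigma> \<equiv> 1 / sqrt u"
  shows "of_real (\<sigma> * (std_normal_density (\<mu> + \<sigma> * x) * (\<mu> + \<sigma> * x) ^ j)) * exp (Complex \<eta> t * (d * (\<mu> + \<sigma> * x) + l * (\<mu> + \<sigma> * x)\<^sup>2))
    = of_real (exp (d\<^sup>2 * \<eta>\<^sup>2 / (2 * u)) / sqrt u) * iexp (t * (d * \<mu> + l * \<mu>\<^sup>2)) *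
       (of_real ((\<mu> + \<sigma> * x) ^ j * std_normal_density x) * iexp (t * (d / (u * sqrt u) * x + l / u * x\<^sup>2)))"
proof -
  define q where "q = d * (\<mu> + \<sigma> * x) + l * (\<mu> + \<sigma> * x)\<^sup>2"
  have s2: "\<sigma>\<^sup>2 = 1 / u" using u by (simp add: \<sigma>_def power_divide)
  have um: "u * \<mu> = d * \<eta>" using u by (simp add: \<mu>_def)
  have l: "l * (2 * \<eta>) = 1 - u" by (simp add: u_def)
  have q: "q = (d * \<mu> + l * \<mu>\<^sup>2) + (d / (u * sqrt u) * x + l / u * x\<^sup>2)"
  proof -
    have "d / (u * sqrt u) = (d + 2 * l * \<mu>) * \<sigma>"
    proof -
      have "u * (d + 2 * l * \<mu>) = u * d + 2 * l * (d * \<eta>)" using um by (simp add: algebra_simps)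
      also have "\<dots> = d" by (simp add: u_def algebra_simps)
      finally show ?thesis using u by (simp add: \<sigma>_def field_simps)
    qed
    thus ?thesis using s2 by (simp add: q_def power2_sum power_mult_distrib algebra_simps)
  qed
  \<comment> \<open>Completing the square: \<open>\<mu>\<close> is the vertex of the tilted exponent
    and \<open>u * \<sigma>\<^sup>2 = 1\<close> restores the standard normal one. What the tilt
    leaves behind is a constant and new coefficients in the phase.\<close>
  have e: "\<eta> * q - (\<mu> + \<sigma> * x)\<^sup>2 / 2 = d\<^sup>2 * \<eta>\<^sup>2 / (2 * u) - x\<^sup>2 / 2"
  proof -
    have "\<eta> * q - (\<mu> + \<sigma> * x)\<^sup>2 / 2 = \<eta> * d * (\<mu> + \<sigma> * x) - u * (\<mu> + \<sigma> * x)\<^sup>2 / 2"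
      unfolding q_def u_def by (simp add: field_simps)
    also have "\<dots> = u * \<mu> * (\<mu> + \<sigma> * x) - u * (\<mu> + \<sigma> * x)\<^sup>2 / 2" using um by (simp add: mult.commute)
    also have "\<dots> = u * \<mu>\<^sup>2 / 2 - u * \<sigma>\<^sup>2 * x\<^sup>2 / 2" by (simp add: power2_eq_square algebra_simps add_divide_distrib)
    also have "\<dots> = d\<^sup>2 * \<eta>\<^sup>2 / (2 * u) - x\<^sup>2 / 2"
      using u s2 by (simp add: \<mu>_def power_divide power2_eq_square mult_ac)
    finally show ?thesis .
  qed
  have "std_normal_density (\<mu> + \<sigma> * x) * exp (\<eta> * q) = exp (\<eta> * q - (\<mu> + \<sigma> * x)\<^sup>2 / 2) / sqrt (2 * pi)"
    by (simp add: std_normal_density_def diff_conv_add_uminus exp_add del: add_uminus_conv_diff)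
  also have "\<dots> = exp (d\<^sup>2 * \<eta>\<^sup>2 / (2 * u)) * std_normal_density x"
    unfolding e by (simp add: std_normal_density_def diff_conv_add_uminus exp_add del: add_uminus_conv_diff)
  finally have d: "std_normal_density (\<mu> + \<sigma> * x) * exp (\<eta> * q) = exp (d\<^sup>2 * \<eta>\<^sup>2 / (2 * u)) * std_normal_density x" .
  have "exp (Complex \<eta> t * q) = of_real (exp (\<eta> * q)) * iexp (t * q)"
    by (simp add: Complex_eq algebra_simps exp_add exp_of_real[symmetric])
  also have "iexp (t * q) = iexp (t * (d * \<mu> + l * \<mu>\<^sup>2)) * iexp (t * (d / (u * sqrt u) * x + l / u * x\<^sup>2))"
    unfolding q by (simp only: of_real_add of_real_mult distrib_left exp_add)
  finally have x: "exp (Complex \<eta> t * q) = of_real (exp (\<eta> * q)) * (iexp (t * (d * \<mu> + l * \<mu>\<^sup>2)) * iexp (t * (d / (u * sqrt u) * x + l / u * x\<^sup>2)))" .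
  have "of_real (\<sigma> * (std_normal_density (\<mu> + \<sigma> * x) * (\<mu> + \<sigma> * x) ^ j)) * exp (Complex \<eta> t * q)
     = of_real (\<sigma> * (\<mu> + \<sigma> * x) ^ j * (std_normal_density (\<mu> + \<sigma> * x) * exp (\<eta> * q)))
         * (iexp (t * (d * \<mu> + l * \<mu>\<^sup>2)) * iexp (t * (d / (u * sqrt u) * x + l / u * x\<^sup>2)))"
    unfolding x by (simp only: of_real_mult mult_ac)
  also have "\<dots> = of_real (exp (d\<^sup>2 * \<eta>\<^sup>2 / (2 * u)) / sqrt u) * iexp (t * (d * \<mu> + l * \<mu>\<^sup>2)) *
       (of_real ((\<mu> + \<sigma> * x) ^ j * std_normal_density x) * iexp (t * (d / (u * sqrt u) * x + l / u * x\<^sup>2)))"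
    unfolding d by (simp add: \<sigma>_def mult_ac)
  finally show ?thesis by (simp add: q_def)
qed

text \<open>The substitution \<open>z = \<mu> + \<sigma> * x\<close> reduces both integrals to
  \<open>gauss_moment\<close> with tilted coefficients: order 0 for the first and, because
  \<open>z\<close> is affine in \<open>x\<close>, orders 0 and 1 for the second. With
  \<open>s = Complex \<eta> t\<close> the prefactor in the second is
  \<open>d * s / (1 - 2 * l * s)\<close>, written with real and imaginary parts of \<open>s\<close>
  apart.\<close>

lemma gauss_laplace:
  fixes d l \<eta> t :: real
  defines "u \<equiv> 1 - 2 * l * \<eta>"
  assumes u: "u > 0"
  defines "F \<equiv> of_real (exp (d\<^sup>2 * \<eta>\<^sup>2 / (2 * u)) / sqrt u) * iexp (t * (d\<^sup>2 * \<eta> * (1 - l * \<eta>) / u\<^sup>2)) * exp (log_cf (d / (u * sqrt u)) (l / u) t)"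
  shows "has_bochner_integral lborel (\<lambda>z. std_normal_density z * exp (Complex \<eta> t * (d * z + l * z\<^sup>2))) F"
    and "has_bochner_integral lborel (\<lambda>z. std_normal_density z * (z * exp (Complex \<eta> t * (d * z + l * z\<^sup>2))))
            (d / u * (\<eta> + \<i> * t / (u * (1 - 2 * \<i> * (l / u) * t))) * F)"
proof -
  define \<mu> \<sigma> where "\<mu> = d * \<eta> / u" and "\<sigma> = 1 / sqrt u"
  define d' l' where "d' = d / (u * sqrt u)" and "l' = l / u"
  define C where "C = of_real (exp (d\<^sup>2 * \<eta>\<^sup>2 / (2 * u)) / sqrt u) * iexp (t * (d * \<mu> + l * \<mu>\<^sup>2))"
  have \<sigma>: "\<sigma> > 0" using u by (simp add: \<sigma>_def)
  have m: "d * \<mu> + l * \<mu>\<^sup>2 = d\<^sup>2 * \<eta> * (1 - l * \<eta>) / u\<^sup>2"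
    using u by (simp add: \<mu>_def divide_simps power2_eq_square) (simp add: u_def algebra_simps)
  have F: "F = C * gauss_moment d' l' 0 t"
    by (simp add: F_def C_def m gauss_moment_0 d'_def l'_def)
  have g: "has_bochner_integral lborel (\<lambda>x. of_real (std_normal_density x * x ^ j) * iexp (t * (d' * x + l' * x\<^sup>2))) (gauss_moment d' l' j t)" for j
    unfolding gauss_moment_def by (rule has_bochner_integral_integrable[OF integrable_gauss_moment])
  have tr: "has_bochner_integral lborel f I \<longleftrightarrow> has_bochner_integral lborel (\<lambda>x. \<sigma> *\<^sub>R f (\<mu> + \<sigma> * x)) I" for f :: "real \<Rightarrow> complex" and I
  proof -
    have "has_bochner_integral lborel f I \<longleftrightarrow> has_bochner_integral lborel (\<lambda>x. f (\<mu> + \<sigma> * x)) (I /\<^sub>R \<bar>\<sigma>\<bar>)"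
      using \<sigma> by (intro lborel_has_bochner_integral_real_affine_iff) auto
    also have "\<dots> \<longleftrightarrow> has_bochner_integral lborel (\<lambda>x. \<sigma> *\<^sub>R f (\<mu> + \<sigma> * x)) I"
    proof
      assume "has_bochner_integral lborel (\<lambda>x. f (\<mu> + \<sigma> * x)) (I /\<^sub>R \<bar>\<sigma>\<bar>)"
      from has_bochner_integral_scaleR_right[OF this, of \<sigma>] \<sigma>
      show "has_bochner_integral lborel (\<lambda>x. \<sigma> *\<^sub>R f (\<mu> + \<sigma> * x)) I" by simp
    next
      assume "has_bochner_integral lborel (\<lambda>x. \<sigma> *\<^sub>R f (\<mu> + \<sigma> * x)) I"
      from has_bochner_integral_scaleR_right[OF this, of "1 / \<sigma>"] \<sigma>
      show "has_bochner_integral lborel (\<lambda>x. f (\<mu> + \<sigma> * x)) (I /\<^sub>R \<bar>\<sigma>\<bar>)" by (simp add: divide_inverse)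
    qed
    finally show ?thesis .
  qed
  note ti = gauss_tilt[OF u[unfolded u_def], where d = d and t = t, folded u_def, folded \<mu>_def \<sigma>_def d'_def l'_def, folded C_def]
  show "has_bochner_integral lborel (\<lambda>z. std_normal_density z * exp (Complex \<eta> t * (d * z + l * z\<^sup>2))) F"
  proof (subst tr)
    have "has_bochner_integral lborel (\<lambda>x. C * (of_real (std_normal_density x * x ^ 0) * iexp (t * (d' * x + l' * x\<^sup>2)))) F"
      unfolding F by (intro has_bochner_integral_mult_right g)
    thus "has_bochner_integral lborel (\<lambda>x. \<sigma> *\<^sub>R (std_normal_density (\<mu> + \<sigma> * x) * exp (Complex \<eta> t * (d * (\<mu> + \<sigma> * x) + l * (\<mu> + \<sigma> * x)\<^sup>2)))) F"
      using ti[where j = 0] by (simp add: scaleR_conv_of_real mult_ac)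
  qed
  have "d / u * (\<eta> + \<i> * t / (u * (1 - 2 * \<i> * (l / u) * t))) * F = C * (\<mu> * gauss_moment d' l' 0 t + \<sigma> * gauss_moment d' l' 1 t)"
  proof -
    have "\<sigma> * d' = d / u\<^sup>2" using u by (simp add: \<sigma>_def d'_def field_simps power2_eq_square)
    hence "complex_of_real \<sigma> * complex_of_real d' = of_real (d / u\<^sup>2)" by (simp only: flip: of_real_mult)
    moreover have "\<sigma> * gauss_moment d' l' 1 t = (complex_of_real \<sigma> * complex_of_real d') * (\<i> * t / (1 - 2 * \<i> * (l / u) * t)) * gauss_moment d' l' 0 t"
      by (simp add: gauss_moment_Suc_0 l'_def)
    moreover have "D / U * (E + \<i> * T / (U * Q)) * (C * G) = C * (D * E / U * G + (D / U\<^sup>2) * (\<i> * T / Q) * G)"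
      if "U \<noteq> 0" for D U E T Q G :: complex
      using that by (simp add: divide_simps power2_eq_square) (simp add: algebra_simps)?
    ultimately show ?thesis
      using u by (simp add: F \<mu>_def)
  qed
  moreover have "has_bochner_integral lborel (\<lambda>z. std_normal_density z * (z * exp (Complex \<eta> t * (d * z + l * z\<^sup>2))))
      (C * (\<mu> * gauss_moment d' l' 0 t + \<sigma> * gauss_moment d' l' 1 t))"
  proof (subst tr)
    have "has_bochner_integral lborel (\<lambda>x. C * (\<mu> * (of_real (std_normal_density x * x ^ 0) * iexp (t * (d' * x + l' * x\<^sup>2)))
      + \<sigma> * (of_real (std_normal_density x * x ^ 1) * iexp (t * (d' * x + l' * x\<^sup>2)))))
       (C * (\<mu> * gauss_moment d' l' 0 t + \<sigma> * gauss_moment d' l' 1 t))"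
      by (intro has_bochner_integral_mult_right has_bochner_integral_add g)
    thus "has_bochner_integral lborel (\<lambda>x. \<sigma> *\<^sub>R (std_normal_density (\<mu> + \<sigma> * x) * ((\<mu> + \<sigma> * x) * exp (Complex \<eta> t * (d * (\<mu> + \<sigma> * x) + l * (\<mu> + \<sigma> * x)\<^sup>2)))))
       (C * (\<mu> * gauss_moment d' l' 0 t + \<sigma> * gauss_moment d' l' 1 t))"
      using ti[where j = 1] by (simp add: scaleR_conv_of_real algebra_simps)
  qed
  ultimately show "has_bochner_integral lborel (\<lambda>z. std_normal_density z * (z * exp (Complex \<eta> t * (d * z + l * z\<^sup>2))))
            (d / u * (\<eta> + \<i> * t / (u * (1 - 2 * \<i> * (l / u) * t))) * F)" by simp
qed

subsection \<open>Fourier inversion for weighted distributions\<close>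

text \<open>The pure Gaussian case is the quadratic phase with \<open>d = 1\<close> and
  \<open>l = 0\<close>, so rescaling the closed form already obtained is enough.\<close>

lemma gaussian_kernel_fourier:
  assumes \<sigma>: "\<sigma> > 0"
  shows "has_bochner_integral lborel (\<lambda>t. iexp (t * x) * of_real (exp (- (\<sigma> * t)\<^sup>2 / 2))) (of_real (2 * pi * normal_density 0 \<sigma> x))"
proof -
  have "has_bochner_integral lborel (\<lambda>y. complex_of_real (std_normal_density y) * iexp (x / \<sigma> * y)) (exp (log_cf 1 0 (x / \<sigma>)))"
    using has_bochner_integral_integrable[OF integrable_gauss_moment[of 0 "x / \<sigma>" 1 0]] gauss_moment_0[of 1 0 "x / \<sigma>"]
    by (simp add: gauss_moment_def)
  hence "has_bochner_integral lborel (\<lambda>t. complex_of_real (std_normal_density (0 + \<sigma> * t)) * iexp (x / \<sigma> * (0 + \<sigma> * t))) (exp (log_cf 1 0 (x / \<sigma>)) /\<^sub>R \<bar>\<sigma>\<bar>)"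
    using \<sigma> by (subst (asm) lborel_has_bochner_integral_real_affine_iff[where c = \<sigma> and t = 0]) auto
  hence "has_bochner_integral lborel (\<lambda>t. of_real (sqrt (2 * pi)) * (complex_of_real (std_normal_density (0 + \<sigma> * t)) * iexp (x / \<sigma> * (0 + \<sigma> * t))))
     (of_real (sqrt (2 * pi)) * (exp (log_cf 1 0 (x / \<sigma>)) /\<^sub>R \<bar>\<sigma>\<bar>))"
    by (rule has_bochner_integral_mult_right)
  also have "(\<lambda>t. of_real (sqrt (2 * pi)) * (complex_of_real (std_normal_density (0 + \<sigma> * t)) * iexp (x / \<sigma> * (0 + \<sigma> * t))))
     = (\<lambda>t. iexp (t * x) * of_real (exp (- (\<sigma> * t)\<^sup>2 / 2)))"
    using \<sigma> by (auto simp: fun_eq_iff std_normal_density_def mult_ac)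
  also have "of_real (sqrt (2 * pi)) * (exp (log_cf 1 0 (x / \<sigma>)) /\<^sub>R \<bar>\<sigma>\<bar>) = of_real (2 * pi * normal_density 0 \<sigma> x)"
  proof -
    have "exp (log_cf 1 0 (complex_of_real (x / \<sigma>))) = of_real (exp (- (x / \<sigma>)\<^sup>2 / 2))"
      by (simp add: log_cf_def exp_of_real[symmetric])
    moreover have "sqrt (2 * pi) * (exp (- (x / \<sigma>)\<^sup>2 / 2) / \<sigma>) = 2 * pi * normal_density 0 \<sigma> x"
    proof -
      have "2 * pi = sqrt (2 * pi) * sqrt (2 * pi)" by simp
      moreover have "- (x / \<sigma>)\<^sup>2 / 2 = - (x\<^sup>2) / (2 * \<sigma>\<^sup>2)" by (simp add: power_divide)
      ultimately show ?thesis
        using \<sigma> by (simp add: normal_density_def real_sqrt_mult divide_simps)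
    qed
    moreover have "of_real (sqrt (2 * pi)) * (complex_of_real E /\<^sub>R \<bar>\<sigma>\<bar>) = of_real (sqrt (2 * pi) * (E / \<sigma>))" for E
      using \<sigma> by (simp add: scaleR_conv_of_real divide_inverse)
    ultimately show ?thesis by (simp only:)
  qed
  finally show ?thesis .
qed

context prob_space
begin

definition char_weighted :: "('a \<Rightarrow> real) \<Rightarrow> ('a \<Rightarrow> real) \<Rightarrow> real \<Rightarrow> complex" where
  "char_weighted X S t = (\<integral>\<omega>. of_real (X \<omega>) * iexp (t * S \<omega>) \<partial>M)"

text \<open>Candidate for the Lebesgue density of the signed law of \<open>S\<close> weighted by
  \<open>X\<close>. For integrable \<open>char_weighted X S\<close> it is continuous, so that its
  value at a single point has a meaning.\<close>

definition density_weighted :: "('a \<Rightarrow> real) \<Rightarrow> ('a \<Rightarrow> real) \<Rightarrow> real \<Rightarrow> complex" where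
  "density_weighted X S y = (\<integral>t. iexp (- (t * y)) * char_weighted X S t \<partial>lborel) / of_real (2 * pi)"

lemma norm_density_weighted_le:
  assumes "integrable lborel (char_weighted X S)"
  shows "cmod (density_weighted X S y) \<le> (\<integral>t. cmod (char_weighted X S t) \<partial>lborel)"
proof -
  have "cmod (\<integral>t. iexp (- (t * y)) * char_weighted X S t \<partial>lborel) \<le> (\<integral>t. cmod (char_weighted X S t) \<partial>lborel)"
    by (rule order_trans[OF integral_norm_bound]) (simp add: norm_mult)
  moreover have "1 \<le> cmod (of_real (2 * pi))" using pi_gt3 by simp
  ultimately show ?thesis unfolding density_weighted_def norm_divide
    by (smt (verit, best) divide_le_eq_1_pos frac_le integral_nonneg_AE AE_I2 norm_ge_zero div_by_1)
qed

lemma isCont_density_weighted: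
  assumes G: "integrable lborel (char_weighted X S)"
  shows "isCont (density_weighted X S) y"
proof -
  have "isCont (\<lambda>y. \<integral>t. iexp (- (t * y)) * char_weighted X S t \<partial>lborel) y"
    unfolding continuous_at_sequentially comp_def
  proof safe
    fix u assume u: "u \<longlonglongrightarrow> y"
    show "(\<lambda>n. \<integral>t. iexp (- (t * u n)) * char_weighted X S t \<partial>lborel) \<longlonglongrightarrow> (\<integral>t. iexp (- (t * y)) * char_weighted X S t \<partial>lborel)"
      by (rule integral_dominated_convergence[where w = "\<lambda>t. cmod (char_weighted X S t)"])
         (use G u in \<open>auto simp: norm_mult intro!: tendsto_intros borel_measurable_integrable\<close>)
  qed
  thus ?thesis unfolding density_weighted_def[abs_def] by (intro continuous_intros) auto
qed

text \<open>Adding independent normal noise of standard deviation \<open>\<sigma>\<close> to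
  \<open>S\<close> multiplies the transform by a Gaussian. That factor justifies Fubini for every
  integrable \<open>X\<close>, whatever the decay of \<open>char_weighted X S\<close>.\<close>

lemma smoothed_density:
  assumes X: "integrable M X" and S[measurable]: "S \<in> borel_measurable M" and \<sigma>: "\<sigma> > 0"
  shows "complex_of_real (\<integral>\<omega>. X \<omega> * normal_density 0 \<sigma> (S \<omega> - y) \<partial>M)
    = (\<integral>t. of_real (exp (- (\<sigma> * t)\<^sup>2 / 2)) * (iexp (- (t * y)) * char_weighted X S t) \<partial>lborel) / of_real (2 * pi)"
proof -
  interpret pair_sigma_finite M lborel ..
  have [measurable]: "X \<in> borel_measurable M" using X by auto
  note ker = gaussian_kernel_fourier[OF \<sigma>]
  define e where "e t = exp (- (\<sigma> * t)\<^sup>2 / 2)" for t :: real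
  have [measurable]: "e \<in> borel_measurable borel" unfolding e_def by measurable
  have e: "integrable lborel e"
    using integrable_norm[OF integrable.intros[OF ker[of 0]]] by (simp add: e_def[abs_def] norm_mult)
  define F where "F \<omega> t = of_real (X \<omega>) * (iexp (t * (S \<omega> - y)) * of_real (e t))" for \<omega> t
  have F: "integrable (M \<Otimes>\<^sub>M lborel) (case_prod F)"
  proof (rule Fubini_integrable)
    show "case_prod F \<in> borel_measurable (M \<Otimes>\<^sub>M lborel)" unfolding F_def by measurable
    have "(\<lambda>\<omega>. \<integral>t. norm (case_prod F (\<omega>, t)) \<partial>lborel) = (\<lambda>\<omega>. \<bar>X \<omega>\<bar> * (\<integral>t. e t \<partial>lborel))"
      by (auto simp: F_def norm_mult e_def fun_eq_iff)
    thus "integrable M (\<lambda>\<omega>. \<integral>t. norm (case_prod F (\<omega>, t)) \<partial>lborel)" using X by simp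
    show "AE \<omega> in M. integrable lborel (\<lambda>t. case_prod F (\<omega>, t))"
    proof (rule AE_I2)
      fix \<omega>
      show "integrable lborel (\<lambda>t. case_prod F (\<omega>, t))"
        unfolding F_def e_def case_prod_conv
        by (intro integrable_mult_right integrable.intros[OF ker, of "S \<omega> - y"])
    qed
  qed
  have "(\<integral>t. (\<integral>\<omega>. F \<omega> t \<partial>M) \<partial>lborel) = (\<integral>\<omega>. (\<integral>t. F \<omega> t \<partial>lborel) \<partial>M)"
    using F by (rule Fubini_integral)
  also have "\<dots> = (\<integral>\<omega>. of_real (2 * pi * (X \<omega> * normal_density 0 \<sigma> (S \<omega> - y))) \<partial>M)"
    unfolding F_def e_def
    by (intro Bochner_Integration.integral_cong refl)
       (simp only: integral_mult_right_zero has_bochner_integral_integral_eq[OF ker], simp only: of_real_mult mult_ac)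
  also have "\<dots> = of_real (2 * pi) * complex_of_real (\<integral>\<omega>. X \<omega> * normal_density 0 \<sigma> (S \<omega> - y) \<partial>M)"
    by (simp add: integral_complex_of_real flip: of_real_mult)
  also have "(\<integral>t. (\<integral>\<omega>. F \<omega> t \<partial>M) \<partial>lborel) = (\<integral>t. of_real (e t) * (iexp (- (t * y)) * char_weighted X S t) \<partial>lborel)"
  proof (intro Bochner_Integration.integral_cong refl)
    fix t
    have "iexp (t * (a - y)) = iexp (t * a) * iexp (- (t * y))" for a
      by (simp add: algebra_simps flip: exp_add)
    hence "(\<lambda>\<omega>. F \<omega> t) = (\<lambda>\<omega>. of_real (e t) * iexp (- (t * y)) * (of_real (X \<omega>) * iexp (t * S \<omega>)))"
      by (simp only: F_def mult_ac)
    thus "(\<integral>\<omega>. F \<omega> t \<partial>M) = of_real (e t) * (iexp (- (t * y)) * char_weighted X S t)"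
      by (simp only: char_weighted_def integral_mult_right_zero mult.assoc)
  qed
  finally show ?thesis by (simp add: e_def field_simps)
qed

text \<open>Fubini moves the noise from the law of \<open>S\<close> to the test function. The inner
  integral is an average of \<open>f\<close> around \<open>S \<omega>\<close> and tends to
  \<open>f (S \<omega>)\<close> at points of continuity.\<close>

lemma smoothed_integral:
  assumes X: "integrable M X" and S[measurable]: "S \<in> borel_measurable M" and \<sigma>: "\<sigma> > 0"
    and f[measurable]: "f \<in> borel_measurable borel" and f_int: "integrable lborel f"
  shows "(\<integral>y. f y * (\<integral>\<omega>. X \<omega> * normal_density 0 \<sigma> (S \<omega> - y) \<partial>M) \<partial>lborel)
    = (\<integral>\<omega>. X \<omega> * (\<integral>z. f (S \<omega> - \<sigma> * z) * std_normal_density z \<partial>lborel) \<partial>M)"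
proof -
  interpret pair_sigma_finite M lborel ..
  have [measurable]: "X \<in> borel_measurable M" using X by auto
  define c where "c = 1 / (\<sigma> * sqrt (2 * pi))"
  have nd: "normal_density 0 \<sigma> x \<le> c" "0 \<le> normal_density 0 \<sigma> x" for x
    using \<sigma> by (auto simp: normal_density_def c_def real_sqrt_mult divide_simps mult_ac)
  have c: "c \<ge> 0" using \<sigma> by (simp add: c_def)
  define F where "F \<omega> y = X \<omega> * (f y * normal_density 0 \<sigma> (S \<omega> - y))" for \<omega> y
  have fn: "integrable lborel (\<lambda>y. f y * normal_density 0 \<sigma> (x - y))" for x
    by (rule Bochner_Integration.integrable_bound[OF integrable_mult_left[OF integrable_norm[OF f_int], of c]])
       (use nd c in \<open>auto simp: abs_mult intro!: AE_I2 mult_mono\<close>)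
  have F: "integrable (M \<Otimes>\<^sub>M lborel) (case_prod F)"
  proof (rule Fubini_integrable)
    show "case_prod F \<in> borel_measurable (M \<Otimes>\<^sub>M lborel)" unfolding F_def by measurable
    show "integrable M (\<lambda>\<omega>. \<integral>y. norm (case_prod F (\<omega>, y)) \<partial>lborel)"
    proof (rule Bochner_Integration.integrable_bound[OF integrable_mult_left[OF integrable_norm[OF X], of "c * (\<integral>y. \<bar>f y\<bar> \<partial>lborel)"]])
      have "(\<integral>y. \<bar>F \<omega> y\<bar> \<partial>lborel) \<le> \<bar>X \<omega>\<bar> * (c * (\<integral>y. \<bar>f y\<bar> \<partial>lborel))" for \<omega>
      proof -
        have "(\<integral>y. \<bar>f y * normal_density 0 \<sigma> (S \<omega> - y)\<bar> \<partial>lborel) \<le> (\<integral>y. c * \<bar>f y\<bar> \<partial>lborel)"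
          using nd f_int fn[of "S \<omega>"]
          by (intro integral_mono integrable_abs integrable_mult_right) (auto simp: abs_mult mult.commute[of c] intro!: mult_mono)
        thus ?thesis by (simp add: F_def abs_mult mult_left_mono)
      qed
      thus "AE \<omega> in M. norm (\<integral>y. norm (case_prod F (\<omega>, y)) \<partial>lborel) \<le> norm (norm (X \<omega>) * (c * (\<integral>y. \<bar>f y\<bar> \<partial>lborel)))"
        using c by (intro AE_I2) (simp add: abs_mult)
    qed (unfold F_def, measurable)
    show "AE \<omega> in M. integrable lborel (\<lambda>y. case_prod F (\<omega>, y))"
      using fn by (intro AE_I2) (simp add: F_def)
  qed
  have "(\<integral>y. f y * (\<integral>\<omega>. X \<omega> * normal_density 0 \<sigma> (S \<omega> - y) \<partial>M) \<partial>lborel) = (\<integral>y. (\<integral>\<omega>. F \<omega> y \<partial>M) \<partial>lborel)"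
    unfolding F_def by (subst integral_mult_right_zero[symmetric]) (simp only: mult_ac)
  also have "\<dots> = (\<integral>\<omega>. (\<integral>y. F \<omega> y \<partial>lborel) \<partial>M)" using F by (rule Fubini_integral)
  also have "\<dots> = (\<integral>\<omega>. X \<omega> * (\<integral>z. f (S \<omega> - \<sigma> * z) * std_normal_density z \<partial>lborel) \<partial>M)"
  proof (intro Bochner_Integration.integral_cong refl)
    fix \<omega>
    have "(\<integral>y. f y * normal_density 0 \<sigma> (S \<omega> - y) \<partial>lborel) = \<bar>- \<sigma>\<bar> *\<^sub>R (\<integral>z. f (S \<omega> + (- \<sigma>) * z) * normal_density 0 \<sigma> (S \<omega> - (S \<omega> + (- \<sigma>) * z)) \<partial>lborel)"
      using \<sigma> by (intro lborel_integral_real_affine) auto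
    also have "\<dots> = (\<integral>z. f (S \<omega> - \<sigma> * z) * (\<sigma> * normal_density 0 \<sigma> (\<sigma> * z)) \<partial>lborel)"
      using \<sigma> by (simp add: mult_ac flip: integral_mult_right_zero)
    also have "(\<lambda>z. \<sigma> * normal_density 0 \<sigma> (\<sigma> * z)) = std_normal_density"
      using \<sigma> by (auto simp: fun_eq_iff normal_density_def real_sqrt_mult power_mult_distrib)
    finally show "(\<integral>y. F \<omega> y \<partial>lborel) = X \<omega> * (\<integral>z. f (S \<omega> - \<sigma> * z) * std_normal_density z \<partial>lborel)"
      by (simp add: F_def fun_eq_iff)
  qed
  finally show ?thesis .
qed

text \<open>Both sides are limits of smoothed identities as the noise vanishes. On the left
  \<open>B\<close> bounds the averages of \<open>f\<close>; on the right the modulus of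
  \<open>char_weighted X S\<close> is the majorant. Continuity of \<open>f\<close> matters only
  almost surely along \<open>S\<close>.\<close>

lemma fourier_inversion_cont:
  assumes X: "integrable M X" and S[measurable]: "S \<in> borel_measurable M"
    and G: "integrable lborel (char_weighted X S)"
    and f[measurable]: "f \<in> borel_measurable borel" and f_int: "integrable lborel f"
    and B: "\<And>y. \<bar>f y\<bar> \<le> B" and cont: "AE \<omega> in M. isCont f (S \<omega>)"
  shows "complex_of_real (\<integral>\<omega>. X \<omega> * f (S \<omega>) \<partial>M) = (\<integral>y. of_real (f y) * density_weighted X S y \<partial>lborel)"
proof -
  have Xm[measurable]: "X \<in> borel_measurable M" using X by auto
  have Gm[measurable]: "char_weighted X S \<in> borel_measurable borel" using borel_measurable_integrable[OF G] by simp
  define \<sigma> where "\<sigma> n = 1 / real (Suc n)" for n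
  have \<sigma>: "\<sigma> n > 0" for n by (simp add: \<sigma>_def)
  have \<sigma>0: "\<sigma> \<longlonglongrightarrow> 0" unfolding \<sigma>_def using LIMSEQ_inverse_real_of_nat by (simp add: inverse_eq_divide)
  define g where "g n y = (\<integral>t. of_real (exp (- (\<sigma> n * t)\<^sup>2 / 2)) * (iexp (- (t * y)) * char_weighted X S t) \<partial>lborel) / of_real (2 * pi)" for n y
  define A where "A n = (\<integral>\<omega>. X \<omega> * (\<integral>z. f (S \<omega> - \<sigma> n * z) * std_normal_density z \<partial>lborel) \<partial>M)" for n
  have "complex_of_real (A n) = (\<integral>y. of_real (f y) * g n y \<partial>lborel)" for n
  proof -
    have "complex_of_real (A n) = (\<integral>y. complex_of_real (f y * (\<integral>\<omega>. X \<omega> * normal_density 0 (\<sigma> n) (S \<omega> - y) \<partial>M)) \<partial>lborel)"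
      unfolding A_def smoothed_integral[OF X S \<sigma> f f_int, symmetric] by (simp only: integral_complex_of_real)
    also have "\<dots> = (\<integral>y. of_real (f y) * g n y \<partial>lborel)"
      using smoothed_density[OF X S \<sigma>[of n]] by (simp only: of_real_mult g_def)
    finally show ?thesis .
  qed
  moreover have "A \<longlonglongrightarrow> (\<integral>\<omega>. X \<omega> * f (S \<omega>) \<partial>M)"
    unfolding A_def
  proof (rule integral_dominated_convergence[where w = "\<lambda>\<omega>. \<bar>X \<omega>\<bar> * B"])
    show "integrable M (\<lambda>\<omega>. \<bar>X \<omega>\<bar> * B)" using X by simp
    have B0: "B \<ge> 0" using B[of 0] by simp
    have fi: "integrable lborel (\<lambda>z. f (s - \<sigma> n * z) * std_normal_density z)" for s n
      by (rule Bochner_Integration.integrable_bound[OF integrable_mult_right[OF integrable_normal_density[of 1 0], of B]])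
         (use B B0 in \<open>auto simp: abs_mult intro!: AE_I2 mult_mono\<close>)
    show "AE \<omega> in M. norm (X \<omega> * (\<integral>z. f (S \<omega> - \<sigma> n * z) * std_normal_density z \<partial>lborel)) \<le> \<bar>X \<omega>\<bar> * B" for n
    proof (rule AE_I2)
      fix \<omega>
      have "\<bar>\<integral>z. f (S \<omega> - \<sigma> n * z) * std_normal_density z \<partial>lborel\<bar> \<le> (\<integral>z. \<bar>f (S \<omega> - \<sigma> n * z) * std_normal_density z\<bar> \<partial>lborel)"
        using integral_norm_bound[of lborel "\<lambda>z. f (S \<omega> - \<sigma> n * z) * std_normal_density z"] by simp
      also have "\<dots> \<le> (\<integral>z. B * std_normal_density z \<partial>lborel)"
        using B fi[of "S \<omega>" n] by (intro integral_mono integrable_abs integrable_mult_right integrable_normal_density) (auto simp: abs_mult intro!: mult_right_mono)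
      also have "\<dots> = B" by simp
      finally show "norm (X \<omega> * (\<integral>z. f (S \<omega> - \<sigma> n * z) * std_normal_density z \<partial>lborel)) \<le> \<bar>X \<omega>\<bar> * B"
        by (simp add: abs_mult mult_left_mono)
    qed
    show "AE \<omega> in M. (\<lambda>n. X \<omega> * (\<integral>z. f (S \<omega> - \<sigma> n * z) * std_normal_density z \<partial>lborel)) \<longlonglongrightarrow> X \<omega> * f (S \<omega>)"
      using cont
    proof eventually_elim
      case (elim \<omega>)
      have "(\<lambda>n. \<integral>z. f (S \<omega> - \<sigma> n * z) * std_normal_density z \<partial>lborel) \<longlonglongrightarrow> (\<integral>z. f (S \<omega>) * std_normal_density z \<partial>lborel)"
      proof (rule integral_dominated_convergence[where w = "\<lambda>z. B * std_normal_density z"])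
        show "AE z in lborel. (\<lambda>n. f (S \<omega> - \<sigma> n * z) * std_normal_density z) \<longlonglongrightarrow> f (S \<omega>) * std_normal_density z"
        proof (rule AE_I2)
          fix z
          have "(\<lambda>n. S \<omega> - \<sigma> n * z) \<longlonglongrightarrow> S \<omega> - 0 * z" by (intro tendsto_intros \<sigma>0)
          hence "(\<lambda>n. f (S \<omega> - \<sigma> n * z)) \<longlonglongrightarrow> f (S \<omega>)" using isCont_tendsto_compose[OF elim] by simp
          thus "(\<lambda>n. f (S \<omega> - \<sigma> n * z) * std_normal_density z) \<longlonglongrightarrow> f (S \<omega>) * std_normal_density z"
            by (intro tendsto_intros)
        qed
      qed (use B in \<open>auto simp: abs_mult intro!: mult_right_mono\<close>)
      thus ?case by (intro tendsto_intros) simp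
    qed
  qed measurable
  moreover have "(\<lambda>n. \<integral>y. of_real (f y) * g n y \<partial>lborel) \<longlonglongrightarrow> (\<integral>y. of_real (f y) * density_weighted X S y \<partial>lborel)"
  proof (rule integral_dominated_convergence[where w = "\<lambda>y. \<bar>f y\<bar> * (\<integral>t. cmod (char_weighted X S t) \<partial>lborel)"])
    show "integrable lborel (\<lambda>y. \<bar>f y\<bar> * (\<integral>t. cmod (char_weighted X S t) \<partial>lborel))" using f_int by simp
    show "(\<lambda>y. complex_of_real (f y) * density_weighted X S y) \<in> borel_measurable lborel"
      unfolding density_weighted_def by measurable
    show "(\<lambda>y. complex_of_real (f y) * g n y) \<in> borel_measurable lborel" for n
      unfolding g_def by measurable
    show "AE y in lborel. (\<lambda>n. complex_of_real (f y) * g n y) \<longlonglongrightarrow> of_real (f y) * density_weighted X S y"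
    proof (rule AE_I2)
      fix y
      have "(\<lambda>n. \<integral>t. of_real (exp (- (\<sigma> n * t)\<^sup>2 / 2)) * (iexp (- (t * y)) * char_weighted X S t) \<partial>lborel)
        \<longlonglongrightarrow> (\<integral>t. iexp (- (t * y)) * char_weighted X S t \<partial>lborel)"
      proof (rule integral_dominated_convergence[where w = "\<lambda>t. cmod (char_weighted X S t)"])
        show "AE t in lborel. (\<lambda>n. complex_of_real (exp (- (\<sigma> n * t)\<^sup>2 / 2)) * (iexp (- (t * y)) * char_weighted X S t)) \<longlonglongrightarrow> iexp (- (t * y)) * char_weighted X S t"
        proof (rule AE_I2)
          fix t
          have "(\<lambda>n. complex_of_real (exp (- (\<sigma> n * t)\<^sup>2 / 2)) * (iexp (- (t * y)) * char_weighted X S t)) \<longlonglongrightarrow> of_real (exp (- (0 * t)\<^sup>2 / 2)) * (iexp (- (t * y)) * char_weighted X S t)"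
            by (intro tendsto_intros \<sigma>0) auto
          thus "(\<lambda>n. complex_of_real (exp (- (\<sigma> n * t)\<^sup>2 / 2)) * (iexp (- (t * y)) * char_weighted X S t)) \<longlonglongrightarrow> iexp (- (t * y)) * char_weighted X S t" by simp
        qed
      qed (use G in \<open>auto simp: norm_mult mult_left_le_one_le\<close>)
      thus "(\<lambda>n. complex_of_real (f y) * g n y) \<longlonglongrightarrow> of_real (f y) * density_weighted X S y"
        unfolding g_def density_weighted_def by (intro tendsto_intros) auto
    qed
    show "AE y in lborel. norm (complex_of_real (f y) * g n y) \<le> \<bar>f y\<bar> * (\<integral>t. cmod (char_weighted X S t) \<partial>lborel)" for n
    proof (rule AE_I2)
      fix y
      have "cmod (\<integral>t. of_real (exp (- (\<sigma> n * t)\<^sup>2 / 2)) * (iexp (- (t * y)) * char_weighted X S t) \<partial>lborel)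
         \<le> (\<integral>t. cmod (of_real (exp (- (\<sigma> n * t)\<^sup>2 / 2)) * (iexp (- (t * y)) * char_weighted X S t)) \<partial>lborel)"
        by (rule integral_norm_bound)
      also have "\<dots> \<le> (\<integral>t. cmod (char_weighted X S t) \<partial>lborel)"
      proof (rule integral_mono[OF Bochner_Integration.integrable_bound[OF integrable_norm[OF G]] integrable_norm[OF G]])
      qed (auto simp: norm_mult mult_left_le_one_le)
      finally have "cmod (g n y) \<le> (\<integral>t. cmod (char_weighted X S t) \<partial>lborel) / (2 * pi)"
        unfolding g_def norm_divide by (simp add: divide_right_mono)
      also have "\<dots> \<le> (\<integral>t. cmod (char_weighted X S t) \<partial>lborel) / 1"
        using pi_gt3 by (intro divide_left_mono) auto
      finally show "norm (complex_of_real (f y) * g n y) \<le> \<bar>f y\<bar> * (\<integral>t. cmod (char_weighted X S t) \<partial>lborel)"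
        by (simp add: norm_mult mult_left_mono)
    qed
  qed
  ultimately show ?thesis
    using LIMSEQ_unique[OF tendsto_of_real[of A _ sequentially, where ?'a = complex]] by auto
qed

text \<open>Hat functions of height one supported within \<open>1 / Suc n\<close> of
  \<open>a\<close> are continuous, so inversion applies before anything is known about atoms, and a
  bounded density gives them weighted mass O(1/n). Positivity of \<open>X\<close> turns vanishing
  weighted mass at \<open>a\<close> into vanishing probability.\<close>

lemma AE_not_atom:
  assumes X: "integrable M X" "\<And>\<omega>. X \<omega> > 0" and S[measurable]: "S \<in> borel_measurable M"
    and G: "integrable lborel (char_weighted X S)"
  shows "AE \<omega> in M. S \<omega> \<noteq> a"
proof -
  have Xm[measurable]: "X \<in> borel_measurable M" using X by auto
  define C where "C = (\<integral>t. cmod (char_weighted X S t) \<partial>lborel)"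
  define I where "I = (\<integral>\<omega>. X \<omega> * indicator {a} (S \<omega>) \<partial>M)"
  have int: "integrable M (\<lambda>\<omega>. X \<omega> * indicator {a} (S \<omega>))"
    by (rule Bochner_Integration.integrable_bound[OF X(1)]) (auto split: split_indicator)
  have bound: "I \<le> C * (2 / real (Suc n))" for n
  proof -
    define f where "f y = max 0 (1 - real (Suc n) * \<bar>y - a\<bar>)" for y
    have [measurable]: "f \<in> borel_measurable borel" unfolding f_def by measurable
    have f: "0 \<le> f y" "f y \<le> indicator {a - 1 / Suc n .. a + 1 / Suc n} y" for y
    proof -
      show "0 \<le> f y" by (simp add: f_def)
      show "f y \<le> indicator {a - 1 / Suc n .. a + 1 / Suc n} y"
      proof (cases "\<bar>y - a\<bar> \<le> 1 / Suc n")
        case True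
        hence "y \<in> {a - 1 / Suc n .. a + 1 / Suc n}" by (simp only: atLeastAtMost_iff) linarith
        thus ?thesis by (simp add: f_def)
      next
        case False
        hence "1 \<le> real (Suc n) * \<bar>y - a\<bar>" by (simp add: divide_simps mult.commute)
        thus ?thesis by (simp add: f_def)
      qed
    qed
    have ii: "has_bochner_integral lborel (indicator {a - 1 / Suc n .. a + 1 / Suc n}) (2 / real (Suc n))"
    proof -
      have "emeasure lborel {a - 1 / Suc n .. a + 1 / Suc n} = ennreal (2 / real (Suc n))"
        by (simp add: emeasure_lborel_Icc_eq)
      thus ?thesis by (auto simp: has_bochner_integral_iff measure_def)
    qed
    have f_int: "integrable lborel f"
      by (rule Bochner_Integration.integrable_bound[OF integrable.intros[OF ii]]) (use f in auto)
    have f1: "\<bar>f y\<bar> \<le> 1" for y using f[of y] by (auto split: split_indicator_asm)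
    have "complex_of_real (\<integral>\<omega>. X \<omega> * f (S \<omega>) \<partial>M) = (\<integral>y. of_real (f y) * density_weighted X S y \<partial>lborel)"
      by (rule fourier_inversion_cont[OF X(1) S G _ f_int f1]) (auto simp: f_def intro!: AE_I2 continuous_intros)
    hence "\<bar>\<integral>\<omega>. X \<omega> * f (S \<omega>) \<partial>M\<bar> = cmod (\<integral>y. of_real (f y) * density_weighted X S y \<partial>lborel)"
      by (metis norm_of_real)
    also have "\<dots> \<le> (\<integral>y. cmod (of_real (f y) * density_weighted X S y) \<partial>lborel)" by (rule integral_norm_bound)
    also have "\<dots> \<le> (\<integral>y. C * indicator {a - 1 / Suc n .. a + 1 / Suc n} y \<partial>lborel)"
    proof (rule integral_mono')
      show "integrable lborel (\<lambda>y. C * indicator {a - 1 / Suc n .. a + 1 / Suc n} y)"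
        using ii by (intro integrable_mult_right integrable.intros)
      show "cmod (of_real (f y) * density_weighted X S y) \<le> C * indicator {a - 1 / Suc n .. a + 1 / Suc n} y" for y
        using mult_mono[OF f(2)[of y] norm_density_weighted_le[OF G, of y]] f(1)[of y]
        by (simp add: norm_mult C_def mult.commute)
      show "0 \<le> C * indicator {a - 1 / Suc n .. a + 1 / Suc n} y" for y :: real
        by (simp add: C_def)
    qed
    also have "\<dots> = C * (2 / real (Suc n))" using ii by (simp add: has_bochner_integral_iff)
    finally have "(\<integral>\<omega>. X \<omega> * f (S \<omega>) \<partial>M) \<le> C * (2 / real (Suc n))" by simp
    moreover have "I \<le> (\<integral>\<omega>. X \<omega> * f (S \<omega>) \<partial>M)"
      unfolding I_def
    proof (rule integral_mono[OF int])
      show "integrable M (\<lambda>\<omega>. X \<omega> * f (S \<omega>))"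
        by (rule Bochner_Integration.integrable_bound[OF X(1)]) (use f1 in \<open>auto simp: abs_mult mult_left_le\<close>)
      show "X \<omega> * indicator {a} (S \<omega>) \<le> X \<omega> * f (S \<omega>)" for \<omega>
        using X(2)[of \<omega>] f by (auto split: split_indicator simp: f_def)
    qed
    ultimately show ?thesis by simp
  qed
  have "(\<lambda>n. C * (2 / real (Suc n))) \<longlonglongrightarrow> 0" by real_asymp
  hence "I \<le> 0" by (rule Lim_bounded2) (use bound in auto)
  moreover have "I \<ge> 0" unfolding I_def using X(2) by (intro integral_nonneg_AE AE_I2) (simp add: less_imp_le)
  ultimately have "AE \<omega> in M. X \<omega> * indicator {a} (S \<omega>) = 0"
    using integral_nonneg_eq_0_iff_AE[OF int] X(2) unfolding I_def
    by (metis (no_types, lifting) AE_I2 indicator_pos_le less_imp_le mult_nonneg_nonneg order_antisym)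
  thus ?thesis by eventually_elim (use X(2) in \<open>auto simp: less_le split: split_indicator_asm\<close>)
qed

text \<open>The weight \<open>X\<close> may change sign, and cancellation could hide an atom of
  \<open>S\<close> in its signed law. The auxiliary positive weight \<open>E\<close> excludes atoms,
  so the finitely many jumps of \<open>f\<close> are almost surely avoided.\<close>

lemma fourier_inversion:
  assumes E: "integrable M E" "\<And>\<omega>. E \<omega> > 0" "integrable lborel (char_weighted E S)"
    and X: "integrable M X" "integrable lborel (char_weighted X S)" and S: "S \<in> borel_measurable M"
    and f: "f \<in> borel_measurable borel" "integrable lborel f" "\<And>y. \<bar>f y\<bar> \<le> B"
    and D: "finite D" "\<And>y. y \<notin> D \<Longrightarrow> isCont f y"
  shows "complex_of_real (\<integral>\<omega>. X \<omega> * f (S \<omega>) \<partial>M) = (\<integral>y. of_real (f y) * density_weighted X S y \<partial>lborel)"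
proof (rule fourier_inversion_cont[OF X(1) S X(2) f])
  have "AE \<omega> in M. \<forall>a\<in>D. S \<omega> \<noteq> a"
    using AE_not_atom[OF E(1,2) S E(3)] D(1) by (intro AE_finite_allI) auto
  thus "AE \<omega> in M. isCont f (S \<omega>)"
    by eventually_elim (use D(2) in auto)
qed

end

subsection \<open>Laplace expansion to second order\<close>

text \<open>Raise \<open>x \<le> exp x\<close> at \<open>x = b * y / Suc j\<close> to the power
  \<open>j\<close>. Taking \<open>Suc j\<close> instead of \<open>j\<close> keeps the division
  meaningful at \<open>j = 0\<close>.\<close>

lemma power_exp_bound:
  assumes "b > (0::real)"
  obtains C where "C \<ge> 0" "\<And>y. y \<ge> 0 \<Longrightarrow> y ^ j * exp (- b * y) \<le> C"
proof
  show "(real (Suc j) / b) ^ j \<ge> 0" using assms by simp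
  fix y :: real assume y: "y \<ge> 0"
  have "b * y / Suc j \<le> exp (b * y / Suc j)"
    using exp_ge_add_one_self[of "b * y / Suc j"] by linarith
  hence "y \<le> real (Suc j) / b * exp (b * y / Suc j)"
    using assms by (simp add: field_simps)
  hence "y ^ j \<le> (real (Suc j) / b * exp (b * y / Suc j)) ^ j"
    using y by (intro power_mono)
  also have "\<dots> = (real (Suc j) / b) ^ j * exp (real j * (b * y / Suc j))"
    by (subst power_mult_distrib, subst exp_of_nat_mult) (rule refl)
  also have "\<dots> \<le> (real (Suc j) / b) ^ j * exp (b * y)"
    using assms y by (intro mult_left_mono) (auto simp: field_simps)
  finally show "y ^ j * exp (- b * y) \<le> (real (Suc j) / b) ^ j"
    by (simp add: exp_minus divide_simps)
qed

text \<open>The error coefficients below are polynomials in the point \<open>T\<close> and in two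
  normalized Taylor remainders; compactness bounds them uniformly without explicit
  constants.\<close>

lemma continuous_bounded_on_cballs:
  fixes g :: "complex \<times> complex \<times> complex \<Rightarrow> complex"
  assumes "continuous_on UNIV g"
  obtains K where "K \<ge> 0" "\<And>T x y. cmod T \<le> 1 \<Longrightarrow> cmod x \<le> C \<Longrightarrow> cmod y \<le> C \<Longrightarrow> cmod (g (T, x, y)) \<le> K"
proof -
  have "compact (g ` (cball 0 1 \<times> cball 0 C \<times> cball 0 C))"
    using assms by (intro compact_continuous_image compact_Times compact_cball) (rule continuous_on_subset, auto)
  then obtain K where K: "K > 0" "\<And>z. z \<in> g ` (cball 0 1 \<times> cball 0 C \<times> cball 0 C) \<Longrightarrow> cmod z \<le> K"
    by (meson bounded_pos compact_imp_bounded)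
  thus ?thesis using that[of K] by (force intro: K(2))
qed

text \<open>The terms of \<open>f(T) exp (N r(T))\<close> that survive in the expansion up to relative order \<open>1/N\<^sup>2\<close>
  when \<open>T\<close> has size \<open>1/sqrt N\<close>; the ones of odd degree integrate to zero against the Gaussian.\<close>
definition saddle_poly :: "(nat \<Rightarrow> complex) \<Rightarrow> (nat \<Rightarrow> complex) \<Rightarrow> complex \<Rightarrow> complex \<Rightarrow> complex" where
  "saddle_poly f A N T = f 0 + f 1 * T + f 2 * T^2 + f 3 * T^3
     + N * (f 0 * A 3 * T^3 + (f 0 * A 4 + f 1 * A 3) * T^4 + (f 0 * A 5 + f 1 * A 4 + f 2 * A 3) * T^5)
     + N^2 / 2 * (f 0 * (A 3)^2 * T^6 + (2 * f 0 * A 3 * A 4 + f 1 * (A 3)^2) * T^7)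
     + N^3 / 6 * (f 0 * (A 3)^3 * T^9)"

text \<open>Here \<open>F\<close> is the weight and \<open>T^3 * R\<close> the phase beyond second
  order, both in Horner form with exact remainders \<open>x\<close> and \<open>y\<close>. The
  product with the j-th power of the phase carries \<open>N^j * T^(3*j)\<close> and is cut so that
  the rest is \<open>N^j * T^(2*j+4)\<close>, that is, \<open>(N * T^2)^j * T^4\<close>. All rests
  are then of size \<open>1/N^2\<close> at the scale \<open>T^2 = 1/N\<close>.\<close>

lemma saddle_poly_remainder:
  fixes f0 f1 f2 f3 A3 A4 A5 T x y :: complex
  defines "R2 \<equiv> A5 + T * y"
  defines "R1 \<equiv> A4 + T * R2"
  defines "R \<equiv> A3 + T * R1"
  defines "F3 \<equiv> f3 + T * x"
  defines "F2 \<equiv> f2 + T * F3"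
  defines "F1 \<equiv> f1 + T * F2"
  defines "F \<equiv> f0 + T * F1"
  shows "F * R = f0 * A3 + (f0 * A4 + f1 * A3) * T + (f0 * A5 + f1 * A4 + f2 * A3) * T^2
      + T^3 * (f0 * y + f1 * R2 + f2 * R1 + F3 * R)"
      (is ?g1)
    and "F * R^2 = f0 * A3^2 + (2 * f0 * A3 * A4 + f1 * A3^2) * T
      + T^2 * (f0 * (A4^2 + 2 * (A3 + A4 * T) * R2 + T^2 * R2^2) + f1 * R1 * (2 * A3 + T * R1) + F2 * R^2)"
      (is ?g2)
    and "F * R^3 = f0 * A3^3 + T * (f0 * R1 * (R^2 + R * A3 + A3^2) + F1 * R^3)" (is ?g3)
proof -
  have "F * R = f0 * R + f1 * T * R + f2 * T^2 * R + T^3 * F3 * R"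
    by (simp add: F_def F1_def F2_def algebra_simps power2_eq_square power3_eq_cube)
  also have "f0 * R = f0 * (A3 + A4 * T + A5 * T^2 + T^3 * y)"
    by (simp add: R_def R1_def R2_def algebra_simps power2_eq_square power3_eq_cube)
  also have "f1 * T * R = f1 * T * (A3 + A4 * T + T^2 * R2)"
    by (simp add: R_def R1_def algebra_simps power2_eq_square)
  also have "f2 * T^2 * R = f2 * T^2 * (A3 + T * R1)" by (simp add: R_def)
  finally show ?g1 by (simp add: algebra_simps power2_eq_square power3_eq_cube)
  have "F * R^2 = f0 * R^2 + f1 * T * R^2 + T^2 * F2 * R^2"
    by (simp add: F_def F1_def algebra_simps power2_eq_square)
  also have "f0 * R^2 = f0 * (A3 + A4 * T + T^2 * R2)^2"
    by (simp add: R_def R1_def algebra_simps power2_eq_square)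
  also have "f1 * T * R^2 = f1 * T * (A3 + T * R1)^2" by (simp add: R_def)
  finally show ?g2 by (simp add: algebra_simps power2_eq_square)
  have "F * R^3 = f0 * R^3 + T * F1 * R^3" by (simp add: F_def algebra_simps)
  also have "f0 * R^3 = f0 * (A3^3 + T * R1 * (R^2 + R * A3 + A3^2))"
    by (simp add: R_def algebra_simps power2_eq_square power3_eq_cube)
  finally show ?g3 by (simp add: algebra_simps)
qed

text \<open>Three powers are kept because \<open>z\<close> has size \<open>N * T^3\<close>: its
  fourth power is \<open>(N * T^2)^4 * T^4\<close>, already of the order of the admissible
  error.\<close>

lemma exp_cubic_remainder:
  "cmod (exp z - (1 + z + z^2 / 2 + z^3 / 6)) \<le> exp (cmod z) * cmod z ^ 4"
proof -
  have "cmod (exp z - (\<Sum>i\<le>3. z ^ i / fact i)) \<le> exp (cmod z) * (cmod z ^ Suc 3) / fact 3"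
    by (rule Taylor_exp_field)
  also have "\<dots> \<le> exp (cmod z) * (cmod z ^ Suc 3) / 1" by (intro divide_left_mono) auto
  finally show ?thesis by (simp add: eval_nat_numeral algebra_simps fact_reduce)
qed

text \<open>Turns a remainder estimate into a bounded variable, so that the Taylor inequality can be
  used as an exact polynomial identity. An even \<open>k\<close> makes \<open>t ^ k\<close> equal to
  its modulus; at \<open>t = 0\<close> and positive \<open>k\<close> the quotient takes the value 0,
  which satisfies the bound.\<close>

lemma norm_quotient_le:
  assumes "cmod w \<le> C * t ^ k" and T: "T = complex_of_real t" and k: "even k"
  shows "cmod (w / T ^ k) \<le> \<bar>C\<bar>"
proof (cases "t = 0")
  case True
  thus ?thesis using T assms(1) by (cases "k = 0") (auto simp: power_0_left)
next
  case False
  hence "0 < t ^ k" using k by (simp add: zero_less_power_eq)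
  moreover have "cmod (T ^ k) = t ^ k" using k by (simp add: T norm_power power_even_abs)
  moreover have "cmod w \<le> \<bar>C\<bar> * t ^ k"
    using assms(1) \<open>0 < t ^ k\<close> mult_right_mono[OF abs_ge_self[of C], of "t ^ k"] by linarith
  ultimately show ?thesis by (simp add: norm_divide divide_le_eq)
qed

text \<open>The constants depend on \<open>F\<close> and \<open>r\<close> only through the Taylor
  data, so they serve all \<open>t\<close> and \<open>N\<close> at once. The Gaussian exponent is a
  budget: one half pays for the exponential of the higher phase, a quarter for polynomial factors,
  and the last quarter is left for integration.\<close>

lemma saddle_near:
  fixes f A :: "nat \<Rightarrow> complex" and C \<kappa> :: real
  assumes \<kappa>: "\<kappa> > 0"
  obtains \<delta> K where "\<delta> > 0" "\<delta> \<le> 1" "K \<ge> 0"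
    "\<And>t N F r. \<bar>t\<bar> \<le> \<delta> \<Longrightarrow> N > 0 \<Longrightarrow>
       cmod (F - (f 0 + f 1 * of_real t + f 2 * of_real t^2 + f 3 * of_real t^3)) \<le> C * t^4 \<Longrightarrow>
       cmod (r - (A 3 * of_real t^3 + A 4 * of_real t^4 + A 5 * of_real t^5)) \<le> C * t^6 \<Longrightarrow>
       cmod (F * exp (of_real (- N * \<kappa> * t\<^sup>2 / 2) + of_real N * r) - of_real (exp (- N * \<kappa> * t\<^sup>2 / 2)) * saddle_poly f A N t)
         \<le> K / N\<^sup>2 * exp (- (N * (\<kappa> / 8) * t\<^sup>2))"
proof -
  define R2 where "R2 T y = A 5 + T * y" for T y :: complex
  define R1 where "R1 T y = A 4 + T * R2 T y" for T y :: complex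
  define R where "R T y = A 3 + T * R1 T y" for T y :: complex
  define F3 where "F3 T x = f 3 + T * x" for T x :: complex
  define F2 where "F2 T x = f 2 + T * F3 T x" for T x :: complex
  define F1 where "F1 T x = f 1 + T * F2 T x" for T x :: complex
  define F0 where "F0 T x = f 0 + T * F1 T x" for T x :: complex
  define B1 where "B1 T x y = f 0 * y + f 1 * R2 T y + f 2 * R1 T y + F3 T x * R T y" for T x y
  define B2 where "B2 T x y = f 0 * ((A 4)^2 + 2 * (A 3 + A 4 * T) * R2 T y + T^2 * (R2 T y)^2) + f 1 * R1 T y * (2 * A 3 + T * R1 T y) + F2 T x * (R T y)^2" for T x y
  define B3 where "B3 T x y = f 0 * R1 T y * ((R T y)^2 + R T y * A 3 + (A 3)^2) + F1 T x * (R T y)^3" for T x y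
  note defs = R2_def R1_def R_def F3_def F2_def F1_def F0_def
  have e1: "F0 T x * R T y = f 0 * A 3 + (f 0 * A 4 + f 1 * A 3) * T + (f 0 * A 5 + f 1 * A 4 + f 2 * A 3) * T^2 + T^3 * B1 T x y"
   and e2: "F0 T x * (R T y)^2 = f 0 * (A 3)^2 + (2 * f 0 * A 3 * A 4 + f 1 * (A 3)^2) * T + T^2 * B2 T x y"
   and e3: "F0 T x * (R T y)^3 = f 0 * (A 3)^3 + T * B3 T x y" for T x y
    using saddle_poly_remainder[of "f 0" T "f 1" "f 2" "f 3" x "A 3" "A 4" "A 5" y]
    unfolding B1_def B2_def B3_def defs by simp_all
  define C' where "C' = \<bar>C\<bar>"
  obtain K1 where K1: "K1 \<ge> 0" "\<And>T x y. cmod T \<le> 1 \<Longrightarrow> cmod x \<le> C' \<Longrightarrow> cmod y \<le> C' \<Longrightarrow> cmod (B1 T x y) \<le> K1"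
    by (rule continuous_bounded_on_cballs[of "\<lambda>(T, x, y). B1 T x y" C'])
       (auto simp: B1_def defs split_beta intro!: continuous_intros)
  obtain K2 where K2: "K2 \<ge> 0" "\<And>T x y. cmod T \<le> 1 \<Longrightarrow> cmod x \<le> C' \<Longrightarrow> cmod y \<le> C' \<Longrightarrow> cmod (B2 T x y) \<le> K2"
    by (rule continuous_bounded_on_cballs[of "\<lambda>(T, x, y). B2 T x y" C'])
       (auto simp: B2_def defs split_beta intro!: continuous_intros)
  obtain K3 where K3: "K3 \<ge> 0" "\<And>T x y. cmod T \<le> 1 \<Longrightarrow> cmod x \<le> C' \<Longrightarrow> cmod y \<le> C' \<Longrightarrow> cmod (B3 T x y) \<le> K3"
    by (rule continuous_bounded_on_cballs[of "\<lambda>(T, x, y). B3 T x y" C'])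
       (auto simp: B3_def defs split_beta intro!: continuous_intros)
  obtain KF where KF: "KF \<ge> 0" "\<And>T x y. cmod T \<le> 1 \<Longrightarrow> cmod x \<le> C' \<Longrightarrow> cmod y \<le> C' \<Longrightarrow> cmod (F0 T x) \<le> KF"
    by (rule continuous_bounded_on_cballs[of "\<lambda>(T, x, y). F0 T x" C'])
       (auto simp: defs split_beta intro!: continuous_intros)
  obtain KR where KR: "KR \<ge> 0" "\<And>T x y. cmod T \<le> 1 \<Longrightarrow> cmod x \<le> C' \<Longrightarrow> cmod y \<le> C' \<Longrightarrow> cmod (R T y) \<le> KR"
    by (rule continuous_bounded_on_cballs[of "\<lambda>(T, x, y). R T y" C'])
       (auto simp: defs split_beta intro!: continuous_intros)
  \<comment> \<open>On this range the higher phase satisfies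
    \<open>cmod z \<le> \<kappa> / 4 * Y\<close>, half of the Gaussian exponent
    \<open>\<kappa> / 2 * Y\<close>. The summand 1 in the denominator covers
    \<open>KR = 0\<close>.\<close>
  define \<delta> where "\<delta> = min 1 (\<kappa> / (4 * (KR + 1)))"
  define L where "L = C' + K1 + K2 + K3 + KF * KR^4"
  have L: "L \<ge> 0" "C' \<le> L" "K1 \<le> L" "K2 \<le> L" "K3 \<le> L" "KF * KR^4 \<le> L"
    using K1(1) K2(1) K3(1) KF(1) KR(1) by (auto simp: L_def C'_def)
  have b: "\<kappa> / 8 > 0" using \<kappa> by simp
  define M where "M j = (SOME M. \<forall>y\<ge>0. y ^ j * exp (- (\<kappa> / 8) * y) \<le> M)" for j
  have M: "y ^ j * exp (- (\<kappa> / 8) * y) \<le> M j" if "y \<ge> 0" for y j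
  proof -
    have "\<exists>M. \<forall>y\<ge>0. y ^ j * exp (- (\<kappa> / 8) * y) \<le> M"
      using power_exp_bound[OF b, of j] by metis
    from someI_ex[OF this] that show ?thesis unfolding M_def by blast
  qed
  define K where "K = L * (M 2 + M 3 + M 4 + M 5 + M 6)"
  show ?thesis
  proof (rule that[of \<delta> "max 0 K"])
    show "\<delta> > 0" "\<delta> \<le> 1" using \<kappa> KR(1) by (auto simp: \<delta>_def)
    fix t N :: real and F r :: complex
    assume t: "\<bar>t\<bar> \<le> \<delta>" and N: "N > 0"
      and F: "cmod (F - (f 0 + f 1 * of_real t + f 2 * of_real t^2 + f 3 * of_real t^3)) \<le> C * t^4"
      and r: "cmod (r - (A 3 * of_real t^3 + A 4 * of_real t^4 + A 5 * of_real t^5)) \<le> C * t^6"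
    define T where "T = complex_of_real t"
    have T1: "cmod T \<le> 1" using t by (simp add: T_def \<delta>_def)
    obtain x where x: "F = F0 T x" "cmod x \<le> C'"
    proof
      define x where "x = (F - (f 0 + f 1 * of_real t + f 2 * of_real t^2 + f 3 * of_real t^3)) / T^4"
      show "cmod x \<le> C'" unfolding x_def C'_def
        by (rule norm_quotient_le[OF F T_def]) simp
      show "F = F0 T x"
      proof (cases "t = 0")
        case True thus ?thesis using F by (simp add: defs T_def)
      next
        case False
        hence "F = (f 0 + f 1 * of_real t + f 2 * of_real t^2 + f 3 * of_real t^3) + T^4 * x" by (simp add: x_def T_def)
        thus ?thesis unfolding defs T_def[symmetric] of_real_power by algebra
      qed
    qed
    obtain y where y: "r = T^3 * R T y" "cmod y \<le> C'"
    proof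
      define y where "y = (r - (A 3 * of_real t^3 + A 4 * of_real t^4 + A 5 * of_real t^5)) / T^6"
      show "cmod y \<le> C'" unfolding y_def C'_def
        by (rule norm_quotient_le[OF r T_def]) simp
      show "r = T^3 * R T y"
      proof (cases "t = 0")
        case True thus ?thesis using r by (simp add: defs T_def)
      next
        case False
        hence "r = (A 3 * of_real t^3 + A 4 * of_real t^4 + A 5 * of_real t^5) + T^6 * y" by (simp add: y_def T_def)
        thus ?thesis unfolding defs T_def[symmetric] of_real_power by algebra
      qed
    qed
    define z where "z = of_real N * r"
    \<comment> \<open>In this variable each error term is a power of \<open>Y\<close> times
      \<open>t^4\<close>, and \<open>t^4 = Y^2 / N^2\<close> produces the factor
      \<open>1 / N^2\<close>.\<close>
    define Y where "Y = N * t\<^sup>2"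
    have Y: "Y \<ge> 0" using N by (simp add: Y_def)
    have zY: "cmod z \<le> Y * \<bar>t\<bar> * KR"
    proof -
      have "cmod z = N * \<bar>t\<bar>^3 * cmod (R T y)" using N by (simp add: z_def y(1) T_def norm_mult norm_power)
      also have "\<dots> \<le> N * \<bar>t\<bar>^3 * KR" using N KR(2)[OF T1 x(2) y(2)] by (intro mult_left_mono) auto
      also have "N * \<bar>t\<bar>^3 = Y * \<bar>t\<bar>" by (simp add: Y_def power3_eq_cube power2_eq_square)
      finally show ?thesis .
    qed
    have z4: "cmod z ^ 4 \<le> Y^4 * t^4 * KR^4"
      using power_mono[OF zY, of 4] by (simp add: power_mult_distrib)
    have zk: "cmod z \<le> \<kappa> / 4 * Y"
    proof -
      have "\<bar>t\<bar> * KR \<le> \<kappa> / (4 * (KR + 1)) * (KR + 1)" using t KR(1) \<kappa> by (intro mult_mono) (auto simp: \<delta>_def)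
      also have "\<dots> = \<kappa> / 4" using KR(1) by (simp add: field_simps)
      finally show ?thesis using zY mult_left_mono[of "\<bar>t\<bar> * KR" "\<kappa> / 4" Y] Y by (simp add: mult_ac)
    qed
    define D where "D = F * exp z - saddle_poly f A N T"
    have "F * (1 + z + z^2 / 2 + z^3 / 6) - saddle_poly f A N T
       = T^4 * x + of_real N * T^6 * B1 T x y + (of_real N)^2 * T^8 / 2 * B2 T x y + (of_real N)^3 * T^10 / 6 * B3 T x y"
    proof -
      have "F * z = of_real N * (T^3 * (F0 T x * R T y))" by (simp add: z_def x y)
      moreover have "F * z^2 = (of_real N)^2 * (T^6 * (F0 T x * (R T y)^2))"
        by (simp add: z_def x y power_mult_distrib mult_ac flip: power_mult)
      moreover have "F * z^3 = (of_real N)^3 * (T^9 * (F0 T x * (R T y)^3))"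
        by (simp add: z_def x y power_mult_distrib mult_ac flip: power_mult)
      moreover have "F = f 0 + f 1 * T + f 2 * T^2 + f 3 * T^3 + T^4 * x"
        unfolding x(1) defs by algebra
      moreover have "F * (1 + z + z^2 / 2 + z^3 / 6) = F + F * z + F * z^2 / 2 + F * z^3 / 6"
        by (simp add: algebra_simps)
      ultimately have eq: "F * (1 + z + z^2 / 2 + z^3 / 6) = f 0 + f 1 * T + f 2 * T^2 + f 3 * T^3 + T^4 * x
         + of_real N * (T^3 * (f 0 * A 3 + (f 0 * A 4 + f 1 * A 3) * T + (f 0 * A 5 + f 1 * A 4 + f 2 * A 3) * T^2 + T^3 * B1 T x y))
         + (of_real N)^2 * (T^6 * (f 0 * (A 3)^2 + (2 * f 0 * A 3 * A 4 + f 1 * (A 3)^2) * T + T^2 * B2 T x y)) / 2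
         + (of_real N)^3 * (T^9 * (f 0 * (A 3)^3 + T * B3 T x y)) / 6"
        unfolding e1 e2 e3 by simp
      have alg: "a0 + a1 * T + a2 * T^2 + a3 * T^3 + T^4 * x + n * (T^3 * (b0 + b1 * T + b2 * T^2 + T^3 * B1))
           + h2 * (T^6 * (c0 + c1 * T + T^2 * B2)) + h3 * (T^9 * (d0 + T * B3))
           - (a0 + a1 * T + a2 * T^2 + a3 * T^3 + n * (b0 * T^3 + b1 * T^4 + b2 * T^5) + h2 * (c0 * T^6 + c1 * T^7) + h3 * (d0 * T^9))
         = T^4 * x + n * T^6 * B1 + h2 * T^8 * B2 + h3 * T^10 * B3"
        for a0 a1 a2 a3 b0 b1 b2 c0 c1 d0 B1 B2 B3 n h2 h3 :: complex
        by algebra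
      show ?thesis unfolding eq saddle_poly_def
        using alg[of "f 0" "f 1" "f 2" "f 3" "of_real N" "f 0 * A 3" "f 0 * A 4 + f 1 * A 3" "f 0 * A 5 + f 1 * A 4 + f 2 * A 3" "B1 T x y"
           "(of_real N)^2 / 2" "f 0 * (A 3)^2" "2 * f 0 * A 3 * A 4 + f 1 * (A 3)^2" "B2 T x y" "(of_real N)^3 / 6" "f 0 * (A 3)^3" "B3 T x y"]
        by (simp only: times_divide_eq_left times_divide_eq_right)
    qed
    hence Deq: "D = T^4 * x + of_real N * T^6 * B1 T x y + (of_real N)^2 * T^8 / 2 * B2 T x y + (of_real N)^3 * T^10 / 6 * B3 T x y
        + F * (exp z - (1 + z + z^2 / 2 + z^3 / 6))"
      by (simp add: D_def algebra_simps)
    have "cmod D \<le> cmod (T^4 * x) + cmod (of_real N * T^6 * B1 T x y) + cmod ((of_real N)^2 * T^8 / 2 * B2 T x y)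
        + cmod ((of_real N)^3 * T^10 / 6 * B3 T x y) + cmod (F * (exp z - (1 + z + z^2 / 2 + z^3 / 6)))"
      unfolding Deq by (intro norm_triangle_le add_mono order_refl)
    also have "\<dots> \<le> t^4 * L + Y * t^4 * L + Y^2 * t^4 * L + Y^3 * t^4 * L + exp (\<kappa> / 4 * Y) * (Y^4 * t^4 * L)"
    proof (intro add_mono)
      show "cmod (T^4 * x) \<le> t^4 * L" using x(2) L by (auto simp: norm_mult norm_power T_def intro!: mult_left_mono)
      have "cmod (B1 T x y) \<le> L" "cmod (B2 T x y) \<le> 2 * L" "cmod (B3 T x y) \<le> 6 * L"
        using K1(2)[OF T1 x(2) y(2)] K2(2)[OF T1 x(2) y(2)] K3(2)[OF T1 x(2) y(2)] L by linarith+
      note B = this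
      have "cmod (of_real N * T^6 * B1 T x y) = Y * t^4 * cmod (B1 T x y)"
        using N by (simp add: norm_mult norm_power T_def Y_def eval_nat_numeral)
      also have "\<dots> \<le> Y * t^4 * L" using B Y by (intro mult_left_mono) auto
      finally show "cmod (of_real N * T^6 * B1 T x y) \<le> Y * t^4 * L" .
      have "cmod ((of_real N)^2 * T^8 / 2 * B2 T x y) = Y^2 * t^4 * (cmod (B2 T x y) / 2)"
        using N by (simp add: norm_mult norm_power norm_divide T_def Y_def eval_nat_numeral)
      also have "\<dots> \<le> Y^2 * t^4 * L" using B Y by (intro mult_left_mono) auto
      finally show "cmod ((of_real N)^2 * T^8 / 2 * B2 T x y) \<le> Y^2 * t^4 * L" .
      have "cmod ((of_real N)^3 * T^10 / 6 * B3 T x y) = Y^3 * t^4 * (cmod (B3 T x y) / 6)"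
        using N by (simp add: norm_mult norm_power norm_divide T_def Y_def eval_nat_numeral)
      also have "\<dots> \<le> Y^3 * t^4 * L" using B Y by (intro mult_left_mono) auto
      finally show "cmod ((of_real N)^3 * T^10 / 6 * B3 T x y) \<le> Y^3 * t^4 * L" .
      have "cmod (F * (exp z - (1 + z + z^2 / 2 + z^3 / 6))) \<le> KF * (exp (cmod z) * cmod z ^ 4)"
        unfolding norm_mult using KF(2)[OF T1 x(2) y(2)] KF(1) exp_cubic_remainder[of z] by (intro mult_mono) (auto simp: x)
      also have "\<dots> \<le> KF * (exp (\<kappa> / 4 * Y) * (Y^4 * t^4 * KR^4))"
        using KF(1) zk z4 by (intro mult_left_mono mult_mono) auto
      also have "\<dots> = exp (\<kappa> / 4 * Y) * (Y^4 * t^4) * (KF * KR^4)" by (simp add: mult_ac)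
      also have "\<dots> \<le> exp (\<kappa> / 4 * Y) * (Y^4 * t^4) * L" using L by (intro mult_left_mono) auto
      finally show "cmod (F * (exp z - (1 + z + z^2 / 2 + z^3 / 6))) \<le> exp (\<kappa> / 4 * Y) * (Y^4 * t^4 * L)" by (simp add: mult_ac)
    qed
    also have "\<dots> \<le> exp (\<kappa> / 4 * Y) * (t^4 * L * (1 + Y + Y^2 + Y^3 + Y^4))"
    proof -
      have "1 \<le> exp (\<kappa> / 4 * Y)" using Y \<kappa> by simp
      hence "1 * (t^4 * L * (1 + Y + Y^2 + Y^3)) \<le> exp (\<kappa> / 4 * Y) * (t^4 * L * (1 + Y + Y^2 + Y^3))"
        using Y L(1) by (intro mult_right_mono) auto
      thus ?thesis by (simp add: algebra_simps)
    qed
    finally have "exp (- (\<kappa> / 2 * Y)) * cmod D \<le> exp (- (\<kappa> / 2 * Y)) * (exp (\<kappa> / 4 * Y) * (t^4 * L * (1 + Y + Y^2 + Y^3 + Y^4)))"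
      by (intro mult_left_mono) auto
    \<comment> \<open>The remaining exponent \<open>\<kappa> / 4 * Y\<close> is split evenly: one
      part absorbs the powers \<open>Y^2\<close> to \<open>Y^6\<close>, the other stays as the
      integrable majorant.\<close>
    also have "\<dots> = L / N\<^sup>2 * exp (- (\<kappa> / 8 * Y)) * (exp (- (\<kappa> / 8) * Y) * (Y^2 * (1 + Y + Y^2 + Y^3 + Y^4)))"
    proof -
      have "exp (- (\<kappa> / 2 * Y)) * exp (\<kappa> / 4 * Y) = exp (- (\<kappa> / 8 * Y)) * exp (- (\<kappa> / 8) * Y)"
        by (simp flip: exp_add)
      moreover have "t^4 = Y^2 / N^2" using N by (simp add: Y_def power_mult_distrib flip: power_mult)
      ultimately show ?thesis by (simp add: mult_ac)
    qed
    also have "\<dots> \<le> L / N\<^sup>2 * exp (- (\<kappa> / 8 * Y)) * (M 2 + M 3 + M 4 + M 5 + M 6)"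
    proof (intro mult_left_mono)
      have "exp (- (\<kappa> / 8) * Y) * (Y^2 * (1 + Y + Y^2 + Y^3 + Y^4)) = Y^2 * exp (- (\<kappa> / 8) * Y) + Y^3 * exp (- (\<kappa> / 8) * Y)
        + Y^4 * exp (- (\<kappa> / 8) * Y) + Y^5 * exp (- (\<kappa> / 8) * Y) + Y^6 * exp (- (\<kappa> / 8) * Y)"
        by (simp add: algebra_simps eval_nat_numeral)
      also have "\<dots> \<le> M 2 + M 3 + M 4 + M 5 + M 6" by (intro add_mono M Y)
      finally show "exp (- (\<kappa> / 8) * Y) * (Y^2 * (1 + Y + Y^2 + Y^3 + Y^4)) \<le> M 2 + M 3 + M 4 + M 5 + M 6" .
    qed (use L N in auto)
    also have "\<dots> = K / N\<^sup>2 * exp (- (\<kappa> / 8 * Y))" by (simp add: K_def)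
    also have "\<dots> \<le> max 0 K / N\<^sup>2 * exp (- (\<kappa> / 8 * Y))" by (intro mult_right_mono divide_right_mono) auto
    finally have fin: "exp (- (\<kappa> / 2 * Y)) * cmod D \<le> max 0 K / N\<^sup>2 * exp (- (\<kappa> / 8 * Y))" .
    have eY: "- N * \<kappa> * t\<^sup>2 / 2 = - (\<kappa> / 2 * Y)" by (simp add: Y_def)
    have "F * exp (of_real (- N * \<kappa> * t\<^sup>2 / 2) + of_real N * r) - of_real (exp (- N * \<kappa> * t\<^sup>2 / 2)) * saddle_poly f A N t
       = of_real (exp (- (\<kappa> / 2 * Y))) * D"
      unfolding eY exp_add exp_of_real D_def z_def T_def by (simp only: right_diff_distrib mult_ac)
    hence "cmod (F * exp (of_real (- N * \<kappa> * t\<^sup>2 / 2) + of_real N * r) - of_real (exp (- N * \<kappa> * t\<^sup>2 / 2)) * saddle_poly f A N t)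
       = exp (- (\<kappa> / 2 * Y)) * cmod D" by (simp add: norm_mult)
    thus "cmod (F * exp (of_real (- N * \<kappa> * t\<^sup>2 / 2) + of_real N * r) - of_real (exp (- N * \<kappa> * t\<^sup>2 / 2)) * saddle_poly f A N t)
         \<le> max 0 K / N\<^sup>2 * exp (- (N * (\<kappa> / 8) * t\<^sup>2))"
      using fin by (simp add: Y_def mult_ac)
  qed simp
qed

lemma abs_power_le_one_plus_square:
  fixes t :: real assumes "j \<le> 2 * m"
  shows "\<bar>t\<bar> ^ j \<le> (1 + t\<^sup>2) ^ m"
proof (cases "\<bar>t\<bar> \<le> 1")
  case True
  have "\<bar>t\<bar> ^ j \<le> 1" using True by (simp add: power_le_one)
  also have "1 \<le> (1 + t\<^sup>2) ^ m" by (rule one_le_power) simp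
  finally show ?thesis .
next
  case False
  hence "\<bar>t\<bar> ^ j \<le> \<bar>t\<bar> ^ (2 * m)" using assms by (intro power_increasing) auto
  also have "\<dots> = (t\<^sup>2) ^ m" by (simp add: power_mult)
  also have "\<dots> \<le> (1 + t\<^sup>2) ^ m" by (intro power_mono) auto
  finally show ?thesis .
qed

lemma norm_saddle_poly_le:
  obtains K where "K \<ge> 0" "\<And>(N::real) (t::real). N \<ge> 1 \<Longrightarrow> cmod (saddle_poly f A N t) \<le> K * N ^ 3 * (1 + t\<^sup>2) ^ 5"
proof -
  \<comment> \<open>One entry per monomial: the exponent of \<open>N\<close>, the exponent of
    \<open>t\<close>, the coefficient. The largest exponents are 3 and 9, which explains
    \<open>N ^ 3\<close> and the fifth power of \<open>1 + t\<^sup>2\<close>.\<close>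
  define c :: "(nat \<times> nat \<times> complex) list" where "c = [(0, 0, f 0), (0, 1, f 1), (0, 2, f 2), (0, 3, f 3), (1, 3, f 0 * A 3), (1, 4, f 0 * A 4 + f 1 * A 3),
     (1, 5, f 0 * A 5 + f 1 * A 4 + f 2 * A 3), (2, 6, f 0 * (A 3)^2 / 2), (2, 7, (2 * f 0 * A 3 * A 4 + f 1 * (A 3)^2) / 2), (3, 9, f 0 * (A 3)^3 / 6)]"
  show ?thesis
  proof (rule that[of "\<Sum>(i, j, w)\<leftarrow>c. cmod w"])
    show "0 \<le> (\<Sum>(i, j, w)\<leftarrow>c. cmod w)" by (simp add: c_def)
    fix N t :: real assume N: "N \<ge> 1"
    have "saddle_poly f A N t = (\<Sum>(i, j, w)\<leftarrow>c. w * of_real (N ^ i * t ^ j))"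
      by (simp add: saddle_poly_def c_def algebra_simps)
    also have "cmod \<dots> \<le> (\<Sum>(i, j, w)\<leftarrow>c. cmod w * (N ^ i * \<bar>t\<bar> ^ j))"
    proof (induction c)
      case (Cons p c)
      obtain i j w where p: "p = (i, j, w)" by (cases p)
      have "cmod (w * of_real (N ^ i * t ^ j)) = cmod w * (N ^ i * \<bar>t\<bar> ^ j)"
        unfolding norm_mult norm_of_real using N by (simp add: abs_mult power_abs)
      thus ?case using Cons norm_triangle_ineq[of "w * of_real (N ^ i * t ^ j)" "\<Sum>(i, j, w)\<leftarrow>c. w * of_real (N ^ i * t ^ j)"]
        unfolding p by (simp only: list.map sum_list.Cons case_prod_conv)
    qed simp
    also have "\<dots> \<le> (\<Sum>(i, j, w)\<leftarrow>c. cmod w * (N ^ 3 * (1 + t\<^sup>2) ^ 5))"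
    proof (rule sum_list_mono, clarify)
      fix i j w assume "(i, j, w) \<in> set c"
      hence ij: "i \<le> 3" "j \<le> 2 * 5" by (auto simp: c_def)
      show "cmod w * (N ^ i * \<bar>t\<bar> ^ j) \<le> cmod w * (N ^ 3 * (1 + t\<^sup>2) ^ 5)"
        using N ij by (intro mult_left_mono mult_mono power_increasing abs_power_le_one_plus_square) auto
    qed
    also have "\<dots> = (\<Sum>(i, j, w)\<leftarrow>c. cmod w) * N ^ 3 * (1 + t\<^sup>2) ^ 5"
      by (induction c) (auto simp: algebra_simps)
    finally show "cmod (saddle_poly f A N t) \<le> (\<Sum>(i, j, w)\<leftarrow>c. cmod w) * N ^ 3 * (1 + t\<^sup>2) ^ 5" .
  qed
qed

lemma norm_cubic_le:
  fixes f :: "nat \<Rightarrow> complex"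
  assumes "cmod (F - (f 0 + f 1 * of_real t + f 2 * of_real t^2 + f 3 * of_real t^3)) \<le> C * t^4"
  shows "cmod F \<le> (cmod (f 0) + cmod (f 1) + cmod (f 2) + cmod (f 3) + \<bar>C\<bar>) * (1 + t\<^sup>2) ^ 2"
proof -
  let ?p = "f 0 + f 1 * complex_of_real t + f 2 * of_real t^2 + f 3 * of_real t^3"
  have "cmod F \<le> cmod ?p + cmod (F - ?p)" using norm_triangle_ineq[of ?p "F - ?p"] by simp
  also have "cmod ?p \<le> cmod (f 0) * \<bar>t\<bar>^0 + cmod (f 1) * \<bar>t\<bar>^1 + cmod (f 2) * \<bar>t\<bar>^2 + cmod (f 3) * \<bar>t\<bar>^3"
    by (intro norm_triangle_le add_mono) (simp_all add: norm_mult norm_power)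
  also have "\<dots> \<le> cmod (f 0) * (1 + t\<^sup>2)^2 + cmod (f 1) * (1 + t\<^sup>2)^2 + cmod (f 2) * (1 + t\<^sup>2)^2 + cmod (f 3) * (1 + t\<^sup>2)^2"
    by (intro add_mono mult_left_mono abs_power_le_one_plus_square) auto
  also have "cmod (F - ?p) \<le> \<bar>C\<bar> * (1 + t\<^sup>2)^2"
  proof -
    have "cmod (F - ?p) \<le> C * t^4" using assms by simp
    also have "\<dots> \<le> \<bar>C\<bar> * \<bar>t\<bar>^4" by (intro mult_mono) auto
    also have "\<dots> \<le> \<bar>C\<bar> * (1 + t\<^sup>2)^2" by (intro mult_left_mono abs_power_le_one_plus_square) auto
    finally show ?thesis .
  qed
  finally show ?thesis by (simp add: algebra_simps)
qed

text \<open>Away from the origin the two terms are bounded separately. Twelve factors of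
  \<open>\<Phi>\<close> give three inverse powers of \<open>1 + t\<^sup>2\<close> up to a constant:
  two offset the growth of the weight and one remains for integrability. The other
  \<open>n - 12\<close> factors are bounded by a number below one and beat every power of
  \<open>n\<close>.\<close>

lemma saddle_far:
  fixes f A :: "nat \<Rightarrow> complex" and C \<kappa> a \<delta> :: real
  assumes \<kappa>: "\<kappa> > 0" and a: "a > 0" and \<delta>: "\<delta> > 0"
  obtains K where "K \<ge> 0"
    "\<And>(t::real) n F \<Phi>. \<delta> \<le> \<bar>t\<bar> \<Longrightarrow> n \<ge> 12 \<Longrightarrow>
       cmod (F - (f 0 + f 1 * of_real t + f 2 * of_real t^2 + f 3 * of_real t^3)) \<le> C * t^4 \<Longrightarrow>
       cmod \<Phi> ^ 4 \<le> 1 / (1 + a * t\<^sup>2) \<Longrightarrow>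
       cmod (F * \<Phi> ^ n - of_real (exp (- real n * \<kappa> * t\<^sup>2 / 2)) * saddle_poly f A (of_real (real n)) t)
         \<le> K / real n ^ 3 * inverse (1 + t\<^sup>2)"
proof -
  define K1 where "K1 = cmod (f 0) + cmod (f 1) + cmod (f 2) + cmod (f 3) + \<bar>C\<bar>"
  have K1: "K1 \<ge> 0" by (simp add: K1_def)
  obtain K2 where K2: "K2 \<ge> 0" "\<And>(N::real) (t::real). N \<ge> 1 \<Longrightarrow> cmod (saddle_poly f A N t) \<le> K2 * N ^ 3 * (1 + t\<^sup>2) ^ 5"
    using norm_saddle_poly_le[of f A] by metis
  \<comment> \<open>Chosen so that the decay hypothesis at distance \<open>\<delta>\<close> reads
    \<open>cmod \<Phi> \<le> exp (- b)\<close>.\<close>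
  define b where "b = ln (1 + a * \<delta>\<^sup>2) / 4"
  have b: "b > 0" using a \<delta> by (auto simp: b_def intro!: divide_pos_pos ln_gt_zero)
  obtain M3 where M3: "M3 \<ge> 0" "\<And>y. y \<ge> 0 \<Longrightarrow> y ^ 3 * exp (- b * y) \<le> M3"
    using power_exp_bound[OF b, of 3] by metis
  have "\<kappa> * \<delta>\<^sup>2 / 4 > 0" using \<kappa> \<delta> by simp
  then obtain M6 where M6: "M6 \<ge> 0" "\<And>y. y \<ge> 0 \<Longrightarrow> y ^ 6 * exp (- (\<kappa> * \<delta>\<^sup>2 / 4) * y) \<le> M6"
    using power_exp_bound[of "\<kappa> * \<delta>\<^sup>2 / 4" 6] by metis
  have "\<kappa> / 4 > 0" using \<kappa> by simp
  then obtain M where M: "M \<ge> 0" "\<And>y. y \<ge> 0 \<Longrightarrow> y ^ 6 * exp (- (\<kappa> / 4) * y) \<le> M"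
    using power_exp_bound[of "\<kappa> / 4" 6] by metis
  \<comment> \<open>With this choice \<open>1 + a * t\<^sup>2\<close> dominates
    \<open>a' * (1 + t\<^sup>2)\<close>, whichever of \<open>a\<close> and 1 is larger.\<close>
  define a' where "a' = min a 1"
  have a': "a' > 0" "a' \<le> a" "a' \<le> 1" using a by (auto simp: a'_def)
  define Ka where "Ka = K1 * (1 / a') ^ 3 * (exp (12 * b) * M3)"
  define Kb where "Kb = M6 * K2 * (exp (\<kappa> / 4) * M)"
  show ?thesis
  proof (rule that[of "Ka + Kb"])
    show "0 \<le> Ka + Kb" using K1 K2 M3 M6 M a' by (simp add: Ka_def Kb_def)
    fix t :: real and n :: nat and F \<Phi> :: complex
    assume t: "\<delta> \<le> \<bar>t\<bar>" and n: "n \<ge> 12"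
      and F: "cmod (F - (f 0 + f 1 * of_real t + f 2 * of_real t^2 + f 3 * of_real t^3)) \<le> C * t^4"
      and \<Phi>: "cmod \<Phi> ^ 4 \<le> 1 / (1 + a * t\<^sup>2)"
    define y where "y = 1 + t\<^sup>2"
    have y: "y \<ge> 1" by (simp add: y_def)
    have t2: "\<delta>\<^sup>2 \<le> t\<^sup>2" using power_mono[OF t, of 2] \<delta> by simp
    have n0: "real n > 0" using n by simp
    have 1: "cmod (F * \<Phi> ^ n) \<le> Ka / real n ^ 3 * inverse y"
    proof -
      have "1 + a * t\<^sup>2 \<ge> a' * y" using a' mult_right_mono[OF a'(2), of "t\<^sup>2"] by (simp add: y_def algebra_simps)
      hence "1 / (1 + a * t\<^sup>2) \<le> 1 / (a' * y)" using a' y by (intro divide_left_mono) (auto intro!: mult_pos_pos add_pos_nonneg)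
      hence "cmod \<Phi> ^ 4 \<le> 1 / (a' * y)" using \<Phi> by linarith
      from power_mono[OF this, of 3] have 12: "cmod \<Phi> ^ 12 \<le> (1 / (a' * y)) ^ 3" by (simp flip: power_mult)
      have "cmod \<Phi> ^ 4 \<le> exp (- b) ^ 4"
      proof -
        have "exp (- b) ^ 4 = exp (- ln (1 + a * \<delta>\<^sup>2))" by (simp add: b_def flip: exp_of_nat_mult)
        also have "\<dots> = 1 / (1 + a * \<delta>\<^sup>2)" using a by (simp add: exp_minus inverse_eq_divide add_pos_nonneg)
        also have "1 / (1 + a * t\<^sup>2) \<le> \<dots>" using a t2 by (intro divide_left_mono) (auto intro!: mult_pos_pos add_pos_nonneg mult_left_mono)
        finally show ?thesis using \<Phi> by linarith
      qed
      hence q: "cmod \<Phi> \<le> exp (- b)" using power_le_imp_le_base[of "cmod \<Phi>" 3 "exp (- b)"] by simp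
      have "cmod \<Phi> ^ (n - 12) \<le> exp (- b) ^ (n - 12)" using q by (intro power_mono) auto
      also have "\<dots> = exp (12 * b) * exp (- b * n)"
        using n by (simp add: of_nat_diff algebra_simps flip: exp_of_nat_mult exp_add)
      also have "exp (- b * n) \<le> M3 / real n ^ 3" using M3(2)[of "real n"] n0 by (simp add: field_simps)
      finally have r: "cmod \<Phi> ^ (n - 12) \<le> exp (12 * b) * (M3 / real n ^ 3)" by simp
      have "cmod (F * \<Phi> ^ n) = cmod F * (cmod \<Phi> ^ 12 * cmod \<Phi> ^ (n - 12))"
        using n by (simp add: norm_mult norm_power flip: power_add)
      also have "\<dots> \<le> (K1 * y ^ 2) * ((1 / (a' * y)) ^ 3 * (exp (12 * b) * (M3 / real n ^ 3)))"
        using norm_cubic_le[OF F] 12 r y a' K1 M3 n0 by (intro mult_mono) (auto simp: K1_def y_def)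
      also have "\<dots> = Ka / real n ^ 3 * inverse y"
        using y a' by (simp add: Ka_def field_simps eval_nat_numeral)
      finally show ?thesis .
    qed
    have 2: "cmod (of_real (exp (- real n * \<kappa> * t\<^sup>2 / 2)) * saddle_poly f A (of_real (real n)) t) \<le> Kb / real n ^ 3 * inverse y"
    proof -
      \<comment> \<open>Half of the Gaussian exponent is evaluated at \<open>\<delta>\<close> and
        decays in \<open>n\<close>; the other half, with \<open>n\<close> replaced by 1, decays in
        \<open>t\<close>. Sixth powers of both beat the growth \<open>n^3 * y^5\<close> of the
        polynomial and leave \<open>n^(-3) * y^(-1)\<close>.\<close>
      have "real n * \<kappa> * \<delta>\<^sup>2 \<le> real n * \<kappa> * t\<^sup>2" using t2 n0 \<kappa> by (intro mult_left_mono) auto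
      moreover have "1 * (\<kappa> * t\<^sup>2) \<le> real n * (\<kappa> * t\<^sup>2)" using n \<kappa> by (intro mult_right_mono) auto
      ultimately have "- real n * \<kappa> * t\<^sup>2 / 2 \<le> - (\<kappa> * \<delta>\<^sup>2 / 4) * real n + (\<kappa> / 4 + - (\<kappa> / 4) * y)"
        by (simp add: y_def algebra_simps)
      hence "exp (- real n * \<kappa> * t\<^sup>2 / 2) \<le> exp (- (\<kappa> * \<delta>\<^sup>2 / 4) * real n + (\<kappa> / 4 + - (\<kappa> / 4) * y))" by simp
      also have "\<dots> = exp (- (\<kappa> * \<delta>\<^sup>2 / 4) * real n) * (exp (\<kappa> / 4) * exp (- (\<kappa> / 4) * y))" by (simp only: exp_add)
      also have "\<dots> \<le> (M6 / real n ^ 6) * (exp (\<kappa> / 4) * (M / y ^ 6))"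
        using M6(2)[of "real n"] M(2)[of y] n0 y M6(1) by (intro mult_mono) (auto simp: field_simps)
      finally have e: "exp (- real n * \<kappa> * t\<^sup>2 / 2) \<le> (M6 / real n ^ 6) * (exp (\<kappa> / 4) * (M / y ^ 6))" .
      have "cmod (of_real (exp (- real n * \<kappa> * t\<^sup>2 / 2)) * saddle_poly f A (of_real (real n)) t)
         \<le> (M6 / real n ^ 6) * (exp (\<kappa> / 4) * (M / y ^ 6)) * (K2 * real n ^ 3 * y ^ 5)"
        unfolding norm_mult norm_of_real y_def using e[unfolded y_def] K2(2)[of "real n" t] K2(1) n M6(1) M(1)
        by (intro mult_mono) auto
      also have "\<dots> = Kb / real n ^ 3 * inverse y"
        using y n0 by (simp add: Kb_def field_simps eval_nat_numeral)
      finally show ?thesis .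
    qed
    show "cmod (F * \<Phi> ^ n - of_real (exp (- real n * \<kappa> * t\<^sup>2 / 2)) * saddle_poly f A (of_real (real n)) t)
         \<le> (Ka + Kb) / real n ^ 3 * inverse (1 + t\<^sup>2)"
      using norm_triangle_ineq4[of "F * \<Phi> ^ n" "of_real (exp (- real n * \<kappa> * t\<^sup>2 / 2)) * saddle_poly f A (of_real (real n)) t"] 1 2
      unfolding y_def by (simp only: add_divide_distrib distrib_right)
  qed
qed

section \<open>Gaussian moments and the integrated expansion\<close>

lemma gaussian_moments:
  fixes v :: real
  assumes v: "v > 0"
  shows "has_bochner_integral lborel (\<lambda>t. complex_of_real (exp (- v * t\<^sup>2 / 2)) * of_real t ^ (2 * k))
           (of_real (sqrt (2 * pi / v) * (fact (2 * k) / ((2 * v) ^ k * fact k))))" (is ?even)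
    and "has_bochner_integral lborel (\<lambda>t. complex_of_real (exp (- v * t\<^sup>2 / 2)) * of_real t ^ (2 * k + 1)) 0" (is ?odd)
proof -
  define \<sigma> where "\<sigma> = 1 / sqrt v"
  have \<sigma>: "\<sigma> > 0" "\<sigma>\<^sup>2 = 1 / v" using v by (auto simp: \<sigma>_def power_divide)
  have e: "sqrt (2 * pi / v) * normal_density 0 \<sigma> t = exp (- v * t\<^sup>2 / 2)" for t
    using v by (simp add: normal_density_def \<sigma>(2) mult.commute)
  have "has_bochner_integral lborel (\<lambda>t. sqrt (2 * pi / v) * (normal_density 0 \<sigma> t * (t - 0) ^ (2 * k)))
      (sqrt (2 * pi / v) * (fact (2 * k) / ((2 / \<sigma>\<^sup>2) ^ k * fact k)))"
    by (intro has_bochner_integral_mult_right normal_moment_even \<sigma>)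
  hence "has_bochner_integral lborel (\<lambda>t. exp (- v * t\<^sup>2 / 2) * t ^ (2 * k))
      (sqrt (2 * pi / v) * (fact (2 * k) / ((2 * v) ^ k * fact k)))"
    by (simp only: e \<sigma>(2) mult.assoc[symmetric] diff_0_right) simp
  from has_bochner_integral_of_real[OF this, where ?'a = complex] show ?even
    by (simp only: of_real_mult of_real_power)
  have "has_bochner_integral lborel (\<lambda>t. sqrt (2 * pi / v) * (normal_density 0 \<sigma> t * (t - 0) ^ (2 * k + 1))) (sqrt (2 * pi / v) * 0)"
    by (intro has_bochner_integral_mult_right normal_moment_odd \<sigma>)
  hence "has_bochner_integral lborel (\<lambda>t. exp (- v * t\<^sup>2 / 2) * t ^ (2 * k + 1)) 0"
    by (simp only: e mult.assoc[symmetric] diff_0_right mult_zero_right)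
  from has_bochner_integral_of_real[OF this, where ?'a = complex] show ?odd
    by (simp only: of_real_mult of_real_power of_real_0)
qed

text \<open>With \<open>V = N * \<kappa>\<close> the even moments are 1, \<open>1/V\<close>,
  \<open>3/V^2\<close>, \<open>15/V^3\<close>. The prefactors \<open>N\<close> and
  \<open>N^2/2\<close> bring the quartic and sextic terms to the same order \<open>1/N\<close> as
  the quadratic one.\<close>

lemma integral_saddle_poly:
  fixes N \<kappa> :: real
  assumes N: "N > 0" and \<kappa>: "\<kappa> > 0"
  shows "has_bochner_integral lborel (\<lambda>t. of_real (exp (- N * \<kappa> * t\<^sup>2 / 2)) * saddle_poly f A N t)
    (of_real (sqrt (2 * pi / (N * \<kappa>))) * (f 0 + (f 2 / \<kappa> + 3 * (f 0 * A 4 + f 1 * A 3) / \<kappa>\<^sup>2 + 15 * f 0 * (A 3)\<^sup>2 / (2 * \<kappa>^3)) / N))"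
proof -
  define v where "v = N * \<kappa>"
  have v: "v > 0" using N \<kappa> by (simp add: v_def)
  define s where "s = complex_of_real (sqrt (2 * pi / v))"
  define E where "E t = complex_of_real (exp (- v * t\<^sup>2 / 2))" for t
  note ev = gaussian_moments(1)[OF v, folded E_def]
  note od = gaussian_moments(2)[OF v, folded E_def]
  define N' V K where "N' = complex_of_real N" and "V = complex_of_real v" and "K = complex_of_real \<kappa>"
  have V: "V = N' * K" "N' \<noteq> 0" "K \<noteq> 0" using N \<kappa> by (auto simp: V_def v_def N'_def K_def)
  have m: "has_bochner_integral lborel (\<lambda>t. E t * of_real t ^ 0) s"
    "has_bochner_integral lborel (\<lambda>t. E t * of_real t ^ 2) (s / V)"
    "has_bochner_integral lborel (\<lambda>t. E t * of_real t ^ 4) (s * 3 / V^2)"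
    "has_bochner_integral lborel (\<lambda>t. E t * of_real t ^ 6) (s * 15 / V^3)"
    using ev[of 0] ev[of 1] ev[of 2] ev[of 3]
    by (simp_all add: s_def V_def fact_numeral power_mult_distrib mult_ac)
  have o: "has_bochner_integral lborel (\<lambda>t. E t * of_real t ^ 1) 0"
    "has_bochner_integral lborel (\<lambda>t. E t * of_real t ^ 3) 0"
    "has_bochner_integral lborel (\<lambda>t. E t * of_real t ^ 5) 0"
    "has_bochner_integral lborel (\<lambda>t. E t * of_real t ^ 7) 0"
    "has_bochner_integral lborel (\<lambda>t. E t * of_real t ^ 9) 0"
    using od[of 0] od[of 1] od[of 2] od[of 3] od[of 4] by simp_all
  have "has_bochner_integral lborel (\<lambda>t. f 0 * (E t * of_real t ^ 0) + f 1 * (E t * of_real t ^ 1) + f 2 * (E t * of_real t ^ 2)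
      + (f 3 + N' * (f 0 * A 3)) * (E t * of_real t ^ 3) + N' * (f 0 * A 4 + f 1 * A 3) * (E t * of_real t ^ 4)
      + N' * (f 0 * A 5 + f 1 * A 4 + f 2 * A 3) * (E t * of_real t ^ 5)
      + N'^2 / 2 * (f 0 * (A 3)^2) * (E t * of_real t ^ 6)
      + N'^2 / 2 * (2 * f 0 * A 3 * A 4 + f 1 * (A 3)^2) * (E t * of_real t ^ 7) + N'^3 / 6 * (f 0 * (A 3)^3) * (E t * of_real t ^ 9))
     (f 0 * s + f 1 * 0 + f 2 * (s / V) + (f 3 + N' * (f 0 * A 3)) * 0 + N' * (f 0 * A 4 + f 1 * A 3) * (s * 3 / V^2)
      + N' * (f 0 * A 5 + f 1 * A 4 + f 2 * A 3) * 0 + N'^2 / 2 * (f 0 * (A 3)^2) * (s * 15 / V^3)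
      + N'^2 / 2 * (2 * f 0 * A 3 * A 4 + f 1 * (A 3)^2) * 0 + N'^3 / 6 * (f 0 * (A 3)^3) * 0)"
    by (intro has_bochner_integral_add has_bochner_integral_mult_right m o)
  moreover have "(\<lambda>t. f 0 * (E t * of_real t ^ 0) + f 1 * (E t * of_real t ^ 1) + f 2 * (E t * of_real t ^ 2)
      + (f 3 + N' * (f 0 * A 3)) * (E t * of_real t ^ 3) + N' * (f 0 * A 4 + f 1 * A 3) * (E t * of_real t ^ 4)
      + N' * (f 0 * A 5 + f 1 * A 4 + f 2 * A 3) * (E t * of_real t ^ 5)
      + N'^2 / 2 * (f 0 * (A 3)^2) * (E t * of_real t ^ 6)
      + N'^2 / 2 * (2 * f 0 * A 3 * A 4 + f 1 * (A 3)^2) * (E t * of_real t ^ 7) + N'^3 / 6 * (f 0 * (A 3)^3) * (E t * of_real t ^ 9))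
     = (\<lambda>t. of_real (exp (- N * \<kappa> * t\<^sup>2 / 2)) * saddle_poly f A N t)"
    by (intro ext) (simp add: saddle_poly_def E_def v_def N'_def ring_distribs mult_ac)
  moreover have "f 0 * s + f 1 * 0 + f 2 * (s / V) + (f 3 + N' * (f 0 * A 3)) * 0 + N' * (f 0 * A 4 + f 1 * A 3) * (s * 3 / V^2)
      + N' * (f 0 * A 5 + f 1 * A 4 + f 2 * A 3) * 0 + N'^2 / 2 * (f 0 * (A 3)^2) * (s * 15 / V^3)
      + N'^2 / 2 * (2 * f 0 * A 3 * A 4 + f 1 * (A 3)^2) * 0 + N'^3 / 6 * (f 0 * (A 3)^3) * 0
    = s * (f 0 + (f 2 / K + 3 * (f 0 * A 4 + f 1 * A 3) / K\<^sup>2 + 15 * f 0 * (A 3)\<^sup>2 / (2 * K^3)) / N')"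
  proof -
    have "a * s + b * (s / (n * k)) + n * c * (s * 3 / (n * k)^2) + n^2 / 2 * d * (s * 15 / (n * k)^3)
       = s * (a + (b / k + 3 * c / k^2 + 15 * d / (2 * k^3)) / n)" if "n \<noteq> 0" "k \<noteq> 0" for a b c d n k :: complex
      using that by (simp add: field_simps eval_nat_numeral)
    from this[OF V(2,3), of "f 0" "f 2" "f 0 * A 4 + f 1 * A 3" "f 0 * (A 3)^2"] show ?thesis
      by (simp add: V(1) mult.assoc)
  qed
  ultimately show ?thesis by (simp only: s_def N'_def K_def v_def of_real_mult of_real_power of_real_numeral)
qed

lemma integrable_inverse_one_plus_square: "integrable lborel (\<lambda>t::real. inverse (1 + t\<^sup>2))"
  using integrable_inverse_1_plus_square by (simp add: set_integrable_def)

text \<open>The near error integrates to \<open>n^(-2)\<close> times a Gaussian width of order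
  \<open>n^(-1/2)\<close>, the far error to order \<open>n^(-3)\<close>. After multiplication by
  \<open>sqrt n\<close> both are at most of order \<open>n^(-2)\<close>.\<close>

lemma laplace_expansion:
  fixes f :: "real \<Rightarrow> complex" and F A :: "nat \<Rightarrow> complex" and \<kappa> a C :: real
  assumes \<kappa>: "\<kappa> > 0" and a: "a > 0"
    and meas[measurable]: "f \<in> borel_measurable borel" "r \<in> borel_measurable borel"
    and f: "\<And>t. cmod (f t - (F 0 + F 1 * of_real t + F 2 * of_real t^2 + F 3 * of_real t^3)) \<le> C * t^4"
    and r: "\<And>t. cmod (r t - (A 3 * of_real t^3 + A 4 * of_real t^4 + A 5 * of_real t^5)) \<le> C * t^6"
    and \<Phi>: "\<And>t. \<Phi> t = exp (of_real (- \<kappa> * t\<^sup>2 / 2) + r t)"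
    and decay: "\<And>t. cmod (\<Phi> t) ^ 4 \<le> 1 / (1 + a * t\<^sup>2)"
  obtains C' where "\<And>n. n \<ge> 12 \<Longrightarrow> integrable lborel (\<lambda>t. f t * \<Phi> t ^ n)"
    "\<And>n. n \<ge> 12 \<Longrightarrow> cmod (of_real (sqrt n) * (\<integral>t. f t * \<Phi> t ^ n \<partial>lborel)
       - of_real (sqrt (2 * pi / \<kappa>)) * (F 0 + (F 2 / \<kappa> + 3 * (F 0 * A 4 + F 1 * A 3) / \<kappa>\<^sup>2 + 15 * F 0 * (A 3)\<^sup>2 / (2 * \<kappa>^3)) / n)) \<le> C' / (real n)\<^sup>2"
proof -
  have [measurable]: "\<Phi> \<in> borel_measurable borel"
    unfolding \<Phi>[abs_def] by measurable
  define P where "P n t = of_real (exp (- real n * \<kappa> * t\<^sup>2 / 2)) * saddle_poly F A (of_real (real n)) t" for n t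
  define D where "D n t = f t * \<Phi> t ^ n - P n t" for n t
  define V where "V n = F 0 + (F 2 / \<kappa> + 3 * (F 0 * A 4 + F 1 * A 3) / \<kappa>\<^sup>2 + 15 * F 0 * (A 3)\<^sup>2 / (2 * \<kappa>^3)) / of_nat n" for n :: nat
  have P: "has_bochner_integral lborel (P n) (of_real (sqrt (2 * pi / (n * \<kappa>))) * V n)" if "n \<ge> 12" for n
    using integral_saddle_poly[of "real n" \<kappa> F A] that \<kappa> unfolding P_def V_def by simp
  obtain \<delta> K1 where \<delta>: "\<delta> > 0" and K1: "K1 \<ge> 0" "\<And>t N F' r. \<bar>t\<bar> \<le> \<delta> \<Longrightarrow> N > 0 \<Longrightarrow>
       cmod (F' - (F 0 + F 1 * of_real t + F 2 * of_real t^2 + F 3 * of_real t^3)) \<le> C * t^4 \<Longrightarrow>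
       cmod (r - (A 3 * of_real t^3 + A 4 * of_real t^4 + A 5 * of_real t^5)) \<le> C * t^6 \<Longrightarrow>
       cmod (F' * exp (of_real (- N * \<kappa> * t\<^sup>2 / 2) + of_real N * r) - of_real (exp (- N * \<kappa> * t\<^sup>2 / 2)) * saddle_poly F A N t)
         \<le> K1 / N\<^sup>2 * exp (- (N * (\<kappa> / 8) * t\<^sup>2))"
    by (rule saddle_near[OF \<kappa>, of F C A]) blast
  obtain K2 where K2: "K2 \<ge> 0" "\<And>(t::real) n F' \<Phi>. \<delta> \<le> \<bar>t\<bar> \<Longrightarrow> n \<ge> 12 \<Longrightarrow>
       cmod (F' - (F 0 + F 1 * of_real t + F 2 * of_real t^2 + F 3 * of_real t^3)) \<le> C * t^4 \<Longrightarrow>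
       cmod \<Phi> ^ 4 \<le> 1 / (1 + a * t\<^sup>2) \<Longrightarrow>
       cmod (F' * \<Phi> ^ n - of_real (exp (- real n * \<kappa> * t\<^sup>2 / 2)) * saddle_poly F A (of_real (real n)) t)
         \<le> K2 / real n ^ 3 * inverse (1 + t\<^sup>2)"
    by (rule saddle_far[OF \<kappa> a \<delta>, of F C A]) blast
  \<comment> \<open>The sum of both majorants holds on the whole line, so the integral need not be
    split at \<open>\<delta>\<close>.\<close>
  define G where "G n t = K1 / (real n)\<^sup>2 * exp (- (real n * (\<kappa> / 8) * t\<^sup>2)) + K2 / real n ^ 3 * inverse (1 + t\<^sup>2)" for n t
  have D: "cmod (D n t) \<le> G n t" if n: "n \<ge> 12" for n t
  proof (cases "\<bar>t\<bar> \<le> \<delta>")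
    case True
    have "\<Phi> t ^ n = exp (of_real (- real n * \<kappa> * t\<^sup>2 / 2) + of_real (real n) * r t)"
      unfolding \<Phi> exp_of_nat_mult[symmetric] by (simp add: algebra_simps)
    hence "cmod (D n t) \<le> K1 / (real n)\<^sup>2 * exp (- (real n * (\<kappa> / 8) * t\<^sup>2))"
      using K1(2)[OF True, of "real n", OF _ f r] n unfolding D_def P_def by simp
    thus ?thesis using K2(1) by (simp add: G_def add_increasing2)
  next
    case False
    hence "cmod (D n t) \<le> K2 / real n ^ 3 * inverse (1 + t\<^sup>2)"
      using K2(2)[of t n, OF _ n f decay] unfolding D_def P_def by simp
    thus ?thesis using K1(1) by (simp add: G_def add_increasing)
  qed
  have G: "has_bochner_integral lborel (G n) (K1 / (real n)\<^sup>2 * sqrt (8 * pi / (n * \<kappa>)) + K2 / real n ^ 3 * (\<integral>t. inverse (1 + t\<^sup>2) \<partial>lborel))" if n: "n \<ge> 12" for n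
  proof -
    have v: "real n * (\<kappa> / 4) > 0" using n \<kappa> by simp
    have "has_bochner_integral lborel (\<lambda>t. exp (- (real n * (\<kappa> / 8) * t\<^sup>2))) (sqrt (8 * pi / (n * \<kappa>)))"
      using has_bochner_integral_bounded_linear[OF bounded_linear_Re gaussian_moments(1)[OF v, of 0]]
      by (simp add: mult_ac)
    thus ?thesis unfolding G_def
      by (intro has_bochner_integral_add has_bochner_integral_mult_right has_bochner_integral_integrable integrable_inverse_one_plus_square)
  qed
  have Dm: "D n \<in> borel_measurable lborel" for n
    unfolding D_def P_def saddle_poly_def by measurable
  have Di: "integrable lborel (D n)" if n: "n \<ge> 12" for n
    by (rule Bochner_Integration.integrable_bound[OF integrable.intros[OF G[OF n]] Dm])
       (use D[OF n] in \<open>auto intro!: AE_I2 order_trans[OF _ abs_ge_self]\<close>)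
  define I where "I = (\<integral>t. inverse (1 + (t::real)\<^sup>2) \<partial>lborel)"
  have I: "I \<ge> 0" unfolding I_def by (intro integral_nonneg_AE AE_I2) (simp add: add_nonneg_nonneg)
  have fi: "has_bochner_integral lborel (\<lambda>t. f t * \<Phi> t ^ n) ((\<integral>t. D n t \<partial>lborel) + of_real (sqrt (2 * pi / (n * \<kappa>))) * V n)" if n: "n \<ge> 12" for n
  proof -
    have eq: "(\<lambda>t. D n t + P n t) = (\<lambda>t. f t * \<Phi> t ^ n)" by (simp add: D_def)
    show ?thesis using has_bochner_integral_add[OF has_bochner_integral_integrable[OF Di[OF n]] P[OF n]] unfolding eq .
  qed
  show ?thesis
  proof (rule that[of "K1 * sqrt (8 * pi / \<kappa>) + K2 * I"])
    fix n :: nat assume n: "n \<ge> 12"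
    show "integrable lborel (\<lambda>t. f t * \<Phi> t ^ n)" using fi[OF n] by (rule integrable.intros)
    have n0: "real n > 0" using n by simp
    have "of_real (sqrt n) * of_real (sqrt (2 * pi / (n * \<kappa>))) = complex_of_real (sqrt (2 * pi / \<kappa>))"
      using n0 by (simp flip: of_real_mult real_sqrt_mult)
    hence "of_real (sqrt n) * (\<integral>t. f t * \<Phi> t ^ n \<partial>lborel) - of_real (sqrt (2 * pi / \<kappa>)) * V n = of_real (sqrt n) * (\<integral>t. D n t \<partial>lborel)"
      using has_bochner_integral_integral_eq[OF fi[OF n]] by (simp add: distrib_left mult.assoc[symmetric])
    hence "cmod (of_real (sqrt n) * (\<integral>t. f t * \<Phi> t ^ n \<partial>lborel) - of_real (sqrt (2 * pi / \<kappa>)) * V n) = sqrt n * cmod (\<integral>t. D n t \<partial>lborel)"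
      by (simp add: norm_mult)
    also have "\<dots> \<le> sqrt n * (K1 / (real n)\<^sup>2 * sqrt (8 * pi / (n * \<kappa>)) + K2 / real n ^ 3 * I)"
    proof (intro mult_left_mono)
      have "cmod (\<integral>t. D n t \<partial>lborel) \<le> (\<integral>t. G n t \<partial>lborel)"
        by (rule order_trans[OF integral_norm_bound integral_mono[OF integrable_norm[OF Di[OF n]] integrable.intros[OF G[OF n]] D[OF n]]])
      thus "cmod (\<integral>t. D n t \<partial>lborel) \<le> K1 / (real n)\<^sup>2 * sqrt (8 * pi / (n * \<kappa>)) + K2 / real n ^ 3 * I"
        using has_bochner_integral_integral_eq[OF G[OF n]] by (simp add: I_def)
    qed simp
    also have "\<dots> = K1 / (real n)\<^sup>2 * (sqrt n * sqrt (8 * pi / (n * \<kappa>))) + K2 * I / (real n)\<^sup>2 * (sqrt n / n)"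
      using n0 by (simp add: field_simps eval_nat_numeral)
    also have "sqrt n * sqrt (8 * pi / (n * \<kappa>)) = sqrt (8 * pi / \<kappa>)" using n0 by (simp flip: real_sqrt_mult)
    also have "K2 * I / (real n)\<^sup>2 * (sqrt n / n) \<le> K2 * I / (real n)\<^sup>2 * 1"
    proof (intro mult_left_mono)
      have "sqrt n * 1 \<le> sqrt n * sqrt n" using n by (intro mult_left_mono) auto
      thus "sqrt n / n \<le> 1" using n0 by (simp add: divide_le_eq)
    qed (use K2(1) I in auto)
    also have "K1 / (real n)\<^sup>2 * sqrt (8 * pi / \<kappa>) + K2 * I / (real n)\<^sup>2 * 1 = (K1 * sqrt (8 * pi / \<kappa>) + K2 * I) / (real n)\<^sup>2"
      by (simp add: add_divide_distrib)
    finally show "cmod (of_real (sqrt n) * (\<integral>t. f t * \<Phi> t ^ n \<partial>lborel)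
       - of_real (sqrt (2 * pi / \<kappa>)) * (F 0 + (F 2 / \<kappa> + 3 * (F 0 * A 4 + F 1 * A 3) / \<kappa>\<^sup>2 + 15 * F 0 * (A 3)\<^sup>2 / (2 * \<kappa>^3)) / n))
        \<le> (K1 * sqrt (8 * pi / \<kappa>) + K2 * I) / (real n)\<^sup>2"
      unfolding V_def by simp
  qed
qed

subsection \<open>Taylor expansion and decay of the characteristic function\<close>

lemma cmod_one_minus_imaginary: "cmod (1 - \<i> * of_real s) ^ 2 = 1 + s\<^sup>2"
  by (simp add: cmod_power2)

lemma cmod_one_minus_imaginary_ge: "cmod (1 - \<i> * of_real s) \<ge> 1"
  using abs_Re_le_cmod[of "1 - \<i> * of_real s"] by simp

text \<open>The difference has derivative \<open>- (w ^ 5) / (1 - w)\<close>, whose denominator has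
  modulus at least one along the imaginary segment. The bound is therefore global in
  \<open>s\<close>, beyond the disc of convergence of the series.\<close>

lemma Ln_taylor_imaginary:
  fixes s :: real
  defines "z \<equiv> \<i> * complex_of_real s"
  shows "cmod (Ln (1 - z) + (z + z^2 / 2 + z^3 / 3 + z^4 / 4 + z^5 / 5)) \<le> \<bar>s\<bar> ^ 6"
proof -
  define f where "f z = Ln (1 - z) + (z + z^2 / 2 + z^3 / 3 + z^4 / 4 + z^5 / 5)" for z :: complex
  have "cmod (f z - f 0) \<le> \<bar>s\<bar> ^ 5 * cmod (z - 0)"
  proof (rule field_differentiable_bound[where S = "closed_segment 0 z" and f' = "\<lambda>w. - (w ^ 5) / (1 - w)"])
    fix w assume "w \<in> closed_segment 0 z"
    then obtain t where t: "0 \<le> t" "t \<le> 1" "w = of_real t * z"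
      by (auto simp: closed_segment_def scaleR_conv_of_real)
    define y where "y = t * s"
    have w: "w = \<i> * of_real y" by (simp add: t z_def y_def)
    have w1: "cmod (1 - w) \<ge> 1" unfolding w by (rule cmod_one_minus_imaginary_ge)
    hence w0: "1 - w \<noteq> 0" by auto
    have np: "1 - w \<notin> \<real>\<^sub>\<le>\<^sub>0" by (auto simp: complex_nonpos_Reals_iff w)
    have L: "((\<lambda>z. Ln (1 - z)) has_field_derivative inverse (1 - w) * (- 1)) (at w)"
      by (rule DERIV_chain2[OF has_field_derivative_Ln]) (use np in \<open>auto intro!: derivative_eq_intros\<close>)
    have p: "((\<lambda>z. z + z^2 / 2 + z^3 / 3 + z^4 / 4 + z^5 / 5) has_field_derivative 1 + w + w^2 + w^3 + w^4) (at w)"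
      by (auto intro!: derivative_eq_intros)
    have "inverse (1 - w) * (- 1) + (1 + w + w^2 + w^3 + w^4) = - (w ^ 5) / (1 - w)"
      using w0 by (simp add: divide_simps) algebra
    with DERIV_add[OF L p] show "(f has_field_derivative - (w ^ 5) / (1 - w)) (at w within closed_segment 0 z)"
      unfolding f_def by (auto intro: has_field_derivative_at_within)
    have "\<bar>y\<bar> \<le> \<bar>s\<bar>" using t by (simp add: y_def abs_mult mult_left_le_one_le)
    hence "cmod (- (w ^ 5)) \<le> \<bar>s\<bar> ^ 5" by (simp add: w norm_power norm_mult power_mono)
    thus "cmod (- (w ^ 5) / (1 - w)) \<le> \<bar>s\<bar> ^ 5"
      unfolding norm_divide using frac_le[of "\<bar>s\<bar> ^ 5" "cmod (- (w ^ 5))" 1 "cmod (1 - w)"] w1 by simp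
  qed auto
  thus ?thesis by (simp add: f_def z_def norm_mult eval_nat_numeral)
qed

text \<open>The remainder is exactly \<open>z ^ k / (1 - z)\<close>, and for imaginary
  \<open>z\<close> the denominator can only help; again no smallness of \<open>s\<close>
  enters.\<close>

lemma geometric_remainder_imaginary:
  fixes s :: real
  defines "z \<equiv> \<i> * complex_of_real s"
  shows "cmod (1 / (1 - z) - (\<Sum>j<k. z ^ j)) \<le> \<bar>s\<bar> ^ k"
proof -
  have z1: "cmod (1 - z) \<ge> 1" unfolding z_def by (rule cmod_one_minus_imaginary_ge)
  hence "1 - z \<noteq> 0" by auto
  hence "1 / (1 - z) - (\<Sum>j<k. z ^ j) = z ^ k / (1 - z)"
    using one_diff_power_eq[of z k] by (simp add: field_simps)
  thus ?thesis using frac_le[of "\<bar>s\<bar> ^ k" "cmod (z ^ k)" 1 "cmod (1 - z)"] z1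
    by (simp add: norm_divide z_def norm_power norm_mult)
qed

text \<open>The coefficients are the cumulants of \<open>d * x + l * x\<^sup>2\<close> times
  \<open>\<i>^j / j!\<close>. The linear and quadratic terms are separated since centring removes
  the former and the latter becomes the Gaussian weight. The two parts of the constant come from the
  logarithm and from the quotient in \<open>log_cf\<close>.\<close>

lemma log_cf_taylor:
  fixes d l t :: real
  shows "cmod (log_cf d l t - \<i> * of_real (l * t) + of_real ((2 * l\<^sup>2 + d\<^sup>2) * t\<^sup>2 / 2)
     - ((- \<i> * of_real ((8 * l^3 + 6 * l * d\<^sup>2) / 6)) * of_real t^3 + of_real ((48 * l^4 + 48 * l\<^sup>2 * d\<^sup>2) / 24) * of_real t^4
        + (\<i> * of_real (16 * l^5 / 5 + 4 * l^3 * d\<^sup>2)) * of_real t^5)) \<le> (32 * l^6 + 8 * d\<^sup>2 * l^4) * t^6"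
proof -
  define z where "z = \<i> * complex_of_real (2 * l * t)"
  define L where "L = Ln (1 - z) + (z + z^2 / 2 + z^3 / 3 + z^4 / 4 + z^5 / 5)"
  define R where "R = 1 / (1 - z) - (1 + z + z^2 + z^3)"
  have L: "cmod L \<le> \<bar>2 * l * t\<bar> ^ 6" unfolding L_def z_def by (rule Ln_taylor_imaginary)
  have R: "cmod R \<le> \<bar>2 * l * t\<bar> ^ 4"
    using geometric_remainder_imaginary[of "2 * l * t" 4] unfolding R_def z_def
    by (simp add: eval_nat_numeral add_ac)
  have "log_cf d l t = - Ln (1 - z) / 2 - (d * t)\<^sup>2 / 2 * (1 / (1 - z))"
    by (simp add: log_cf_def z_def mult_ac)
  also have "\<dots> = - L / 2 - of_real ((d * t)\<^sup>2 / 2) * R + (z + z^2 / 2 + z^3 / 3 + z^4 / 4 + z^5 / 5) / 2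
      - of_real ((d * t)\<^sup>2 / 2) * (1 + z + z^2 + z^3)"
    by (simp add: L_def R_def algebra_simps add_divide_distrib diff_divide_distrib)
  finally have e: "log_cf d l t = - L / 2 - of_real ((d * t)\<^sup>2 / 2) * R + (z + z^2 / 2 + z^3 / 3 + z^4 / 4 + z^5 / 5) / 2
      - of_real ((d * t)\<^sup>2 / 2) * (1 + z + z^2 + z^3)" .
  have p: "(z + z^2 / 2 + z^3 / 3 + z^4 / 4 + z^5 / 5) / 2 - of_real ((d * t)\<^sup>2 / 2) * (1 + z + z^2 + z^3)
     = \<i> * of_real (l * t) - of_real ((2 * l\<^sup>2 + d\<^sup>2) * t\<^sup>2 / 2)
     + ((- \<i> * of_real ((8 * l^3 + 6 * l * d\<^sup>2) / 6)) * of_real t^3 + of_real ((48 * l^4 + 48 * l\<^sup>2 * d\<^sup>2) / 24) * of_real t^4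
        + (\<i> * of_real (16 * l^5 / 5 + 4 * l^3 * d\<^sup>2)) * of_real t^5)"
    by (simp add: complex_eq_iff z_def field_simps eval_nat_numeral)
  have "log_cf d l t - \<i> * of_real (l * t) + of_real ((2 * l\<^sup>2 + d\<^sup>2) * t\<^sup>2 / 2)
     - ((- \<i> * of_real ((8 * l^3 + 6 * l * d\<^sup>2) / 6)) * of_real t^3 + of_real ((48 * l^4 + 48 * l\<^sup>2 * d\<^sup>2) / 24) * of_real t^4
        + (\<i> * of_real (16 * l^5 / 5 + 4 * l^3 * d\<^sup>2)) * of_real t^5) = - L / 2 - of_real ((d * t)\<^sup>2 / 2) * R"
    unfolding e using p by (simp only: algebra_simps)
  moreover have "cmod (- L / 2 - of_real ((d * t)\<^sup>2 / 2) * R) \<le> \<bar>2 * l * t\<bar> ^ 6 / 2 + (d * t)\<^sup>2 / 2 * \<bar>2 * l * t\<bar> ^ 4"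
    by (rule order_trans[OF norm_triangle_ineq4], rule add_mono)
       (use L mult_left_mono[OF R, of "(d * t)\<^sup>2 / 2"] in \<open>simp_all add: norm_mult norm_power norm_divide power_mult_distrib\<close>)
  moreover have "\<bar>2 * l * t\<bar> ^ 6 / 2 + (d * t)\<^sup>2 / 2 * \<bar>2 * l * t\<bar> ^ 4 = (32 * l^6 + 8 * d\<^sup>2 * l^4) * t^6"
    by (simp add: power_even_abs power_mult_distrib algebra_simps eval_nat_numeral)
  ultimately show ?thesis by simp
qed

text \<open>The logarithmic part contributes \<open>cmod z\<close> to the power -1/2, and
  \<open>cmod z ^ 2\<close> is a polynomial in \<open>t\<close>; the fourth power is the one that
  removes all roots.\<close>

lemma cmod_exp_log_cf_power4:
  fixes d l t :: real
  shows "cmod (exp (log_cf d l t)) ^ 4 = exp (- (2 * (d * t)\<^sup>2 / (1 + (2 * l * t)\<^sup>2))) / (1 + (2 * l * t)\<^sup>2)"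
proof -
  define z where "z = 1 - \<i> * complex_of_real (2 * l * t)"
  have z1: "cmod z \<ge> 1" unfolding z_def by (rule cmod_one_minus_imaginary_ge)
  hence z0: "z \<noteq> 0" by auto
  have z2: "cmod z ^ 2 = 1 + (2 * l * t)\<^sup>2" unfolding z_def by (rule cmod_one_minus_imaginary)
  have q: "Re (of_real r / z) = r * Re (inverse z)" for r
    by (subst divide_inverse) simp
  have "log_cf d l t = - Ln z / 2 - of_real ((d * t)\<^sup>2 / 2) / z"
    by (simp add: log_cf_def z_def mult_ac)
  hence "Re (log_cf d l t) = Re (- Ln z / 2) - Re (of_real ((d * t)\<^sup>2 / 2) / z)"
    by (simp only: minus_complex.sel)
  hence "Re (log_cf d l t) = - ln (cmod z) / 2 - (d * t)\<^sup>2 / 2 * Re (inverse z)"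
    unfolding q using z0 by simp
  moreover have "Re (inverse z) = 1 / (1 + (2 * l * t)\<^sup>2)" by (simp add: z_def power2_eq_square)
  ultimately have "Re (log_cf d l t) = - ln (cmod z) / 2 - (d * t)\<^sup>2 / 2 * (1 / (1 + (2 * l * t)\<^sup>2))" by (simp only:)
  moreover have "4 * (- L / 2 - b / 2 * (1 / w)) = - (2 * b / w) + - (2 * L)" for L b w :: real by simp
  ultimately have "4 * Re (log_cf d l t) = - (2 * (d * t)\<^sup>2 / (1 + (2 * l * t)\<^sup>2)) + - (2 * ln (cmod z))"
    by (simp only:)
  hence "cmod (exp (log_cf d l t)) ^ 4 = exp (- (2 * (d * t)\<^sup>2 / (1 + (2 * l * t)\<^sup>2)) + - (2 * ln (cmod z)))"
    by (simp only: norm_exp_eq_Re exp_of_nat_mult[symmetric] of_nat_numeral)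
  also have "\<dots> = exp (- (2 * (d * t)\<^sup>2 / (1 + (2 * l * t)\<^sup>2))) * inverse (exp (2 * ln (cmod z)))"
    by (simp only: exp_add exp_minus)
  also have "exp (2 * ln (cmod z)) = 1 + (2 * l * t)\<^sup>2"
    using z0 z2 exp_of_nat_mult[of 2 "ln (cmod z)"] by simp
  finally show ?thesis by (simp only: divide_inverse)
qed

lemma cmod_exp_log_cf_le_1: "cmod (exp (log_cf d l (of_real t))) \<le> 1"
proof -
  have "cmod (exp (log_cf d l (of_real t))) ^ 4 \<le> 1"
    unfolding cmod_exp_log_cf_power4 by (rule order_trans[OF divide_right_mono[of _ 1]]) (auto simp: add_nonneg_nonneg divide_le_eq_1 add_pos_nonneg)
  thus ?thesis using power_le_one_iff[of "cmod (exp (log_cf d l (of_real t)))" 4] by (metis norm_ge_zero zero_neq_numeral)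
qed

text \<open>A quadratic part gives algebraic decay. Without it the Gaussian decay from
  \<open>d\<close> is weakened by \<open>1 + x \<le> exp x\<close>, so that both cases share one
  form.\<close>

lemma exp_log_cf_decay:
  assumes "l \<noteq> 0 \<or> d \<noteq> 0"
  obtains a where "a > 0" "\<And>t::real. cmod (exp (log_cf d l t)) ^ 4 \<le> 1 / (1 + a * t\<^sup>2)"
proof (cases "l = 0")
  case False
  show ?thesis
  proof (rule that[of "4 * l\<^sup>2"])
    show "4 * l\<^sup>2 > 0" using False by simp
    show "cmod (exp (log_cf d l t)) ^ 4 \<le> 1 / (1 + 4 * l\<^sup>2 * t\<^sup>2)" for t :: real
      unfolding cmod_exp_log_cf_power4 by (simp add: power_mult_distrib) (intro divide_right_mono, auto)
  qed
next
  case True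
  show ?thesis
  proof (rule that[of "2 * d\<^sup>2"])
    show "2 * d\<^sup>2 > 0" using True assms by simp
    fix t :: real
    have "1 + 2 * d\<^sup>2 * t\<^sup>2 \<le> exp (2 * d\<^sup>2 * t\<^sup>2)" by (rule exp_ge_add_one_self)
    hence "1 / exp (2 * d\<^sup>2 * t\<^sup>2) \<le> 1 / (1 + 2 * d\<^sup>2 * t\<^sup>2)" by (intro divide_left_mono) (auto intro!: mult_pos_pos add_pos_nonneg)
    thus "cmod (exp (log_cf d l t)) ^ 4 \<le> 1 / (1 + 2 * d\<^sup>2 * t\<^sup>2)"
      unfolding cmod_exp_log_cf_power4 using True by (simp add: exp_minus power_mult_distrib inverse_eq_divide mult.assoc)
  qed
qed

subsection \<open>Derivatives of the cumulant generating function\<close>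

text \<open>An iterated \<open>deriv\<close> at a point depends on the previous derivative nearby;
  this is why each closed form is established on an open set and not only at the
  saddlepoint.\<close>

lemma higher_deriv_step:
  assumes "open S" "x \<in> S" "\<And>y. y \<in> S \<Longrightarrow> (deriv ^^ j) f y = g y" "(g has_real_derivative D) (at x)"
  shows "(deriv ^^ Suc j) f x = D"
proof -
  have "eventually (\<lambda>y. (deriv ^^ j) f y = g y) (nhds x)"
    using assms(1-3) eventually_nhds by blast
  hence "deriv ((deriv ^^ j) f) x = deriv g x" by (rule deriv_cong_ev) simp
  thus ?thesis using DERIV_imp_deriv[OF assms(4)] by simp
qed

lemma cgf_deriv_eq:
  assumes "\<forall>k<m. 1 - 2 * lam k * \<eta> > 0"
  shows "cgf_deriv 2 m c lam d \<eta> = (\<Sum>k<m. 2 * (lam k)^2 / (1 - 2 * lam k * \<eta>)^2 + (d k)^2 / (1 - 2 * lam k * \<eta>)^3)"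
    and "cgf_deriv 3 m c lam d \<eta> = (\<Sum>k<m. 8 * (lam k)^3 / (1 - 2 * lam k * \<eta>)^3 + 6 * lam k * (d k)^2 / (1 - 2 * lam k * \<eta>)^4)"
    and "cgf_deriv 4 m c lam d \<eta> = (\<Sum>k<m. 48 * (lam k)^4 / (1 - 2 * lam k * \<eta>)^4 + 48 * (lam k)^2 * (d k)^2 / (1 - 2 * lam k * \<eta>)^5)"
proof -
  define S where "S = {x. \<forall>k<m. 1 - 2 * lam k * x > 0}"
  have S: "open S"
  proof -
    have "S = (\<Inter>k\<in>{..<m}. {x. 1 - 2 * lam k * x > 0})" by (auto simp: S_def)
    thus ?thesis by (auto intro!: open_INT open_Collect_less continuous_intros)
  qed
  have \<eta>: "\<eta> \<in> S" using assms by (simp add: S_def)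
  define u where "u k x = 1 - 2 * lam k * x" for k and x :: real
  have u: "u k x > 0" if "x \<in> S" "k < m" for k x using that by (auto simp: S_def u_def)
  have du: "(u k has_real_derivative - 2 * lam k) (at x)" for k x
    unfolding u_def[abs_def] by (auto intro!: derivative_eq_intros)
  have dinv: "((\<lambda>x. a / u k x ^ j) has_real_derivative a * real j * (2 * lam k) / u k x ^ Suc j) (at x)" if "x \<in> S" "k < m" for a k x j
  proof (cases j)
    case (Suc i)
    have "((\<lambda>x. a / u k x ^ j) has_real_derivative (0 * u k x ^ j - a * (of_nat j * (- 2 * lam k * u k x ^ (j - Suc 0)))) / (u k x ^ j * u k x ^ j)) (at x)"
      using u[OF that] by (intro DERIV_divide DERIV_power du derivative_intros) auto
    moreover have "(0 * u k x ^ j - a * (of_nat j * (- 2 * lam k * u k x ^ (j - Suc 0)))) / (u k x ^ j * u k x ^ j) = a * real j * (2 * lam k) / u k x ^ Suc j"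
      using u[OF that] Suc by (simp add: field_simps)
    ultimately show ?thesis by simp
  qed auto
  define g1 where "g1 x = c + (\<Sum>k<m. lam k / u k x + (d k)^2 * x / u k x + lam k * (d k)^2 * x^2 / u k x ^ 2)" for x
  have D1: "(deriv ^^ Suc 0) (cgf_Y m c lam d) x = g1 x" if x: "x \<in> S" for x
  proof (rule higher_deriv_step[OF S x, where g = "cgf_Y m c lam d"])
    have L: "((\<lambda>x. \<Sum>k<m. ln (u k x)) has_real_derivative (\<Sum>k<m. 1 / u k x * (- 2 * lam k))) (at x)"
      using u[OF x] by (intro DERIV_sum DERIV_chain2[OF DERIV_ln_divide du]) auto
    have Q: "((\<lambda>x. \<Sum>k<m. (d k)\<^sup>2 * x\<^sup>2 / u k x) has_real_derivative
        (\<Sum>k<m. ((d k)\<^sup>2 * (2 * x) * u k x - (d k)\<^sup>2 * x\<^sup>2 * (- 2 * lam k)) / (u k x * u k x))) (at x)"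
      using u[OF x] less_imp_neq[OF u[OF x]] by (intro DERIV_sum DERIV_divide du DERIV_cmult) (auto intro!: derivative_eq_intros simp: less_imp_neq[symmetric] dest: less_imp_neq)
    have "((\<lambda>x. c * x - 1/2 * (\<Sum>k<m. ln (u k x)) + 1/2 * (\<Sum>k<m. (d k)\<^sup>2 * x\<^sup>2 / u k x)) has_real_derivative
       c * 1 - 1/2 * (\<Sum>k<m. 1 / u k x * (- 2 * lam k)) + 1/2 * (\<Sum>k<m. ((d k)\<^sup>2 * (2 * x) * u k x - (d k)\<^sup>2 * x\<^sup>2 * (- 2 * lam k)) / (u k x * u k x))) (at x)"
      by (intro DERIV_add DERIV_diff DERIV_cmult L Q DERIV_ident)
    also have "c * 1 - 1/2 * (\<Sum>k<m. 1 / u k x * (- 2 * lam k)) + 1/2 * (\<Sum>k<m. ((d k)\<^sup>2 * (2 * x) * u k x - (d k)\<^sup>2 * x\<^sup>2 * (- 2 * lam k)) / (u k x * u k x)) = g1 x"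
    proof -
      have "(\<Sum>k<m. lam k / u k x + (d k)^2 * x / u k x + lam k * (d k)^2 * x^2 / u k x ^ 2)
        = (\<Sum>k<m. - (1/2) * (1 / u k x * (- 2 * lam k)) + 1/2 * (((d k)\<^sup>2 * (2 * x) * u k x - (d k)\<^sup>2 * x\<^sup>2 * (- 2 * lam k)) / (u k x * u k x)))"
      proof (intro sum.cong refl)
        fix k assume "k \<in> {..<m}"
        hence "u k x \<noteq> 0" using u[OF x, of k] by simp
        thus "lam k / u k x + (d k)^2 * x / u k x + lam k * (d k)^2 * x^2 / u k x ^ 2 = - (1/2) * (1 / u k x * (- 2 * lam k)) + 1/2 * (((d k)\<^sup>2 * (2 * x) * u k x - (d k)\<^sup>2 * x\<^sup>2 * (- 2 * lam k)) / (u k x * u k x))"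
          by (simp add: field_simps power2_eq_square)
      qed
      hence "(\<Sum>k<m. lam k / u k x + (d k)^2 * x / u k x + lam k * (d k)^2 * x^2 / u k x ^ 2)
        = - (1/2) * (\<Sum>k<m. 1 / u k x * (- 2 * lam k)) + 1/2 * (\<Sum>k<m. ((d k)\<^sup>2 * (2 * x) * u k x - (d k)\<^sup>2 * x\<^sup>2 * (- 2 * lam k)) / (u k x * u k x))"
        unfolding sum_distrib_left sum.distrib[symmetric] .
      thus ?thesis unfolding g1_def by linarith
    qed
    finally show "(cgf_Y m c lam d has_real_derivative g1 x) (at x)"
      unfolding cgf_Y_def[abs_def] u_def .
  qed simp
  define g2 where "g2 x = (\<Sum>k<m. 2 * (lam k)^2 / u k x ^ 2 + (d k)^2 / u k x ^ 3)" for x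
  have D2: "(deriv ^^ Suc (Suc 0)) (cgf_Y m c lam d) x = g2 x" if x: "x \<in> S" for x
  proof (rule higher_deriv_step[OF S x D1])
    have "((\<lambda>x. lam k / u k x + (d k)^2 * x / u k x + lam k * (d k)^2 * x^2 / u k x ^ 2) has_real_derivative
         2 * (lam k)^2 / u k x ^ 2 + (d k)^2 / u k x ^ 3) (at x)" if k: "k < m" for k
    proof -
      have 1: "((\<lambda>x. lam k / u k x ^ 1) has_real_derivative lam k * real 1 * (2 * lam k) / u k x ^ Suc 1) (at x)"
        by (rule dinv[OF x k])
      have 2: "((\<lambda>x. (d k)^2 * x / u k x) has_real_derivative ((d k)^2 * 1 * u k x - (d k)^2 * x * (- 2 * lam k)) / (u k x * u k x)) (at x)"
        using u[OF x k] by (intro DERIV_divide DERIV_cmult DERIV_ident du) auto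
      have 3: "((\<lambda>x. lam k * (d k)^2 * x^2 / u k x ^ 2) has_real_derivative
         (lam k * (d k)^2 * (2 * x) * u k x ^ 2 - lam k * (d k)^2 * x^2 * (2 * u k x * (- 2 * lam k))) / (u k x ^ 2 * u k x ^ 2)) (at x)"
        using u[OF x k] by (intro DERIV_divide DERIV_cmult) (auto intro!: derivative_eq_intros du)
      \<comment> \<open>Over the common denominator \<open>u k x ^ 3\<close> the two summands with
        \<open>d k\<close> combine into the square of \<open>u k x + 2 * lam k * x\<close>, which
        equals one.\<close>
      have "lam k * real 1 * (2 * lam k) / u k x ^ Suc 1 + ((d k)^2 * 1 * u k x - (d k)^2 * x * (- 2 * lam k)) / (u k x * u k x)
         + (lam k * (d k)^2 * (2 * x) * u k x ^ 2 - lam k * (d k)^2 * x^2 * (2 * u k x * (- 2 * lam k))) / (u k x ^ 2 * u k x ^ 2)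
         = 2 * (lam k)^2 / u k x ^ 2 + (d k)^2 * (u k x + 2 * lam k * x)^2 / u k x ^ 3"
        using u[OF x k] by (simp add: field_simps eval_nat_numeral)
      also have "u k x + 2 * lam k * x = 1" by (simp add: u_def)
      finally show ?thesis using DERIV_add[OF DERIV_add[OF 1 2] 3] by simp
    qed
    hence "(g1 has_real_derivative 0 + g2 x) (at x)"
      unfolding g1_def[abs_def] g2_def by (intro DERIV_add[OF DERIV_const DERIV_sum]) auto
    thus "(g1 has_real_derivative g2 x) (at x)" by simp
  qed
  define g3 where "g3 x = (\<Sum>k<m. 8 * (lam k)^3 / u k x ^ 3 + 6 * lam k * (d k)^2 / u k x ^ 4)" for x
  have D3: "(deriv ^^ Suc (Suc (Suc 0))) (cgf_Y m c lam d) x = g3 x" if x: "x \<in> S" for x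
  proof (rule higher_deriv_step[OF S x D2])
    have "(g2 has_real_derivative (\<Sum>k<m. 2 * (lam k)^2 * real 2 * (2 * lam k) / u k x ^ Suc 2 + (d k)^2 * real 3 * (2 * lam k) / u k x ^ Suc 3)) (at x)"
      unfolding g2_def[abs_def] by (intro DERIV_sum DERIV_add dinv x) auto
    thus "(g2 has_real_derivative g3 x) (at x)" by (simp add: g3_def power3_eq_cube power2_eq_square mult_ac)
  qed
  define g4 where "g4 x = (\<Sum>k<m. 48 * (lam k)^4 / u k x ^ 4 + 48 * (lam k)^2 * (d k)^2 / u k x ^ 5)" for x
  have D4: "(deriv ^^ Suc (Suc (Suc (Suc 0)))) (cgf_Y m c lam d) x = g4 x" if x: "x \<in> S" for x
  proof (rule higher_deriv_step[OF S x D3])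
    have "(g3 has_real_derivative (\<Sum>k<m. 8 * (lam k)^3 * real 3 * (2 * lam k) / u k x ^ Suc 3 + 6 * lam k * (d k)^2 * real 4 * (2 * lam k) / u k x ^ Suc 4)) (at x)"
      unfolding g3_def[abs_def] by (intro DERIV_sum DERIV_add dinv x) auto
    thus "(g3 has_real_derivative g4 x) (at x)" by (simp add: g4_def eval_nat_numeral mult_ac)
  qed
  show "cgf_deriv 2 m c lam d \<eta> = (\<Sum>k<m. 2 * (lam k)^2 / (1 - 2 * lam k * \<eta>)^2 + (d k)^2 / (1 - 2 * lam k * \<eta>)^3)"
    using D2[OF \<eta>] by (simp add: cgf_deriv_def g2_def u_def numeral_2_eq_2)
  show "cgf_deriv 3 m c lam d \<eta> = (\<Sum>k<m. 8 * (lam k)^3 / (1 - 2 * lam k * \<eta>)^3 + 6 * lam k * (d k)^2 / (1 - 2 * lam k * \<eta>)^4)"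
    using D3[OF \<eta>] unfolding cgf_deriv_def g3_def u_def numeral_3_eq_3 .
  have "4 = Suc (Suc (Suc (Suc 0)))" by simp
  thus "cgf_deriv 4 m c lam d \<eta> = (\<Sum>k<m. 48 * (lam k)^4 / (1 - 2 * lam k * \<eta>)^4 + 48 * (lam k)^2 * (d k)^2 / (1 - 2 * lam k * \<eta>)^5)"
    using D4[OF \<eta>] unfolding cgf_deriv_def g4_def u_def by presburger
qed

lemma log_cf_measurable[measurable]: "(\<lambda>t. log_cf d l (complex_of_real t)) \<in> borel_measurable borel"
proof (rule borel_measurable_continuous_onI, rule continuous_at_imp_continuous_on, safe)
  fix t :: real
  have "isCont (log_cf d l) (of_real t)" by (rule DERIV_isCont[OF log_cf_has_field_derivative])
  thus "isCont (\<lambda>t. log_cf d l (complex_of_real t)) t" by (rule isCont_o2[rotated]) (intro continuous_intros)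
qed

subsection \<open>Tilted transforms of the sample\<close>

lemma indep_vars_Pair_compose:
  assumes "prob_space M" "prob_space.indep_vars M (\<lambda>_. borel) (\<lambda>(j, k). Z j k) UNIV"
    and "\<And>p. f p \<in> borel_measurable borel"
  shows "prob_space.indep_vars M (\<lambda>_. borel) (\<lambda>p x. f p (Z (fst p) (snd p) x)) I"
proof -
  interpret prob_space M by fact
  have "indep_vars (\<lambda>_. borel) (\<lambda>p. f p \<circ> (case p of (j, k) \<Rightarrow> Z j k)) I"
    by (rule indep_vars_compose[OF indep_vars_subset[OF assms(2)] assms(3)]) simp
  thus ?thesis by (simp add: comp_def split_beta)
qed

text \<open>The level \<open>b\<close> stands for \<open>v - c\<close>, which keeps the additive
  constant of the loss out of the transforms. The hypothesis \<open>saddle\<close> says that the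
  tilt by \<open>\<eta>\<close> moves the mean of the loss to the level.\<close>

locale quadratic_gaussian_sample = prob_space M for M :: "'a measure" +
  fixes Z :: "nat \<Rightarrow> nat \<Rightarrow> 'a \<Rightarrow> real" and m :: nat and \<eta> b :: real and lam d :: "nat \<Rightarrow> real"
  assumes indep: "indep_vars (\<lambda>_. borel) (\<lambda>(j, k). Z j k) UNIV"
    and dist: "\<And>j k. distributed M lborel (Z j k) std_normal_density"
    and nondeg: "\<exists>k<m. lam k \<noteq> 0 \<or> d k \<noteq> 0"
    and dom: "\<And>k. k < m \<Longrightarrow> 1 - 2 * lam k * \<eta> > 0"
    and saddle: "(\<Sum>k<m. (lam k * (1 - 2 * lam k * \<eta>) + (d k)\<^sup>2 * (1 - lam k * \<eta>) * \<eta>)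
                     / (1 - 2 * lam k * \<eta>)\<^sup>2) = b"
begin

definition u :: "nat \<Rightarrow> real" where "u k = 1 - 2 * lam k * \<eta>"

text \<open>Parameters of the loss after the exponential tilt by \<open>\<eta>\<close>, where the normals are again standardized.\<close>
definition lt :: "nat \<Rightarrow> real" where "lt k = lam k / u k"
definition dt :: "nat \<Rightarrow> real" where "dt k = d k / (u k * sqrt (u k))"

definition S :: "nat \<Rightarrow> 'a \<Rightarrow> real" where
  "S n x = (\<Sum>j<n. (\<Sum>k<m. d k * Z j k x + lam k * (Z j k x)\<^sup>2) - b)"

text \<open>For \<open>b = v - c\<close> this is the cumulant generating function at
  \<open>\<eta>\<close> minus \<open>\<eta> * v\<close>, hence minus half the square of the signed
  root in the theorem.\<close>

definition \<kappa>0 :: real where "\<kappa>0 = (\<Sum>k<m. (d k)\<^sup>2 * \<eta>\<^sup>2 / (2 * u k) - ln (u k) / 2) - \<eta> * b"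

text \<open>Characteristic function of the centred loss under the tilted law; \<open>lt k\<close> is
  the mean of the k-th summand in the standardized tilted variable.\<close>

definition \<Phi> :: "real \<Rightarrow> complex" where
  "\<Phi> t = exp (\<Sum>k<m. log_cf (dt k) (lt k) t - \<i> * of_real (lt k * t))"

text \<open>Inserting a factor \<open>Z j k\<close> multiplies the transform by \<open>B k\<close>, which equals \<open>d\<^sub>k s / (1 - 2 \<lambda>\<^sub>k s)\<close> at \<open>s = \<eta> + it\<close>.\<close>
definition B :: "nat \<Rightarrow> real \<Rightarrow> complex" where
  "B k t = d k / u k * (\<eta> + \<i> * t / (u k * (1 - 2 * \<i> * lt k * t)))"

lemma u_pos: "k < m \<Longrightarrow> u k > 0"
  using dom by (simp add: u_def)

lemma Z_measurable[measurable]: "Z j k \<in> borel_measurable M"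
  using distributed_measurable[OF dist[of j k]] by simp

lemma S_measurable[measurable]: "S n \<in> borel_measurable M"
  unfolding S_def by measurable

definition F :: "nat \<Rightarrow> real \<Rightarrow> complex" where
  "F k t = of_real (exp ((d k)\<^sup>2 * \<eta>\<^sup>2 / (2 * u k)) / sqrt (u k)) * iexp (t * ((d k)\<^sup>2 * \<eta> * (1 - lam k * \<eta>) / (u k)\<^sup>2))
     * exp (log_cf (dt k) (lt k) t)"

lemma single_transform:
  assumes k: "k < m"
  shows "has_bochner_integral M (\<lambda>x. exp (Complex \<eta> t * (d k * Z j k x + lam k * (Z j k x)\<^sup>2))) (F k t)"
    and "has_bochner_integral M (\<lambda>x. Z j k x * exp (Complex \<eta> t * (d k * Z j k x + lam k * (Z j k x)\<^sup>2))) (B k t * F k t)"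
proof -
  have tr: "has_bochner_integral M (\<lambda>x. g (Z j k x)) I"
    if "has_bochner_integral lborel (\<lambda>z. std_normal_density z * g z) I" "g \<in> borel_measurable borel" for g :: "real \<Rightarrow> complex" and I
  proof -
    have dd: "distr M lborel (Z j k) = density lborel std_normal_density"
      using distributed_distr_eq_density[OF dist[of j k]] .
    have "has_bochner_integral lborel (\<lambda>z. std_normal_density z *\<^sub>R g z) I"
      using that(1) by (simp add: scaleR_conv_of_real)
    hence "has_bochner_integral (density lborel std_normal_density) g I"
      using that(2) by (intro has_bochner_integral_density) auto
    hence "has_bochner_integral (distr M lborel (Z j k)) g I" by (simp only: dd)
    thus ?thesis using that(2) by (simp add: has_bochner_integral_iff integrable_distr_eq integral_distr)
  qed
  note gl = gauss_laplace[OF dom[OF k], where d = "d k" and t = t, folded u_def, folded dt_def lt_def, folded F_def B_def]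
  show "has_bochner_integral M (\<lambda>x. exp (Complex \<eta> t * (d k * Z j k x + lam k * (Z j k x)\<^sup>2))) (F k t)"
    by (rule tr[OF gl(1)]) measurable
  show "has_bochner_integral M (\<lambda>x. Z j k x * exp (Complex \<eta> t * (d k * Z j k x + lam k * (Z j k x)\<^sup>2))) (B k t * F k t)"
    by (rule tr[OF gl(2)]) measurable
qed

text \<open>This is where the saddlepoint equation acts. The linear phase collected from the shifted
  means cancels against the level \<open>b\<close>, up to the terms \<open>lt k * t\<close> that
  centre \<open>\<Phi>\<close>; thus \<open>\<Phi>\<close> has no first-order term.\<close>

lemma prod_F: "exp (- (Complex \<eta> t * b)) * (\<Prod>k<m. F k t) = of_real (exp \<kappa>0) * \<Phi> t"
proof -
  have "F k t = exp (of_real ((d k)\<^sup>2 * \<eta>\<^sup>2 / (2 * u k) - ln (u k) / 2) + (\<i> * of_real (t * ((d k)\<^sup>2 * \<eta> * (1 - lam k * \<eta>) / (u k)\<^sup>2)) + log_cf (dt k) (lt k) t))"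
    if "k < m" for k
  proof -
    have "exp ((d k)\<^sup>2 * \<eta>\<^sup>2 / (2 * u k)) / sqrt (u k) = exp ((d k)\<^sup>2 * \<eta>\<^sup>2 / (2 * u k) - ln (u k) / 2)"
      using u_pos[OF that] by (simp add: exp_diff ln_sqrt[symmetric])
    thus ?thesis unfolding F_def exp_add exp_of_real by (simp only: mult.assoc)
  qed
  hence "(\<Prod>k<m. F k t) = exp (\<Sum>k<m. of_real ((d k)\<^sup>2 * \<eta>\<^sup>2 / (2 * u k) - ln (u k) / 2) + (\<i> * of_real (t * ((d k)\<^sup>2 * \<eta> * (1 - lam k * \<eta>) / (u k)\<^sup>2)) + log_cf (dt k) (lt k) t))"
    by (simp add: exp_sum)
  also have "(\<Sum>k<m. of_real ((d k)\<^sup>2 * \<eta>\<^sup>2 / (2 * u k) - ln (u k) / 2) + (\<i> * of_real (t * ((d k)\<^sup>2 * \<eta> * (1 - lam k * \<eta>) / (u k)\<^sup>2)) + log_cf (dt k) (lt k) t))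
     = Complex \<eta> t * b + (of_real \<kappa>0 + (\<Sum>k<m. log_cf (dt k) (lt k) t - \<i> * of_real (lt k * t)))"
  proof -
    have "b = (\<Sum>k<m. lt k + (d k)\<^sup>2 * \<eta> * (1 - lam k * \<eta>) / (u k)\<^sup>2)"
      unfolding saddle[symmetric]
    proof (intro sum.cong refl)
      fix k assume "k \<in> {..<m}"
      hence "u k > 0" using u_pos by simp
      thus "(lam k * (1 - 2 * lam k * \<eta>) + (d k)\<^sup>2 * (1 - lam k * \<eta>) * \<eta>) / (1 - 2 * lam k * \<eta>)\<^sup>2 = lt k + (d k)\<^sup>2 * \<eta> * (1 - lam k * \<eta>) / (u k)\<^sup>2"
        unfolding u_def[symmetric] by (simp add: lt_def add_divide_distrib power2_eq_square mult_ac)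
    qed
    hence "of_real t * of_real b = (\<Sum>k<m. complex_of_real (lt k * t) + of_real (t * ((d k)\<^sup>2 * \<eta> * (1 - lam k * \<eta>) / (u k)\<^sup>2)))"
      by (simp add: sum_distrib_left algebra_simps)
    moreover have "Complex \<eta> t * b = of_real (\<eta> * b) + \<i> * (of_real t * of_real b)" by (simp add: complex_eq_iff)
    ultimately have e: "Complex \<eta> t * b = of_real (\<eta> * b) + (\<Sum>k<m. \<i> * complex_of_real (lt k * t) + \<i> * of_real (t * ((d k)\<^sup>2 * \<eta> * (1 - lam k * \<eta>) / (u k)\<^sup>2)))"
      by (simp only: sum_distrib_left distrib_left)
    have k: "complex_of_real \<kappa>0 = (\<Sum>k<m. complex_of_real ((d k)\<^sup>2 * \<eta>\<^sup>2 / (2 * u k) - ln (u k) / 2)) - of_real (\<eta> * b)"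
      unfolding \<kappa>0_def by (simp only: of_real_diff of_real_sum)
    show ?thesis unfolding e k by (simp only: sum.distrib sum_subtractf) simp
  qed
  finally show ?thesis unfolding \<Phi>_def
    by (simp only: exp_add exp_of_real exp_minus) simp
qed

text \<open>Independence factorizes the expectation over all pairs \<open>(j, k)\<close>, and each
  pair in \<open>P\<close> replaces its \<open>F\<close> by \<open>B * F\<close>. The empty set
  yields the transform of the tilted law, a singleton the one with a single normal inserted.\<close>

lemma joint_transform:
  assumes P: "P \<subseteq> {..<n} \<times> {..<m}"
  shows "has_bochner_integral M (\<lambda>x. (\<Prod>p\<in>P. of_real (Z (fst p) (snd p) x)) * exp (Complex \<eta> t * S n x))
     ((\<Prod>p\<in>P. B (snd p) t) * (of_real (exp \<kappa>0) * \<Phi> t) ^ n)"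
proof -
  define I where "I = {..<n} \<times> {..<m}"
  have I: "finite I" by (simp add: I_def)
  define g where "g p z = (if p \<in> P then of_real z else 1) * exp (Complex \<eta> t * (d (snd p) * z + lam (snd p) * z\<^sup>2))" for p :: "nat \<times> nat" and z :: real
  define X where "X p x = g p (Z (fst p) (snd p) x)" for p x
  have gm: "g p \<in> borel_measurable borel" for p unfolding g_def by measurable
  have iv: "indep_vars (\<lambda>_. borel) X I"
    unfolding X_def by (rule indep_vars_Pair_compose[OF prob_space_axioms indep gm])
  have X: "has_bochner_integral M (X p) ((if p \<in> P then B (snd p) t else 1) * F (snd p) t)" if "p \<in> I" for p
    using single_transform[where k = "snd p" and j = "fst p" and t = t] that by (cases p) (auto simp: X_def[abs_def] g_def I_def)
  have Xi: "integrable M (X p)" if "p \<in> I" for p using X[OF that] by (rule integrable.intros)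
  have "has_bochner_integral M (\<lambda>x. \<Prod>p\<in>I. X p x) (\<Prod>p\<in>I. (if p \<in> P then B (snd p) t else 1) * F (snd p) t)"
    using indep_vars_lebesgue_integral[OF I iv Xi] indep_vars_integrable[OF I iv Xi] X
    by (simp add: has_bochner_integral_iff)
  hence "has_bochner_integral M (\<lambda>x. exp (- (Complex \<eta> t * b)) ^ n * (\<Prod>p\<in>I. X p x))
     (exp (- (Complex \<eta> t * b)) ^ n * (\<Prod>p\<in>I. (if p \<in> P then B (snd p) t else 1) * F (snd p) t))"
    by (rule has_bochner_integral_mult_right)
  moreover have "exp (- (Complex \<eta> t * b)) ^ n * (\<Prod>p\<in>I. X p x) = (\<Prod>p\<in>P. of_real (Z (fst p) (snd p) x)) * exp (Complex \<eta> t * S n x)" for x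
  proof -
    have "(\<Prod>p\<in>I. X p x) = (\<Prod>p\<in>I. if p \<in> P then of_real (Z (fst p) (snd p) x) else 1) *
       (\<Prod>p\<in>I. exp (Complex \<eta> t * (d (snd p) * Z (fst p) (snd p) x + lam (snd p) * (Z (fst p) (snd p) x)\<^sup>2)))"
      by (simp add: X_def g_def prod.distrib)
    also have "(\<Prod>p\<in>I. if p \<in> P then complex_of_real (Z (fst p) (snd p) x) else 1) = (\<Prod>p\<in>P. of_real (Z (fst p) (snd p) x))"
      using I P by (subst prod.If_cases) (auto simp: I_def[symmetric] Int_absorb1)
    also have "(\<Prod>p\<in>I. exp (Complex \<eta> t * (d (snd p) * Z (fst p) (snd p) x + lam (snd p) * (Z (fst p) (snd p) x)\<^sup>2)))
       = exp (Complex \<eta> t * (\<Sum>j<n. \<Sum>k<m. d k * Z j k x + lam k * (Z j k x)\<^sup>2))"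
      unfolding exp_sum[OF I, symmetric] sum_distrib_left[symmetric] by (simp add: I_def sum.cartesian_product split_beta)
    finally have eq: "(\<Prod>p\<in>I. X p x) = (\<Prod>p\<in>P. of_real (Z (fst p) (snd p) x)) * exp (Complex \<eta> t * (\<Sum>j<n. \<Sum>k<m. d k * Z j k x + lam k * (Z j k x)\<^sup>2))" .
    have S: "complex_of_real (S n x) = of_real (\<Sum>j<n. \<Sum>k<m. d k * Z j k x + lam k * (Z j k x)\<^sup>2) - of_nat n * of_real b"
      by (simp add: S_def sum_subtractf)
    have "exp (Complex \<eta> t * S n x) = exp (Complex \<eta> t * (\<Sum>j<n. \<Sum>k<m. d k * Z j k x + lam k * (Z j k x)\<^sup>2)) * exp (of_nat n * (- (Complex \<eta> t * b)))"
      unfolding S exp_add[symmetric] by (rule arg_cong[of _ _ exp]) (simp only: right_diff_distrib, simp)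
    thus ?thesis unfolding eq exp_of_nat_mult by (simp only: mult_ac)
  qed
  moreover have "exp (- (Complex \<eta> t * b)) ^ n * (\<Prod>p\<in>I. (if p \<in> P then B (snd p) t else 1) * F (snd p) t)
     = (\<Prod>p\<in>P. B (snd p) t) * (of_real (exp \<kappa>0) * \<Phi> t) ^ n"
  proof -
    have "(\<Prod>p\<in>I. (if p \<in> P then B (snd p) t else 1)) = (\<Prod>p\<in>P. B (snd p) t)"
      using I P by (subst prod.If_cases) (auto simp: I_def[symmetric] Int_absorb1)
    moreover have "(\<Prod>p\<in>I. F (snd p) t) = (\<Prod>k<m. F k t) ^ n"
    proof -
      have "(\<Prod>j<n. \<Prod>k<m. F k t) = (\<Prod>p\<in>I. F (snd p) t)"
        unfolding I_def prod.cartesian_product by (simp add: split_beta)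
      thus ?thesis by simp
    qed
    ultimately show ?thesis unfolding prod.distrib prod_F[symmetric] power_mult_distrib by (simp only: mult_ac)
  qed
  ultimately show ?thesis by (simp only:)
qed

definition E :: "nat \<Rightarrow> 'a \<Rightarrow> real" where "E n x = exp (\<eta> * S n x)"

text \<open>For positive \<open>n\<close> this is the sample mean of \<open>W\<close> minus
  \<open>w0\<close>.\<close>

definition X :: "(nat \<Rightarrow> real) \<Rightarrow> nat \<Rightarrow> 'a \<Rightarrow> real" where
  "X w n x = (\<Sum>j<n. \<Sum>k<m. w k * Z j k x) / real n"

definition fB :: "(nat \<Rightarrow> real) \<Rightarrow> real \<Rightarrow> complex" where "fB w t = (\<Sum>k<m. of_real (w k) * B k t)"

lemma exp_tilt: "exp (Complex \<eta> t * S n x) = of_real (E n x) * iexp (t * S n x)"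
proof -
  have "Complex \<eta> t * S n x = of_real (\<eta> * S n x) + \<i> * of_real (t * S n x)" by (simp add: complex_eq_iff)
  thus ?thesis by (simp only: exp_add exp_of_real E_def)
qed

lemma E_transform: "has_bochner_integral M (\<lambda>x. of_real (E n x) * iexp (t * S n x)) ((of_real (exp \<kappa>0) * \<Phi> t) ^ n)"
  using joint_transform[of "{}" n t] by (simp add: exp_tilt)

text \<open>All \<open>n\<close> rows contribute the same factor, so averaging returns it unchanged
  and \<open>fB w\<close> is free of \<open>n\<close>.\<close>

lemma X_transform:
  assumes n: "n > 0"
  shows "has_bochner_integral M (\<lambda>x. of_real (X w n x * E n x) * iexp (t * S n x)) (fB w t * (of_real (exp \<kappa>0) * \<Phi> t) ^ n)"
proof -
  let ?G = "(of_real (exp \<kappa>0) * \<Phi> t) ^ n"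
  have "has_bochner_integral M (\<lambda>x. of_real (Z j k x) * (of_real (E n x) * iexp (t * S n x))) (B k t * ?G)" if "j < n" "k < m" for j k
    using joint_transform[of "{(j, k)}" n t] that by (simp add: exp_tilt)
  hence "has_bochner_integral M (\<lambda>x. (1 / of_nat n) * (\<Sum>j<n. \<Sum>k<m. of_real (w k) * (of_real (Z j k x) * (of_real (E n x) * iexp (t * S n x)))))
     ((1 / of_nat n) * (\<Sum>j<n. \<Sum>k<m. of_real (w k) * (B k t * ?G)))"
    by (intro has_bochner_integral_mult_right has_bochner_integral_sum) auto
  moreover have "(1 / of_nat n) * (\<Sum>j<n. \<Sum>k<m. of_real (w k) * (B k t * ?G)) = fB w t * ?G"
    using n by (simp add: fB_def sum_distrib_right mult.assoc)
  moreover have "(1 / of_nat n) * (\<Sum>j<n. \<Sum>k<m. of_real (w k) * (of_real (Z j k x) * (of_real (E n x) * iexp (t * S n x))))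
     = of_real (X w n x * E n x) * iexp (t * S n x)" for x
    by (simp add: X_def sum_distrib_left sum_distrib_right sum_divide_distrib mult_ac)
  ultimately show ?thesis by (simp only:)
qed

lemma E_pos: "E n x > 0" by (simp add: E_def)

lemma E_measurable[measurable]: "E n \<in> borel_measurable M"
  unfolding E_def by measurable

lemma X_measurable[measurable]: "X w n \<in> borel_measurable M"
  unfolding X_def by measurable

lemma integrable_E: "integrable M (E n)"
  using integrable_norm[OF integrable.intros[OF E_transform[of n 0]]] by (simp add: norm_mult E_def[abs_def])

lemma integrable_XE: "n > 0 \<Longrightarrow> integrable M (\<lambda>x. X w n x * E n x)"
  by (rule Bochner_Integration.integrable_bound[OF integrable_norm[OF integrable.intros[OF X_transform[of n w 0]]]])
     (auto simp: norm_mult abs_mult)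

lemma char_E: "char_weighted (E n) (S n) = (\<lambda>t. of_real (exp (n * \<kappa>0)) * \<Phi> t ^ n)"
  using has_bochner_integral_integral_eq[OF E_transform]
  by (auto simp: char_weighted_def fun_eq_iff power_mult_distrib exp_of_nat_mult)

lemma char_XE: "n > 0 \<Longrightarrow> char_weighted (\<lambda>x. X w n x * E n x) (S n) = (\<lambda>t. of_real (exp (n * \<kappa>0)) * (fB w t * \<Phi> t ^ n))"
  using has_bochner_integral_integral_eq[OF X_transform]
  by (auto simp: char_weighted_def fun_eq_iff power_mult_distrib exp_of_nat_mult)

text \<open>Second cumulant of the tilted loss, read off from the expansion of
  \<open>log_cf\<close>; with \<open>K3\<close> and \<open>K4\<close> it is matched to derivatives
  of the generating function in \<open>K_eq\<close>.\<close>

definition K2 :: real where "K2 = (\<Sum>k<m. 2 * (lt k)\<^sup>2 + (dt k)\<^sup>2)"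
definition K3 :: real where "K3 = (\<Sum>k<m. 8 * (lt k)^3 + 6 * lt k * (dt k)\<^sup>2)"
definition K4 :: real where "K4 = (\<Sum>k<m. 48 * (lt k)^4 + 48 * (lt k)\<^sup>2 * (dt k)\<^sup>2)"

lemma dt_square: "k < m \<Longrightarrow> (dt k)\<^sup>2 = (d k)\<^sup>2 / u k ^ 3"
  using u_pos[of k] by (simp add: dt_def power_divide power_mult_distrib power3_eq_cube power2_eq_square)

lemma K_eq: "cgf_deriv 2 m c lam d \<eta> = K2" "cgf_deriv 3 m c lam d \<eta> = K3" "cgf_deriv 4 m c lam d \<eta> = K4"
proof -
  have dom': "\<forall>k<m. 1 - 2 * lam k * \<eta> > 0" using dom by simp
  note c = cgf_deriv_eq[OF dom', of c d, folded u_def]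
  show "cgf_deriv 2 m c lam d \<eta> = K2"
    unfolding c K2_def using dt_square by (intro sum.cong refl) (simp add: lt_def power_divide)
  show "cgf_deriv 3 m c lam d \<eta> = K3"
    unfolding c K3_def using dt_square by (intro sum.cong refl) (simp add: lt_def power_divide eval_nat_numeral mult_ac)
  show "cgf_deriv 4 m c lam d \<eta> = K4"
    unfolding c K4_def using dt_square by (intro sum.cong refl) (simp add: lt_def power_divide eval_nat_numeral mult_ac)
qed

lemma nondeg_tilted: obtains k where "k < m" "lt k \<noteq> 0 \<or> dt k \<noteq> 0"
  using nondeg u_pos by (force simp: lt_def dt_def)

lemma K2_pos: "K2 > 0"
proof -
  obtain k where k: "k < m" "lt k \<noteq> 0 \<or> dt k \<noteq> 0" by (rule nondeg_tilted)
  have "0 < 2 * (lt k)\<^sup>2 + (dt k)\<^sup>2"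
    using k(2) by (auto intro: add_pos_nonneg add_nonneg_pos)
  also have "\<dots> \<le> K2" unfolding K2_def using k(1) by (intro member_le_sum) auto
  finally show ?thesis .
qed

text \<open>A single nondegenerate coordinate supplies the decay; all other factors have modulus at
  most one.\<close>

lemma \<Phi>_decay: obtains a where "a > 0" "\<And>t. cmod (\<Phi> t) ^ 4 \<le> 1 / (1 + a * t\<^sup>2)"
proof -
  obtain i where i: "i < m" "lt i \<noteq> 0 \<or> dt i \<noteq> 0" by (rule nondeg_tilted)
  obtain a where a: "a > 0" "\<And>t::real. cmod (exp (log_cf (dt i) (lt i) t)) ^ 4 \<le> 1 / (1 + a * t\<^sup>2)"
    using exp_log_cf_decay[OF i(2)] by metis
  have "cmod (\<Phi> t) \<le> cmod (exp (log_cf (dt i) (lt i) t))" for t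
  proof -
    have "cmod (exp (log_cf (dt k) (lt k) t - \<i> * of_real (lt k * t))) = cmod (exp (log_cf (dt k) (lt k) t))" for k
      by (simp only: norm_exp_eq_Re minus_complex.sel) simp
    hence "cmod (\<Phi> t) = (\<Prod>k<m. cmod (exp (log_cf (dt k) (lt k) t)))"
      unfolding \<Phi>_def exp_sum[OF finite_lessThan] by (simp only: prod_norm[symmetric])
    also have "\<dots> = cmod (exp (log_cf (dt i) (lt i) t)) * (\<Prod>k\<in>{..<m} - {i}. cmod (exp (log_cf (dt k) (lt k) t)))"
      using i(1) by (intro prod.remove) auto
    also have "\<dots> \<le> cmod (exp (log_cf (dt i) (lt i) t)) * 1"
      by (intro mult_left_mono prod_le_1) (simp_all only: cmod_exp_log_cf_le_1 norm_ge_zero simp_thms)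
    finally show ?thesis by simp
  qed
  hence "cmod (\<Phi> t) ^ 4 \<le> 1 / (1 + a * t\<^sup>2)" for t
    using power_mono[of "cmod (\<Phi> t)" "cmod (exp (log_cf (dt i) (lt i) t))" 4] a(2)[of t] by (meson norm_ge_zero order_trans)
  thus ?thesis using that a(1) by blast
qed

text \<open>The coefficient of \<open>1/n\<close> in Laplace's expansion for a weight with Taylor
  coefficients \<open>f0\<close>, \<open>f1\<close>, \<open>f2\<close>, after inserting the phase
  coefficients \<open>- \<i> * K3 / 6\<close> and \<open>K4 / 24\<close>. The multiple of
  \<open>f0\<close> is the classical correction of the saddlepoint density.\<close>

definition \<alpha> :: "complex \<Rightarrow> complex \<Rightarrow> complex \<Rightarrow> complex" where
  "\<alpha> f0 f1 f2 = f2 / K2 - \<i> * f1 * K3 / (2 * K2\<^sup>2) + f0 * (K4 / (8 * K2\<^sup>2) - 5 * K3\<^sup>2 / (24 * K2^3))"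

lemma \<Phi>_measurable[measurable]: "\<Phi> \<in> borel_measurable borel"
  unfolding \<Phi>_def by measurable

lemma J_expansion:
  fixes f0 f1 f2 f3 :: complex
  assumes meas[measurable]: "f \<in> borel_measurable borel"
    and f: "\<And>t. cmod (f t - (f0 + f1 * of_real t + f2 * of_real t^2 + f3 * of_real t^3)) \<le> C * t^4"
  obtains C' where "\<And>n. n \<ge> 12 \<Longrightarrow> integrable lborel (\<lambda>t. f t * \<Phi> t ^ n)"
    "\<And>n. n \<ge> 12 \<Longrightarrow> cmod (of_real (sqrt n) * (\<integral>t. f t * \<Phi> t ^ n \<partial>lborel)
       - of_real (sqrt (2 * pi / K2)) * (f0 + \<alpha> f0 f1 f2 / n)) \<le> C' / (real n)\<^sup>2"
proof -
  obtain a where a: "a > 0" "\<And>t. cmod (\<Phi> t) ^ 4 \<le> 1 / (1 + a * t\<^sup>2)" by (rule \<Phi>_decay) blast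
  define Fc where "Fc j = (if j = 0 then f0 else if j = 1 then f1 else if j = 2 then f2 else f3)" for j :: nat
  define A5 where "A5 = (\<Sum>k<m. 16 * (lt k)^5 / 5 + 4 * (lt k)^3 * (dt k)\<^sup>2)"
  define A where "A j = (if j = 3 then - \<i> * of_real (K3 / 6) else if j = 4 then of_real (K4 / 24) else \<i> * of_real A5)" for j :: nat
  define Cr where "Cr = (\<Sum>k<m. 32 * (lt k)^6 + 8 * (dt k)\<^sup>2 * (lt k)^4)"
  define r where "r t = (\<Sum>k<m. log_cf (dt k) (lt k) (of_real t) - \<i> * of_real (lt k * t)) + of_real (K2 * t\<^sup>2 / 2)" for t
  have rm: "r \<in> borel_measurable borel" unfolding r_def by measurable
  have r: "cmod (r t - (A 3 * of_real t^3 + A 4 * of_real t^4 + A 5 * of_real t^5)) \<le> Cr * t^6" for t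
  proof -
    have eq: "r t - (A 3 * of_real t^3 + A 4 * of_real t^4 + A 5 * of_real t^5)
      = (\<Sum>k<m. log_cf (dt k) (lt k) t - \<i> * of_real (lt k * t) + of_real ((2 * (lt k)\<^sup>2 + (dt k)\<^sup>2) * t\<^sup>2 / 2)
     - ((- \<i> * of_real ((8 * (lt k)^3 + 6 * lt k * (dt k)\<^sup>2) / 6)) * of_real t^3 + of_real ((48 * (lt k)^4 + 48 * (lt k)\<^sup>2 * (dt k)\<^sup>2) / 24) * of_real t^4
        + (\<i> * of_real (16 * (lt k)^5 / 5 + 4 * (lt k)^3 * (dt k)\<^sup>2)) * of_real t^5))"
    proof -
      have 2: "complex_of_real (K2 * t\<^sup>2 / 2) = (\<Sum>k<m. of_real ((2 * (lt k)\<^sup>2 + (dt k)\<^sup>2) * t\<^sup>2 / 2))"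
        unfolding K2_def sum_distrib_right sum_divide_distrib of_real_sum ..
      have 3: "A 3 * of_real t^3 = (\<Sum>k<m. (- \<i> * of_real ((8 * (lt k)^3 + 6 * lt k * (dt k)\<^sup>2) / 6)) * of_real t^3)"
        unfolding A_def K3_def by (simp only: sum_divide_distrib of_real_sum sum_distrib_left sum_distrib_right if_True refl)
      have 4: "A 4 * of_real t^4 = (\<Sum>k<m. of_real ((48 * (lt k)^4 + 48 * (lt k)\<^sup>2 * (dt k)\<^sup>2) / 24) * of_real t^4)"
        unfolding A_def K4_def by (simp add: sum_divide_distrib sum_distrib_right)
      have 5: "A 5 * of_real t^5 = (\<Sum>k<m. (\<i> * of_real (16 * (lt k)^5 / 5 + 4 * (lt k)^3 * (dt k)\<^sup>2)) * of_real t^5)"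
        unfolding A_def A5_def by (simp add: sum_distrib_left sum_distrib_right)
      show ?thesis unfolding r_def 2 3 4 5 by (simp only: sum.distrib sum_subtractf)
    qed
    show ?thesis unfolding eq Cr_def sum_distrib_right
      by (rule sum_norm_le) (rule log_cf_taylor)
  qed
  define Cm where "Cm = max C Cr"
  have f': "cmod (f t - (Fc 0 + Fc 1 * of_real t + Fc 2 * of_real t^2 + Fc 3 * of_real t^3)) \<le> Cm * t^4" for t
  proof -
    have "C * t^4 \<le> Cm * t^4" by (intro mult_right_mono) (auto simp: Cm_def)
    thus ?thesis using f[of t] by (simp add: Fc_def)
  qed
  have r': "cmod (r t - (A 3 * of_real t^3 + A 4 * of_real t^4 + A 5 * of_real t^5)) \<le> Cm * t^6" for t
    by (rule order_trans[OF r]) (intro mult_right_mono, auto simp: Cm_def)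
  have \<Phi>: "\<Phi> t = exp (of_real (- K2 * t\<^sup>2 / 2) + r t)" for t
    by (simp add: \<Phi>_def r_def)
  have al: "Fc 2 / K2 + 3 * (Fc 0 * A 4 + Fc 1 * A 3) / K2\<^sup>2 + 15 * Fc 0 * (A 3)\<^sup>2 / (2 * K2^3) = \<alpha> f0 f1 f2"
    unfolding \<alpha>_def using K2_pos by (simp add: Fc_def A_def power_mult_distrib power_divide field_simps)
  obtain C' where C': "\<And>n. n \<ge> 12 \<Longrightarrow> integrable lborel (\<lambda>t. f t * \<Phi> t ^ n)"
    "\<And>n. n \<ge> 12 \<Longrightarrow> cmod (of_real (sqrt n) * (\<integral>t. f t * \<Phi> t ^ n \<partial>lborel)
       - of_real (sqrt (2 * pi / K2)) * (Fc 0 + (Fc 2 / K2 + 3 * (Fc 0 * A 4 + Fc 1 * A 3) / K2\<^sup>2 + 15 * Fc 0 * (A 3)\<^sup>2 / (2 * K2^3)) / n)) \<le> C' / (real n)\<^sup>2"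
    by (rule laplace_expansion[OF K2_pos a(1) meas rm f' r' \<Phi> a(2)]) blast
  have "Fc 0 = f0" by (simp add: Fc_def)
  thus ?thesis using that[of C'] C' unfolding al by simp
qed

end

subsection \<open>Half-line kernels and local averages\<close>

text \<open>Moves a test function from the density to the transform side, where the tail kernel has
  a closed form. Integrability of both functions makes the double integral absolutely
  convergent.\<close>

lemma parseval_exchange:
  fixes q G :: "real \<Rightarrow> complex"
  assumes q: "integrable lborel q" and G: "integrable lborel G"
  shows "(\<integral>y. q y * (\<integral>t. iexp (- (t * y)) * G t \<partial>lborel) \<partial>lborel) = (\<integral>t. G t * (\<integral>y. q y * iexp (- (t * y)) \<partial>lborel) \<partial>lborel)"
proof -
  have [measurable]: "q \<in> borel_measurable borel" "G \<in> borel_measurable borel"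
    using q G by (auto dest: borel_measurable_integrable)
  define H where "H t y = G t * (q y * iexp (- (t * y)))" for t y :: real
  have H: "integrable (lborel \<Otimes>\<^sub>M lborel) (case_prod H)"
  proof (rule lborel_pair.Fubini_integrable)
    show "case_prod H \<in> borel_measurable (lborel \<Otimes>\<^sub>M lborel)" unfolding H_def by measurable
    have "(\<lambda>t. \<integral>y. norm (case_prod H (t, y)) \<partial>lborel) = (\<lambda>t. cmod (G t) * (\<integral>y. cmod (q y) \<partial>lborel))"
      by (simp add: H_def norm_mult)
    thus "integrable lborel (\<lambda>t. \<integral>y. norm (case_prod H (t, y)) \<partial>lborel)" using G by simp
    show "AE t in lborel. integrable lborel (\<lambda>y. case_prod H (t, y))"
      unfolding H_def case_prod_conv
      by (intro AE_I2 integrable_mult_right Bochner_Integration.integrable_bound[OF q]) (auto simp: norm_mult)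
  qed
  have "(\<integral>y. (\<integral>t. H t y \<partial>lborel) \<partial>lborel) = (\<integral>t. (\<integral>y. H t y \<partial>lborel) \<partial>lborel)"
    using H by (rule lborel_pair.Fubini_integral)
  moreover have "(\<integral>t. H t y \<partial>lborel) = q y * (\<integral>t. iexp (- (t * y)) * G t \<partial>lborel)" for y
    unfolding H_def by (subst integral_mult_right_zero[symmetric]) (simp only: mult_ac)
  moreover have "(\<integral>y. H t y \<partial>lborel) = G t * (\<integral>y. q y * iexp (- (t * y)) \<partial>lborel)" for t
    unfolding H_def by (rule integral_mult_right_zero)
  ultimately show ?thesis by (simp only:)
qed

lemma half_line_transform:
  fixes \<eta> t :: real
  assumes \<eta>: "\<eta> > 0"
  shows "has_bochner_integral lborel (\<lambda>y. indicator {0<..} y *\<^sub>R exp (- (Complex \<eta> t * of_real y))) (1 / Complex \<eta> t)"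
proof -
  define s where "s = Complex \<eta> t"
  have s: "s \<noteq> 0" using \<eta> by (auto simp: s_def complex_eq_iff)
  have n: "cmod (exp (- (s * of_real y))) = exp (- \<eta> * y)" for y
    by (simp add: s_def)
  \<comment> \<open>The Erlang density of index 0 is the exponential density, hence a multiple of
    the modulus of the integrand.\<close>
  have "integrable lborel (erlang_density 0 \<eta>)"
    by (rule integrableI_nonneg) (use nn_integral_erlang_ith_moment[OF \<eta>, of 0 0] \<eta> in auto)
  hence "integrable lborel (\<lambda>x. (1 / \<eta>) * erlang_density 0 \<eta> x)" by simp
  hence int: "integrable lborel (\<lambda>y. indicator {0<..} y *\<^sub>R exp (- (s * of_real y)))"
    by (rule Bochner_Integration.integrable_bound)
       (use \<eta> in \<open>auto simp: s_def erlang_density_def split: split_indicator\<close>)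
  have "(LBINT y=ereal 0..\<infinity>. exp (- (s * of_real y))) = 0 - (- 1 / s)"
  proof (rule interval_integral_FTC_integrable[where F = "\<lambda>y. - exp (- (s * of_real y)) / s"])
    fix y :: real
    have "((\<lambda>z. - exp (- (s * z)) / s) has_field_derivative exp (- (s * of_real y))) (at (of_real y))"
      using s by (auto intro!: derivative_eq_intros)
    thus "((\<lambda>y. - exp (- (s * of_real y)) / s) has_vector_derivative exp (- (s * of_real y))) (at y)"
      by (rule has_vector_derivative_real_field)
    show "isCont (\<lambda>y. exp (- (s * of_real y))) y" by (intro continuous_intros)
  next
    show "set_integrable lborel (einterval (ereal 0) \<infinity>) (\<lambda>y. exp (- (s * of_real y)))"
      using int by (simp add: set_integrable_def einterval_eq_Ici greaterThan_def einterval_def)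
    have "isCont (\<lambda>y::real. - exp (- (s * of_real y)) / s) 0" using s by (intro continuous_intros) auto
    hence "((\<lambda>y::real. - exp (- (s * of_real y)) / s) \<longlongrightarrow> - 1 / s) (at_right 0)"
      unfolding isCont_def by (auto intro: filterlim_mono at_le)
    thus "(((\<lambda>y. - exp (- (s * of_real y)) / s) \<circ> real_of_ereal) \<longlongrightarrow> - 1 / s) (at_right (ereal 0))"
      by (simp only: ereal_tendsto_simps)
    have "((\<lambda>y. cmod (- exp (- (s * of_real y)) / s)) \<longlongrightarrow> 0) at_top"
      unfolding norm_divide norm_minus_cancel n
      by (rule tendsto_divide_zero) (use \<eta> in real_asymp)
    hence "((\<lambda>y::real. - exp (- (s * of_real y)) / s) \<longlongrightarrow> 0) at_top" by (rule tendsto_norm_zero_cancel)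
    thus "(((\<lambda>y. - exp (- (s * of_real y)) / s) \<circ> real_of_ereal) \<longlongrightarrow> 0) (at_left \<infinity>)"
      by (simp only: ereal_tendsto_simps)
  qed auto
  hence "(\<integral>y. indicator {0<..} y *\<^sub>R exp (- (s * of_real y)) \<partial>lborel) = 1 / s"
    by (simp add: interval_lebesgue_integral_def set_lebesgue_integral_def einterval_def greaterThan_def)
  thus ?thesis using int by (simp add: has_bochner_integral_iff s_def)
qed

text \<open>For either sign of \<open>\<eta>\<close> its transform is \<open>1 / (\<eta> + it)\<close>. The two kernels differ by the full exponential
  \<open>exp (- \<eta> y)\<close>, which contributes only the expectation of the weight, here zero.\<close>
definition tail_kernel :: "real \<Rightarrow> real \<Rightarrow> real" where
  "tail_kernel \<eta> y = (if \<eta> > 0 then indicator {0..} y * exp (- \<eta> * y) else - (indicator {..<0} y * exp (- \<eta> * y)))"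

text \<open>Positive \<open>\<eta>\<close> is the half-line integral up to the null point 0.
  Negative \<open>\<eta>\<close> follows by reflecting \<open>y\<close>, which negates both
  components of \<open>Complex \<eta> t\<close>; this sign cancels the one in the kernel.\<close>

lemma tail_kernel_transform:
  assumes \<eta>: "\<eta> \<noteq> 0"
  shows "has_bochner_integral lborel (\<lambda>y. of_real (tail_kernel \<eta> y) * iexp (- (t * y))) (1 / Complex \<eta> t)"
proof -
  have e: "complex_of_real (exp (- \<eta> * y)) * iexp (- (t * y)) = exp (- (Complex \<eta> t * of_real y))" for y
    unfolding exp_of_real[symmetric] exp_add[symmetric] by (rule arg_cong[of _ _ exp]) (simp add: complex_eq_iff)
  show ?thesis
  proof (cases "\<eta> > 0")
    case True
    have "has_bochner_integral lborel (\<lambda>y. indicator {0<..} y *\<^sub>R exp (- (Complex \<eta> t * of_real y))) (1 / Complex \<eta> t)"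
      by (rule half_line_transform[OF True])
    moreover have "indicator {0<..} y *\<^sub>R exp (- (Complex \<eta> t * of_real y)) = of_real (tail_kernel \<eta> y) * iexp (- (t * y))" if "y \<noteq> 0" for y
      using that True by (auto simp: tail_kernel_def e[symmetric] split: split_indicator)
    ultimately show ?thesis
      by (subst (asm) has_bochner_integral_cong_AE[where g = "\<lambda>y. of_real (tail_kernel \<eta> y) * iexp (- (t * y))"])
         (use AE_lborel_singleton[of "0::real"] in \<open>auto simp: tail_kernel_def[abs_def] elim!: eventually_mono\<close>)
  next
    case False
    hence \<eta>': "- \<eta> > 0" using \<eta> by simp
    from half_line_transform[OF \<eta>', of "- t"]
    have "has_bochner_integral lborel (\<lambda>y. indicator {0<..} (0 + (-1) * y) *\<^sub>R exp (- (Complex (-\<eta>) (-t) * of_real (0 + (-1) * y)))) ((1 / Complex (-\<eta>) (-t)) /\<^sub>R \<bar>-1\<bar>)"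
      by (subst (asm) lborel_has_bochner_integral_real_affine_iff[where c = "-1" and t = 0]) auto
    hence "has_bochner_integral lborel (\<lambda>y. - (indicator {0<..} (0 + (-1) * y) *\<^sub>R exp (- (Complex (-\<eta>) (-t) * of_real (0 + (-1) * y))))) (- ((1 / Complex (-\<eta>) (-t)) /\<^sub>R \<bar>-1\<bar>))"
      by (rule has_bochner_integral_minus)
    moreover have "Complex (-\<eta>) (-t) = - Complex \<eta> t" by (simp add: complex_eq_iff)
    ultimately have "has_bochner_integral lborel (\<lambda>y. - (indicator {0<..} (- y) *\<^sub>R exp (- (Complex \<eta> t * of_real y)))) (1 / Complex \<eta> t)"
      by simp
    moreover have "(\<lambda>y. - (indicator {0<..} (- y) *\<^sub>R exp (- (Complex \<eta> t * of_real y)))) = (\<lambda>y. of_real (tail_kernel \<eta> y) * iexp (- (t * y)))"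
      using False by (auto simp: tail_kernel_def e[symmetric] fun_eq_iff split: split_indicator)
    ultimately show ?thesis by simp
  qed
qed

lemma tail_kernel_props:
  assumes \<eta>: "\<eta> \<noteq> 0"
  shows "tail_kernel \<eta> \<in> borel_measurable borel" "integrable lborel (tail_kernel \<eta>)" "\<bar>tail_kernel \<eta> y\<bar> \<le> 1"
    "y \<notin> {0} \<Longrightarrow> isCont (tail_kernel \<eta>) y"
proof -
  show m: "tail_kernel \<eta> \<in> borel_measurable borel" unfolding tail_kernel_def[abs_def] by measurable
  show "integrable lborel (tail_kernel \<eta>)"
    using integrable.intros[OF tail_kernel_transform[OF \<eta>, of 0]] m
    by (intro Bochner_Integration.integrable_bound[OF integrable_norm[OF integrable.intros[OF tail_kernel_transform[OF \<eta>, of 0]]]])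
       (auto simp: norm_mult)
  show "\<bar>tail_kernel \<eta> y\<bar> \<le> 1"
    by (auto simp: tail_kernel_def mult_nonpos_nonpos split: split_indicator)
  assume "y \<notin> {0}"
  then consider "y > 0" | "y < 0" by fastforce
  thus "isCont (tail_kernel \<eta>) y"
  proof cases
    case 1
    have "isCont (\<lambda>y. if \<eta> > 0 then exp (- \<eta> * y) else 0) y" by (cases "\<eta> > 0") (auto intro!: continuous_intros)
    moreover have "eventually (\<lambda>y. tail_kernel \<eta> y = (if \<eta> > 0 then exp (- \<eta> * y) else 0)) (nhds y)"
      using 1 by (intro eventually_nhds[THEN iffD2] exI[of _ "{0<..}"]) (auto simp: tail_kernel_def)
    ultimately show ?thesis by (subst isCont_cong)
  next
    case 2
    have "isCont (\<lambda>y. if \<eta> > 0 then 0 else - exp (- \<eta> * y)) y" by (cases "\<eta> > 0") (auto intro!: continuous_intros)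
    moreover have "eventually (\<lambda>y. tail_kernel \<eta> y = (if \<eta> > 0 then 0 else - exp (- \<eta> * y))) (nhds y)"
      using 2 by (intro eventually_nhds[THEN iffD2] exI[of _ "{..<0}"]) (auto simp: tail_kernel_def)
    ultimately show ?thesis by (subst isCont_cong)
  qed
qed

text \<open>The parameter \<open>p\<close> covers two windows: \<open>p = 1\<close> is symmetric and
  serves the conditional expectation, while \<open>p = 0\<close> is one-sided and serves positivity
  of the tail probability.\<close>

lemma average_tendsto:
  fixes g :: "real \<Rightarrow> complex" and p :: real
  assumes g: "isCont g 0" "\<And>y. cmod (g y) \<le> C" "g \<in> borel_measurable borel" and p: "p \<ge> 0"
  shows "((\<lambda>\<delta>. (1 / ((1 + p) * \<delta>)) *\<^sub>R (\<integral>y. indicator {- (p * \<delta>)<..<\<delta>} y *\<^sub>R g y \<partial>lborel)) \<longlongrightarrow> g 0) (at_right 0)"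
proof (rule tendstoI)
  fix e :: real assume e: "e > 0"
  obtain r where r: "r > 0" "\<And>y. \<bar>y\<bar> < r \<Longrightarrow> cmod (g y - g 0) \<le> e / 2"
    using g(1) e unfolding isCont_def LIM_eq by (metis diff_0_right half_gt_zero less_imp_le norm_zero real_norm_def right_minus_eq)
  define r' where "r' = r / (1 + p)"
  have r': "r' > 0" using r p by (simp add: r'_def)
  have "dist ((1 / ((1 + p) * \<delta>)) *\<^sub>R (\<integral>y. indicator {- (p * \<delta>)<..<\<delta>} y *\<^sub>R g y \<partial>lborel)) (g 0) < e" if \<delta>: "0 < \<delta>" "\<delta> < r'" for \<delta>
  proof -
    define I where "I = {- (p * \<delta>)<..<\<delta>}"
    have le: "- (p * \<delta>) \<le> \<delta>" using p \<delta> by (simp add: add_increasing minus_le_iff order_trans[of _ 0])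
    have mI: "measure lborel I = (1 + p) * \<delta>" using le by (simp add: I_def algebra_simps)
    have iI: "integrable lborel (indicator I :: real \<Rightarrow> real)" using le by (auto simp: I_def intro!: integrable_real_indicator)
    have ig: "integrable lborel (\<lambda>y. indicator I y *\<^sub>R g y)"
      by (rule Bochner_Integration.integrable_bound[OF integrable_mult_right[OF iI, of C]])
         (use g in \<open>auto simp: I_def split: split_indicator intro: order_trans[OF _ abs_ge_self]\<close>)
    have ic: "integrable lborel (\<lambda>y. indicator I y *\<^sub>R g 0)" using iI by simp
    have c: "(\<integral>y. indicator I y *\<^sub>R g 0 \<partial>lborel) = ((1 + p) * \<delta>) *\<^sub>R g 0"
      using iI mI by (simp add: integral_scaleR_left)
    have "cmod ((\<integral>y. indicator I y *\<^sub>R g y \<partial>lborel) - ((1 + p) * \<delta>) *\<^sub>R g 0) = cmod (\<integral>y. indicator I y *\<^sub>R g y - indicator I y *\<^sub>R g 0 \<partial>lborel)"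
      unfolding c[symmetric] using ig ic by simp
    also have "\<dots> \<le> (\<integral>y. cmod (indicator I y *\<^sub>R g y - indicator I y *\<^sub>R g 0) \<partial>lborel)" by (rule integral_norm_bound)
    also have "\<dots> \<le> (\<integral>y. (e / 2) * indicator I y \<partial>lborel)"
    proof (rule integral_mono)
      show "integrable lborel (\<lambda>y. cmod (indicator I y *\<^sub>R g y - indicator I y *\<^sub>R g 0))" using ig ic by simp
      show "integrable lborel (\<lambda>y. (e / 2) * indicator I y)" using iI by simp
      fix y
      show "cmod (indicator I y *\<^sub>R g y - indicator I y *\<^sub>R g 0) \<le> (e / 2) * indicator I y"
      proof (cases "y \<in> I")
        case True
        have "\<delta> * 1 \<le> \<delta> * (1 + p)" "p * \<delta> \<le> \<delta> * (1 + p)" using \<delta> p by (auto simp: algebra_simps)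
        moreover have "\<delta> * (1 + p) < r" using \<delta> p by (simp add: r'_def field_simps)
        ultimately have "\<bar>y\<bar> < r" using True by (auto simp: I_def)
        thus ?thesis using r(2) True by simp
      qed simp
    qed
    also have "\<dots> = (e / 2) * ((1 + p) * \<delta>)" using mI by simp
    finally have b: "cmod ((\<integral>y. indicator I y *\<^sub>R g y \<partial>lborel) - ((1 + p) * \<delta>) *\<^sub>R g 0) \<le> (e / 2) * ((1 + p) * \<delta>)" .
    have pos: "(1 + p) * \<delta> > 0" using p \<delta> by simp
    define w where "w = (1 + p) * \<delta>"
    define A where "A = (\<integral>y. indicator I y *\<^sub>R g y \<partial>lborel)"
    have "(1 / w) *\<^sub>R A - g 0 = (1 / w) *\<^sub>R (A - w *\<^sub>R g 0)"
      using less_imp_neq[OF pos] unfolding w_def[symmetric] by (simp add: scaleR_diff_right)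
    hence "cmod ((1 / w) *\<^sub>R A - g 0) = cmod (A - w *\<^sub>R g 0) / w" using pos by (simp add: w_def)
    also have "\<dots> \<le> e / 2" using b pos by (simp add: A_def w_def divide_le_eq)
    also have "\<dots> < e" using e by simp
    finally show ?thesis by (simp add: dist_norm A_def w_def I_def)
  qed
  thus "eventually (\<lambda>\<delta>. dist ((1 / ((1 + p) * \<delta>)) *\<^sub>R (\<integral>y. indicator {- (p * \<delta>)<..<\<delta>} y *\<^sub>R g y \<partial>lborel)) (g 0) < e) (at_right 0)"
    using r' by (intro eventually_at_rightI[of 0 r']) auto
qed

section \<open>Quotients of expansions in 1/n\<close>

lemma quotient_expansion:
  fixes a b :: "nat \<Rightarrow> complex" and a0 a1 b1 :: complex
  assumes a: "\<And>n. n \<ge> N \<Longrightarrow> cmod (a n - (a0 + a1 / n)) \<le> C / (real n)\<^sup>2"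
    and b: "\<And>n. n \<ge> N \<Longrightarrow> cmod (b n - (1 + b1 / n)) \<le> D / (real n)\<^sup>2"
  obtains C' N' where "N' \<ge> N" "N' \<ge> 1" "\<And>n. n \<ge> N' \<Longrightarrow> b n \<noteq> 0"
    "\<And>n. n \<ge> N' \<Longrightarrow> cmod (a n / b n - (a0 + (a1 - a0 * b1) / n)) \<le> C' / (real n)\<^sup>2"
proof -
  define c where "c = a1 - a0 * b1"
  \<comment> \<open>From here on \<open>b n\<close> differs from 1 by at most 1/2, which keeps it
    away from zero.\<close>
  define N' where "N' = max N (max 1 (nat \<lceil>2 * (cmod b1 + \<bar>D\<bar>)\<rceil>))"
  define R where "R = \<bar>C\<bar> + \<bar>D\<bar> * (cmod a0 + cmod c) + cmod (b1 * c)"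
  show ?thesis
  proof (rule that[of N' "2 * R"])
    show "N' \<ge> N" "N' \<ge> 1" by (auto simp: N'_def)
    fix n assume n: "n \<ge> N'"
    have nN: "n \<ge> N" and n1: "real n \<ge> 1" using n by (auto simp: N'_def)
    have nb: "2 * (cmod b1 + \<bar>D\<bar>) \<le> real n" using n by (simp add: N'_def)
    define i where "i = 1 / real n"
    have i: "0 < i" "i \<le> 1" using n1 by (auto simp: i_def)
    have bb: "cmod (b n) \<ge> 1 / 2"
    proof -
      have "D / (real n)\<^sup>2 \<le> \<bar>D\<bar> / real n" using n1 by (intro frac_le) (auto simp: power2_eq_square)
      hence "cmod (b n - (1 + b1 / n)) \<le> \<bar>D\<bar> / real n" using b[OF nN] by linarith
      moreover have "cmod (b1 / n) = cmod b1 / real n" by (simp add: norm_divide)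
      moreover have "1 = (1 + b1 / n - b n) + b n - b1 / n" by simp
      hence "1 \<le> cmod (1 + b1 / n - b n) + cmod (b n) + cmod (b1 / n)"
        using norm_triangle_ineq4[of "(1 + b1 / n - b n) + b n" "b1 / n"] norm_triangle_ineq[of "1 + b1 / n - b n" "b n"]
        by simp
      moreover have "(cmod b1 + \<bar>D\<bar>) / real n \<le> 1 / 2" using nb n1 by (simp add: divide_simps)
      ultimately show ?thesis unfolding add_divide_distrib norm_minus_commute[of "1 + b1 / n"] by linarith
    qed
    thus b0: "b n \<noteq> 0" by auto
    have "a n / b n - (a0 + c / n) = (a n - b n * (a0 + c / n)) / b n" using b0 by (simp add: diff_divide_distrib)
    \<comment> \<open>The value of \<open>c\<close> makes the \<open>1/n\<close> terms cancel; the
      two given errors and one explicit term of order \<open>1/n^2\<close> remain.\<close>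
    moreover have "a n - b n * (a0 + c / n) = (a n - (a0 + a1 / n)) - (b n - (1 + b1 / n)) * (a0 + c / n) - b1 * c / (of_nat n)\<^sup>2"
    proof -
      have "x - y * (a0 + c * I) = (x - (a0 + a1 * I)) - (y - (1 + b1 * I)) * (a0 + c * I) - b1 * c * I^2" for x y I
        unfolding c_def by algebra
      from this[of "a n" "b n" "inverse (of_nat n)"] show ?thesis by (simp only: divide_inverse power_inverse)
    qed
    moreover have "cmod ((a n - (a0 + a1 / n)) - (b n - (1 + b1 / n)) * (a0 + c / n) - b1 * c / (of_nat n)\<^sup>2) \<le> R / (real n)\<^sup>2"
    proof -
      have "cmod (a n - (a0 + a1 / n)) \<le> \<bar>C\<bar> / (real n)\<^sup>2"
        using a[OF nN] by (rule order_trans) (intro divide_right_mono, auto)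
      moreover have "cmod ((b n - (1 + b1 / n)) * (a0 + c / n)) \<le> \<bar>D\<bar> / (real n)\<^sup>2 * (cmod a0 + cmod c)"
        unfolding norm_mult
      proof (intro mult_mono)
        show "cmod (b n - (1 + b1 / n)) \<le> \<bar>D\<bar> / (real n)\<^sup>2"
          using b[OF nN] by (rule order_trans) (intro divide_right_mono, auto)
        have "cmod (c / n) \<le> cmod c" using n1 by (simp add: norm_divide divide_le_eq mult_le_cancel_left1)
        thus "cmod (a0 + c / n) \<le> cmod a0 + cmod c" using norm_triangle_ineq[of a0 "c / n"] by linarith
      qed auto
      moreover have "cmod (b1 * c / (of_nat n)\<^sup>2) = cmod (b1 * c) / (real n)\<^sup>2" by (simp add: norm_divide norm_power)
      ultimately have "cmod ((a n - (a0 + a1 / n)) - (b n - (1 + b1 / n)) * (a0 + c / n) - b1 * c / (of_nat n)\<^sup>2)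
        \<le> \<bar>C\<bar> / (real n)\<^sup>2 + \<bar>D\<bar> / (real n)\<^sup>2 * (cmod a0 + cmod c) + cmod (b1 * c) / (real n)\<^sup>2"
        using norm_triangle_ineq4[of "(a n - (a0 + a1 / n)) - (b n - (1 + b1 / n)) * (a0 + c / n)" "b1 * c / (of_nat n)\<^sup>2"]
          norm_triangle_ineq4[of "a n - (a0 + a1 / n)" "(b n - (1 + b1 / n)) * (a0 + c / n)"] by linarith
      thus ?thesis by (simp add: R_def add_divide_distrib)
    qed
    ultimately have "cmod (a n / b n - (a0 + c / n)) \<le> R / (real n)\<^sup>2 / (1 / 2)"
      using bb by (simp only: norm_divide) (intro frac_le, auto simp: R_def)
    thus "cmod (a n / b n - (a0 + (a1 - a0 * b1) / n)) \<le> 2 * R / (real n)\<^sup>2" by (simp add: c_def mult.commute)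
  qed
qed

context quadratic_gaussian_sample
begin

subsection \<open>Conditional and tail expectations\<close>

text \<open>The cofactor of \<open>s = Complex \<eta> t\<close> in \<open>fB\<close>: its k-th
  summand is \<open>w k * d k / (1 - 2 * lam k * s)\<close>, with \<open>u k\<close> taken out of
  the denominator.\<close>

definition fh :: "(nat \<Rightarrow> real) \<Rightarrow> real \<Rightarrow> complex" where
  "fh w t = (\<Sum>k<m. of_real (w k * d k / u k) * (1 / (1 - \<i> * of_real (2 * lt k * t))))"

lemma fB_eq: "fB w t = Complex \<eta> t * fh w t"
  unfolding fB_def fh_def sum_distrib_left
proof (intro sum.cong refl)
  fix k assume "k \<in> {..<m}"
  hence u0: "u k > 0" using u_pos by simp
  define q where "q = 1 - \<i> * complex_of_real (2 * lt k * t)"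
  have q: "q \<noteq> 0" using cmod_one_minus_imaginary_ge[of "2 * lt k * t"] by (auto simp: q_def)
  have "u k * lt k = lam k" using u0 by (simp add: lt_def)
  hence ul: "complex_of_real (u k) * of_real (lt k) = of_real (lam k)" by (simp flip: of_real_mult)
  have "complex_of_real (u k) * q = of_real (u k) - 2 * \<i> * (complex_of_real (u k) * of_real (lt k)) * of_real t"
    by (simp add: q_def algebra_simps)
  hence "complex_of_real (u k) * q = of_real (u k) - 2 * \<i> * of_real (lam k) * of_real t"
    unfolding ul .
  \<comment> \<open>The relation \<open>u k = 1 - 2 * lam k * \<eta>\<close> is what lets the common
    factor \<open>s\<close> split off.\<close>
  moreover have "H * (U - 2 * \<i> * L * T) + \<i> * T = U * (H + \<i> * T)" if "U = 1 - 2 * L * H" for U L H T :: complex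
    unfolding that by (simp add: algebra_simps)
  moreover have "complex_of_real (u k) = 1 - 2 * of_real (lam k) * of_real \<eta>" by (simp add: u_def)
  ultimately have "of_real \<eta> * (of_real (u k) * q) + \<i> * of_real t = of_real (u k) * Complex \<eta> t"
    unfolding Complex_eq by (simp only:)
  hence "complex_of_real \<eta> + \<i> * t / (u k * q) = Complex \<eta> t * (1 / q)"
    using q u0 by (simp add: field_simps)
  moreover have "1 - 2 * \<i> * of_real (lt k) * of_real t = q" by (simp add: q_def)
  ultimately show "of_real (w k) * B k t = Complex \<eta> t * (of_real (w k * d k / u k) * (1 / (1 - \<i> * of_real (2 * lt k * t))))"
    unfolding B_def q_def[symmetric] by (simp add: mult_ac)
qed

lemma fh_taylor:
  "cmod (fh w t - ((\<Sum>k<m. of_real (w k * d k / u k)) + (\<Sum>k<m. of_real (w k * d k / u k) * (2 * \<i> * lt k)) * of_real t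
     + (\<Sum>k<m. of_real (w k * d k / u k) * (2 * \<i> * lt k)^2) * of_real t^2 + (\<Sum>k<m. of_real (w k * d k / u k) * (2 * \<i> * lt k)^3) * of_real t^3))
     \<le> (\<Sum>k<m. \<bar>w k * d k / u k\<bar> * (2 * lt k)^4) * t^4"
proof -
  define R where "R k = 1 / (1 - \<i> * of_real (2 * lt k * t)) - (\<Sum>j<4. (\<i> * of_real (2 * lt k * t)) ^ j)" for k
  have "fh w t - ((\<Sum>k<m. of_real (w k * d k / u k)) + (\<Sum>k<m. of_real (w k * d k / u k) * (2 * \<i> * lt k)) * of_real t
     + (\<Sum>k<m. of_real (w k * d k / u k) * (2 * \<i> * lt k)^2) * of_real t^2 + (\<Sum>k<m. of_real (w k * d k / u k) * (2 * \<i> * lt k)^3) * of_real t^3)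
    = (\<Sum>k<m. of_real (w k * d k / u k) * R k)"
    unfolding fh_def sum_distrib_right sum.distrib[symmetric] sum_subtractf[symmetric]
    by (intro sum.cong refl) (simp add: R_def eval_nat_numeral algebra_simps)
  moreover have "cmod (\<Sum>k<m. of_real (w k * d k / u k) * R k) \<le> (\<Sum>k<m. \<bar>w k * d k / u k\<bar> * (2 * lt k)^4 * t^4)"
  proof (rule sum_norm_le)
    fix k
    have "cmod (R k) \<le> (2 * lt k)^4 * t^4"
      using geometric_remainder_imaginary[of "2 * lt k * t" 4] unfolding R_def by (simp add: power_mult_distrib power_even_abs)
    thus "cmod (of_real (w k * d k / u k) * R k) \<le> \<bar>w k * d k / u k\<bar> * (2 * lt k)^4 * t^4"
      unfolding norm_mult norm_of_real mult.assoc by (intro mult_left_mono) auto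
  qed
  ultimately show ?thesis by (simp only: sum_distrib_right)
qed

lemma fB_taylor:
  "cmod (fB w t - ((\<Sum>k<m. complex_of_real (w k * d k / u k) * of_real \<eta>) + (\<Sum>k<m. of_real (w k * d k / u k) * (\<i> / u k)) * of_real t
     + (\<Sum>k<m. of_real (w k * d k / u k) * (\<i> / u k * (2 * \<i> * lt k))) * of_real t^2 + (\<Sum>k<m. of_real (w k * d k / u k) * (\<i> / u k * (2 * \<i> * lt k)^2)) * of_real t^3))
     \<le> (\<Sum>k<m. \<bar>w k * d k / u k\<bar> * (1 / \<bar>u k\<bar> * \<bar>2 * lt k\<bar>^3)) * t^4"
proof -
  \<comment> \<open>Three geometric terms are enough for an error of order \<open>t^4\<close>,
    because \<open>B k t\<close> multiplies the fraction by a further \<open>t\<close>.\<close>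
  define R where "R k = 1 / (1 - \<i> * of_real (2 * lt k * t)) - (\<Sum>j<3. (\<i> * of_real (2 * lt k * t)) ^ j)" for k
  have B: "B k t = of_real (d k / u k) * (\<eta> + \<i> / u k * t * (R k + (\<Sum>j<3. (\<i> * of_real (2 * lt k * t)) ^ j)))" for k
    by (simp add: B_def R_def mult_ac)
  have "fB w t - ((\<Sum>k<m. complex_of_real (w k * d k / u k) * of_real \<eta>) + (\<Sum>k<m. of_real (w k * d k / u k) * (\<i> / u k)) * of_real t
     + (\<Sum>k<m. of_real (w k * d k / u k) * (\<i> / u k * (2 * \<i> * lt k))) * of_real t^2 + (\<Sum>k<m. of_real (w k * d k / u k) * (\<i> / u k * (2 * \<i> * lt k)^2)) * of_real t^3)
    = (\<Sum>k<m. of_real (w k * d k / u k) * (\<i> / u k * t * R k))"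
    unfolding fB_def sum_distrib_right sum.distrib[symmetric] sum_subtractf[symmetric] B
    by (intro sum.cong refl) (simp add: eval_nat_numeral algebra_simps)
  moreover have "cmod (\<Sum>k<m. of_real (w k * d k / u k) * (\<i> / u k * t * R k)) \<le> (\<Sum>k<m. \<bar>w k * d k / u k\<bar> * (1 / \<bar>u k\<bar> * \<bar>2 * lt k\<bar>^3) * t^4)"
  proof (rule sum_norm_le)
    fix k
    have "cmod (R k) \<le> \<bar>2 * lt k\<bar>^3 * \<bar>t\<bar>^3"
      using geometric_remainder_imaginary[of "2 * lt k * t" 3] unfolding R_def by (simp add: power_mult_distrib abs_mult)
    hence "1 / \<bar>u k\<bar> * \<bar>t\<bar> * cmod (R k) \<le> 1 / \<bar>u k\<bar> * \<bar>t\<bar> * (\<bar>2 * lt k\<bar>^3 * \<bar>t\<bar>^3)" by (intro mult_left_mono) auto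
    also have "\<dots> = 1 / \<bar>u k\<bar> * \<bar>2 * lt k\<bar>^3 * \<bar>t\<bar>^4" by (simp add: eval_nat_numeral mult_ac)
    finally have "1 / \<bar>u k\<bar> * \<bar>t\<bar> * cmod (R k) \<le> 1 / \<bar>u k\<bar> * \<bar>2 * lt k\<bar>^3 * t^4" by (simp only: power_even_abs even_numeral)
    moreover have "cmod (\<i> / u k * t * R k) = 1 / \<bar>u k\<bar> * \<bar>t\<bar> * cmod (R k)" by (simp add: norm_mult norm_divide)
    ultimately show "cmod (of_real (w k * d k / u k) * (\<i> / u k * t * R k)) \<le> \<bar>w k * d k / u k\<bar> * (1 / \<bar>u k\<bar> * \<bar>2 * lt k\<bar>^3) * t^4"
      unfolding norm_mult[of "of_real (w k * d k / u k)"] norm_of_real mult.assoc[of "\<bar>w k * d k / u k\<bar>"] by (intro mult_left_mono) auto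
  qed
  ultimately show ?thesis by (simp only: sum_distrib_right)
qed

definition J :: "nat \<Rightarrow> (real \<Rightarrow> complex) \<Rightarrow> complex" where
  "J n f = (\<integral>t. f t * \<Phi> t ^ n \<partial>lborel)"

lemma fh_measurable[measurable]: "fh w \<in> borel_measurable borel" unfolding fh_def by measurable
lemma fB_measurable[measurable]: "fB w \<in> borel_measurable borel" unfolding fB_def B_def by measurable

lemma integrable_\<Phi>: "n \<ge> 12 \<Longrightarrow> integrable lborel (\<lambda>t. \<Phi> t ^ n)"
  using J_expansion[of "\<lambda>_. 1" 1 0 0 0 0] by auto

lemma integrable_fB_\<Phi>: "n \<ge> 12 \<Longrightarrow> integrable lborel (\<lambda>t. fB w t * \<Phi> t ^ n)"
  using J_expansion[OF fB_measurable fB_taylor[of w]] by metis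

lemma integrable_char_E: "n \<ge> 12 \<Longrightarrow> integrable lborel (char_weighted (E n) (S n))"
  unfolding char_E by (intro integrable_mult_right integrable_\<Phi>)

lemma integrable_char_XE: "n \<ge> 12 \<Longrightarrow> integrable lborel (char_weighted (\<lambda>x. X w n x * E n x) (S n))"
  by (subst char_XE) (auto intro!: integrable_mult_right integrable_fB_\<Phi>)

lemma density_E_0: "density_weighted (E n) (S n) 0 = of_real (exp (n * \<kappa>0) / (2 * pi)) * J n (\<lambda>_. 1)"
  by (simp add: density_weighted_def char_E J_def)

lemma density_XE_0: "n > 0 \<Longrightarrow> density_weighted (\<lambda>x. X w n x * E n x) (S n) 0 = of_real (exp (n * \<kappa>0) / (2 * pi)) * J n (fB w)"
  by (simp add: density_weighted_def char_XE J_def)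

lemma integrable_X: "integrable M (X w n)" and expectation_X: "expectation (X w n) = 0"
proof -
  have "has_bochner_integral M (\<lambda>x. Z j k x) 0" for j k
  proof -
    have "has_bochner_integral lborel (\<lambda>z. std_normal_density z * z) 0"
      using std_normal_moment_odd[of 0] by simp
    hence "integrable M (\<lambda>x. Z j k x)" "(\<integral>x. Z j k x \<partial>M) = 0"
      using distributed_integrable[OF dist[of j k], of "\<lambda>x. x"] distributed_integral[OF dist[of j k], of "\<lambda>x. x"]
      by (auto simp: has_bochner_integral_iff)
    thus ?thesis by (simp add: has_bochner_integral_iff)
  qed
  hence "has_bochner_integral M (\<lambda>x. (1 / real n) * (\<Sum>j<n. \<Sum>k<m. w k * Z j k x)) ((1 / real n) * (\<Sum>j<n. \<Sum>k<m. w k * 0))"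
    by (intro has_bochner_integral_mult_right has_bochner_integral_sum) auto
  hence "has_bochner_integral M (X w n) 0" by (simp add: X_def[abs_def])
  thus "integrable M (X w n)" "expectation (X w n) = 0" by (auto simp: has_bochner_integral_iff)
qed

lemma tail_expectation:
  assumes n: "n \<ge> 12" and \<eta>: "\<eta> \<noteq> 0"
  shows "complex_of_real (\<integral>x. X w n x * indicator {x \<in> space M. S n x \<ge> 0} x \<partial>M) = of_real (exp (n * \<kappa>0) / (2 * pi)) * J n (fh w)"
proof -
  let ?X = "\<lambda>x. X w n x * E n x"
  let ?G = "char_weighted ?X (S n)"
  have n0: "n > 0" using n by simp
  note q = tail_kernel_props[OF \<eta>]
  have "complex_of_real (\<integral>x. ?X x * tail_kernel \<eta> (S n x) \<partial>M) = (\<integral>y. of_real (tail_kernel \<eta> y) * density_weighted ?X (S n) y \<partial>lborel)"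
    \<comment> \<open>The kernel jumps only at 0.\<close>
    by (rule fourier_inversion[where D = "{0}", OF integrable_E E_pos integrable_char_E[OF n] integrable_XE[OF n0] integrable_char_XE[OF n] S_measurable
        q(1,2,3) _ q(4)]) simp_all
  also have "\<dots> = (\<integral>y. of_real (tail_kernel \<eta> y) * (\<integral>t. iexp (- (t * y)) * ?G t \<partial>lborel) \<partial>lborel) / of_real (2 * pi)"
    unfolding density_weighted_def times_divide_eq_right by (rule integral_divide_zero)
  also have "(\<integral>y. of_real (tail_kernel \<eta> y) * (\<integral>t. iexp (- (t * y)) * ?G t \<partial>lborel) \<partial>lborel)
     = (\<integral>t. ?G t * (\<integral>y. of_real (tail_kernel \<eta> y) * iexp (- (t * y)) \<partial>lborel) \<partial>lborel)"
    by (rule parseval_exchange[OF integrable_of_real[OF q(2)] integrable_char_XE[OF n]])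
  also have "\<dots> = (\<integral>t. of_real (exp (n * \<kappa>0)) * (fh w t * \<Phi> t ^ n) \<partial>lborel)"
  proof (intro Bochner_Integration.integral_cong refl)
    fix t
    have "Complex \<eta> t \<noteq> 0" using \<eta> by (simp add: complex_eq_iff)
    thus "?G t * (\<integral>y. of_real (tail_kernel \<eta> y) * iexp (- (t * y)) \<partial>lborel) = of_real (exp (n * \<kappa>0)) * (fh w t * \<Phi> t ^ n)"
      unfolding has_bochner_integral_integral_eq[OF tail_kernel_transform[OF \<eta>]] char_XE[OF n0] fB_eq by simp
  qed
  also have "\<dots> = of_real (exp (n * \<kappa>0)) * J n (fh w)" unfolding J_def by (rule integral_mult_right_zero)
  finally have 1: "complex_of_real (\<integral>x. ?X x * tail_kernel \<eta> (S n x) \<partial>M) = of_real (exp (n * \<kappa>0) / (2 * pi)) * J n (fh w)"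
    by simp
  have ind: "integrable M (\<lambda>x. X w n x * indicator {x \<in> space M. S n x \<ge> 0} x)"
    by (rule Bochner_Integration.integrable_bound[OF integrable_X[of w n]]) (auto split: split_indicator)
  have "(\<integral>x. ?X x * tail_kernel \<eta> (S n x) \<partial>M) = (\<integral>x. X w n x * indicator {x \<in> space M. S n x \<ge> 0} x \<partial>M)"
  proof (cases "\<eta> > 0")
    case True
    thus ?thesis by (intro Bochner_Integration.integral_cong refl)
      (auto simp: tail_kernel_def E_def simp flip: exp_add split: split_indicator)
  next
    case False
    have "(\<integral>x. ?X x * tail_kernel \<eta> (S n x) \<partial>M) = (\<integral>x. X w n x * indicator {x \<in> space M. S n x \<ge> 0} x - X w n x \<partial>M)"
      using False by (intro Bochner_Integration.integral_cong refl)
      (auto simp: tail_kernel_def E_def simp flip: exp_add split: split_indicator)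
    also have "\<dots> = (\<integral>x. X w n x * indicator {x \<in> space M. S n x \<ge> 0} x \<partial>M) - expectation (X w n)"
      by (rule Bochner_Integration.integral_diff[OF ind integrable_X])
    finally show ?thesis by (simp add: expectation_X)
  qed
  with 1 show ?thesis by simp
qed

text \<open>Inversion concerns the tilted weight \<open>V x * E n x\<close>, so the test function
  carries \<open>exp (- \<eta> * y)\<close> to undo the tilt; at \<open>y = 0\<close> this factor is
  one. Taking \<open>V\<close> constant yields window probabilities, and \<open>V = X w n\<close>
  the numerators of conditional expectations.\<close>

lemma local_density:
  assumes n: "n \<ge> 12" and p: "p \<ge> 0"
    and V: "integrable M (\<lambda>x. V x * E n x)" "integrable lborel (char_weighted (\<lambda>x. V x * E n x) (S n))"
  shows "((\<lambda>\<delta>. complex_of_real ((\<integral>x. V x * indicator {x \<in> space M. - (p * \<delta>) < S n x \<and> S n x < \<delta>} x \<partial>M) / ((1 + p) * \<delta>)))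
      \<longlongrightarrow> density_weighted (\<lambda>x. V x * E n x) (S n) 0) (at_right 0)"
proof -
  define D where "D = density_weighted (\<lambda>x. V x * E n x) (S n)"
  \<comment> \<open>Clamping keeps \<open>exp (- \<eta> * cl y)\<close> bounded and continuous on
    the line, while \<open>cl y = y\<close> on every window with
    \<open>\<delta> < 1\<close>.\<close>
  define cl where "cl y = max (- p - 1) (min 1 y)" for y :: real
  define g where "g y = of_real (exp (- \<eta> * cl y)) * D y" for y
  have Dc: "isCont D y" for y unfolding D_def by (rule isCont_density_weighted[OF V(2)])
  hence Dm[measurable]: "D \<in> borel_measurable borel"
    by (intro borel_measurable_continuous_onI continuous_at_imp_continuous_on) simp
  have gm: "g \<in> borel_measurable borel" unfolding g_def cl_def by measurable
  have gc: "isCont g 0" unfolding g_def cl_def using Dc by (intro continuous_intros) auto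
  have cl: "\<bar>cl y\<bar> \<le> p + 1" for y using p by (auto simp: cl_def)
  have ecl: "exp (- \<eta> * cl y) \<le> exp (\<bar>\<eta>\<bar> * (p + 1))" for y
  proof -
    have "- \<eta> * cl y \<le> \<bar>\<eta>\<bar> * \<bar>cl y\<bar>" using abs_ge_self[of "- \<eta> * cl y"] by (simp add: abs_mult)
    also have "\<dots> \<le> \<bar>\<eta>\<bar> * (p + 1)" using cl by (intro mult_left_mono) auto
    finally show ?thesis by simp
  qed
  have gb: "cmod (g y) \<le> exp (\<bar>\<eta>\<bar> * (p + 1)) * (\<integral>t. cmod (char_weighted (\<lambda>x. V x * E n x) (S n) t) \<partial>lborel)" for y
    unfolding g_def norm_mult norm_of_real D_def using ecl[of y] norm_density_weighted_le[OF V(2)]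
    by (intro mult_mono) auto
  have eq: "complex_of_real ((\<integral>x. V x * indicator {x \<in> space M. - (p * \<delta>) < S n x \<and> S n x < \<delta>} x \<partial>M) / ((1 + p) * \<delta>))
      = (1 / ((1 + p) * \<delta>)) *\<^sub>R (\<integral>y. indicator {- (p * \<delta>)<..<\<delta>} y *\<^sub>R g y \<partial>lborel)" if \<delta>: "0 < \<delta>" "\<delta> < 1" for \<delta>
  proof -
    define f where "f y = indicator {- (p * \<delta>)<..<\<delta>} y * exp (- \<eta> * cl y)" for y
    have pd: "p * \<delta> \<le> p" using p \<delta> by (simp add: mult_left_le)
    have "0 \<le> p * \<delta>" using p \<delta> by simp
    hence le: "- (p * \<delta>) \<le> \<delta>" using \<delta> by linarith
    have clI: "cl y = y" if "- (p * \<delta>) < y" "y < \<delta>" for y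
      using that pd \<delta> by (simp add: cl_def)
    have fm: "f \<in> borel_measurable borel" unfolding f_def cl_def by measurable
    have fb: "\<bar>f y\<bar> \<le> exp (\<bar>\<eta>\<bar> * (p + 1))" for y
      using ecl[of y] by (auto simp: f_def split: split_indicator)
    have "integrable lborel (\<lambda>y. exp (\<bar>\<eta>\<bar> * (p + 1)) * indicator {- (p * \<delta>)<..<\<delta>} y :: real)"
      using le by (intro integrable_mult_right integrable_real_indicator) auto
    hence fi: "integrable lborel f"
      by (rule Bochner_Integration.integrable_bound) (use fm ecl in \<open>auto simp: f_def split: split_indicator\<close>)
    have fc: "isCont f y" if y: "y \<notin> {- (p * \<delta>), \<delta>}" for y
    proof (cases "y \<in> {- (p * \<delta>)<..<\<delta>}")
      case True
      have "eventually (\<lambda>y. f y = exp (- \<eta> * cl y)) (nhds y)"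
        using True by (intro eventually_nhds[THEN iffD2] exI[of _ "{- (p * \<delta>)<..<\<delta>}"]) (auto simp: f_def)
      moreover have "isCont (\<lambda>y. exp (- \<eta> * cl y)) y" unfolding cl_def by (intro continuous_intros)
      ultimately show ?thesis by (subst isCont_cong)
    next
      case False
      have "eventually (\<lambda>y. f y = 0) (nhds y)"
        using False y by (intro eventually_nhds[THEN iffD2] exI[of _ "- {- (p * \<delta>)..\<delta>}"]) (auto simp: f_def)
      thus ?thesis by (subst isCont_cong) auto
    qed
    have "complex_of_real (\<integral>x. (V x * E n x) * f (S n x) \<partial>M) = (\<integral>y. of_real (f y) * D y \<partial>lborel)"
      unfolding D_def by (rule fourier_inversion[where D = "{- (p * \<delta>), \<delta>}", OF integrable_E E_pos integrable_char_E[OF n] V S_measurable fm fi fb _ fc]) simp_all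
    also have "(\<integral>y. of_real (f y) * D y \<partial>lborel) = (\<integral>y. indicator {- (p * \<delta>)<..<\<delta>} y *\<^sub>R g y \<partial>lborel)"
      by (intro Bochner_Integration.integral_cong refl) (auto simp: f_def g_def split: split_indicator)
    also have "(\<integral>x. (V x * E n x) * f (S n x) \<partial>M) = (\<integral>x. V x * indicator {x \<in> space M. - (p * \<delta>) < S n x \<and> S n x < \<delta>} x \<partial>M)"
      by (intro Bochner_Integration.integral_cong refl)
        (auto simp: f_def E_def clI simp flip: exp_add split: split_indicator)
    finally have "complex_of_real (\<integral>x. V x * indicator {x \<in> space M. - (p * \<delta>) < S n x \<and> S n x < \<delta>} x \<partial>M) = (\<integral>y. indicator {- (p * \<delta>)<..<\<delta>} y *\<^sub>R g y \<partial>lborel)" .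
    thus ?thesis by (simp add: scaleR_conv_of_real)
  qed
  have "((\<lambda>\<delta>. (1 / ((1 + p) * \<delta>)) *\<^sub>R (\<integral>y. indicator {- (p * \<delta>)<..<\<delta>} y *\<^sub>R g y \<partial>lborel)) \<longlongrightarrow> g 0) (at_right 0)"
    by (rule average_tendsto[OF gc gb gm p])
  moreover have "g 0 = D 0" using p by (simp add: g_def cl_def)
  moreover have "eventually (\<lambda>\<delta>. complex_of_real ((\<integral>x. V x * indicator {x \<in> space M. - (p * \<delta>) < S n x \<and> S n x < \<delta>} x \<partial>M) / ((1 + p) * \<delta>))
      = (1 / ((1 + p) * \<delta>)) *\<^sub>R (\<integral>y. indicator {- (p * \<delta>)<..<\<delta>} y *\<^sub>R g y \<partial>lborel)) (at_right 0)"
    by (rule eventually_at_rightI[of 0 1]) (use eq in auto)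
  ultimately show ?thesis unfolding D_def[symmetric] by (subst tendsto_cong) simp_all
qed

lemma event_measurable: "{x \<in> space M. - (p * \<delta>) < S n x \<and> S n x < \<delta>} \<in> sets M" "{x \<in> space M. S n x \<ge> 0} \<in> sets M"
  by measurable

lemma density_E_nonzero:
  assumes "n \<ge> 12" "J n (\<lambda>_. 1) \<noteq> 0" "p \<ge> 0"
  shows "((\<lambda>\<delta>. complex_of_real (measure M {x \<in> space M. - (p * \<delta>) < S n x \<and> S n x < \<delta>} / ((1 + p) * \<delta>)))
      \<longlongrightarrow> of_real (exp (n * \<kappa>0) / (2 * pi)) * J n (\<lambda>_. 1)) (at_right 0)"
  unfolding density_E_0[symmetric]
  using local_density[OF assms(1,3), of "\<lambda>_. 1"] integrable_E integrable_char_E[OF assms(1)]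
  by (simp add: event_measurable Int_absorb2 sets.sets_into_space)

text \<open>The conditional expectation is a ratio of two local densities at 0, in which the window
  length and the factor \<open>exp (n * \<kappa>0) / (2 * pi)\<close> cancel.\<close>

lemma has_cond_exp_at_sample:
  assumes n: "n \<ge> 12" and J: "J n (\<lambda>_. 1) \<noteq> 0"
    and Y: "\<And>x. S n x = real n * (Ybar x - v)" and W: "\<And>x. Wbar x = w0 + X w n x"
  shows "has_cond_exp_at M Wbar Ybar v (w0 + Re (J n (fB w) / J n (\<lambda>_. 1)))"
proof -
  have n0: "real n > 0" using n by simp
  define A where "A \<delta> = {x \<in> space M. - (1 * \<delta>) < S n x \<and> S n x < \<delta>}" for \<delta>
  define P where "P \<delta> = measure M (A \<delta>)" for \<delta>
  define T where "T \<delta> = (\<integral>x. X w n x * indicator (A \<delta>) x \<partial>M)" for \<delta>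
  define c where "c = complex_of_real (exp (n * \<kappa>0) / (2 * pi))"
  have c: "c \<noteq> 0" by (simp add: c_def)
  have A[measurable]: "A \<delta> \<in> sets M" for \<delta> unfolding A_def by (rule event_measurable)
  have P: "((\<lambda>\<delta>. complex_of_real (P \<delta> / ((1 + 1) * \<delta>))) \<longlongrightarrow> c * J n (\<lambda>_. 1)) (at_right 0)"
    using density_E_nonzero[OF n J, of 1] unfolding P_def A_def c_def by simp
  have T: "((\<lambda>\<delta>. complex_of_real (T \<delta> / ((1 + 1) * \<delta>))) \<longlongrightarrow> c * J n (fB w)) (at_right 0)"
    using local_density[OF n, of 1 "X w n"] integrable_XE[of n w] integrable_char_XE[OF n, of w] density_XE_0[of n w] n
    unfolding T_def A_def c_def by simp
  have lim: "((\<lambda>\<delta>. Re (complex_of_real (T \<delta> / ((1 + 1) * \<delta>)) / complex_of_real (P \<delta> / ((1 + 1) * \<delta>)))) \<longlongrightarrow> Re (J n (fB w) / J n (\<lambda>_. 1))) (at_right 0)"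
    using tendsto_Re[OF tendsto_divide[OF T P]] c J by simp
  have "eventually (\<lambda>\<delta>. complex_of_real (P \<delta> / ((1 + 1) * \<delta>)) \<noteq> 0) (at_right 0)"
    by (rule tendsto_imp_eventually_ne[OF P]) (use c J in simp)
  hence "eventually (\<lambda>\<delta>. w0 + Re (complex_of_real (T \<delta> / ((1 + 1) * \<delta>)) / complex_of_real (P \<delta> / ((1 + 1) * \<delta>)))
     = (\<integral>x. Wbar x * indicator (A \<delta>) x \<partial>M) / P \<delta>) (at_right 0)"
    using eventually_at_right_less[of "0::real"]
  proof eventually_elim
    case (elim \<delta>)
    hence P0: "P \<delta> \<noteq> 0" and d: "\<delta> > 0" by auto
    have "integrable M (\<lambda>x. X w n x * indicator (A \<delta>) x)"
      by (rule Bochner_Integration.integrable_bound[OF integrable_X[of w n]]) (auto split: split_indicator)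
    moreover have "integrable M (indicator (A \<delta>) :: 'a \<Rightarrow> real)"
      by (intro integrable_real_indicator A) (simp add: emeasure_eq_measure)
    ultimately have "(\<integral>x. w0 * indicator (A \<delta>) x + X w n x * indicator (A \<delta>) x \<partial>M) = w0 * P \<delta> + T \<delta>"
      by (subst Bochner_Integration.integral_add) (auto simp: P_def T_def Int_absorb2 sets.sets_into_space)
    hence "(\<integral>x. Wbar x * indicator (A \<delta>) x \<partial>M) = w0 * P \<delta> + T \<delta>" by (simp add: W distrib_right)
    moreover have "T \<delta> / ((1 + 1) * \<delta>) / (P \<delta> / ((1 + 1) * \<delta>)) = T \<delta> / P \<delta>" using d by simp
    ultimately show ?case using P0 unfolding of_real_divide[symmetric] by (simp add: add_divide_distrib)
  qed
  moreover have "((\<lambda>\<delta>. w0 + Re (complex_of_real (T \<delta> / ((1 + 1) * \<delta>)) / complex_of_real (P \<delta> / ((1 + 1) * \<delta>)))) \<longlongrightarrow> w0 + Re (J n (fB w) / J n (\<lambda>_. 1))) (at_right 0)"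
    by (intro tendsto_add tendsto_const lim)
  ultimately have "((\<lambda>\<delta>. (\<integral>x. Wbar x * indicator (A \<delta>) x \<partial>M) / P \<delta>) \<longlongrightarrow> w0 + Re (J n (fB w) / J n (\<lambda>_. 1))) (at_right 0)"
    by (rule Lim_transform_eventually[rotated])
  \<comment> \<open>Half-width \<open>\<epsilon>\<close> for the sample mean is half-width
    \<open>n * \<epsilon>\<close> for the sum \<open>S n\<close>.\<close>
  moreover have "filterlim (\<lambda>\<epsilon>. real n * \<epsilon>) (at_right 0) (at_right 0)"
    using n0 by real_asymp
  ultimately have "((\<lambda>\<epsilon>. (\<integral>x. Wbar x * indicator (A (real n * \<epsilon>)) x \<partial>M) / P (real n * \<epsilon>)) \<longlongrightarrow> w0 + Re (J n (fB w) / J n (\<lambda>_. 1))) (at_right 0)"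
    by (rule filterlim_compose)
  moreover have "A (real n * \<epsilon>) = {x \<in> space M. \<bar>Ybar x - v\<bar> < \<epsilon>}" for \<epsilon>
  proof -
    have "(- (1 * (real n * \<epsilon>)) < real n * z \<and> real n * z < real n * \<epsilon>) \<longleftrightarrow> \<bar>z\<bar> < \<epsilon>" for z
    proof -
      have "- (1 * (real n * \<epsilon>)) = real n * (- \<epsilon>)" by simp
      thus ?thesis using n0 by (simp only: mult_less_cancel_left_pos) auto
    qed
    thus ?thesis unfolding A_def Y by (simp only:)
  qed
  ultimately show ?thesis unfolding has_cond_exp_at_def P_def by simp
qed

text \<open>One-sided windows starting at 0 lie in the tail event and have positive probability for
  small \<open>\<delta>\<close>, as the density at 0 is nonzero.\<close>

lemma tail_positive:
  assumes n: "n \<ge> 12" and J: "J n (\<lambda>_. 1) \<noteq> 0"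
  shows "measure M {x \<in> space M. S n x \<ge> 0} > 0"
proof -
  have "eventually (\<lambda>\<delta>. complex_of_real (measure M {x \<in> space M. - (0 * \<delta>) < S n x \<and> S n x < \<delta>} / ((1 + 0) * \<delta>)) \<noteq> 0) (at_right 0)"
    by (rule tendsto_imp_eventually_ne[OF density_E_nonzero[OF n J]]) (use J in auto)
  then obtain \<delta> where "complex_of_real (measure M {x \<in> space M. - (0 * \<delta>) < S n x \<and> S n x < \<delta>} / ((1 + 0) * \<delta>)) \<noteq> 0"
    using eventually_happens trivial_limit_at_right_real by blast
  hence "measure M {x \<in> space M. - (0 * \<delta>) < S n x \<and> S n x < \<delta>} \<noteq> 0" by auto
  hence "0 < measure M {x \<in> space M. - (0 * \<delta>) < S n x \<and> S n x < \<delta>}" by (simp add: zero_less_measure_iff)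
  also have "\<dots> \<le> measure M {x \<in> space M. S n x \<ge> 0}"
    by (intro finite_measure_mono event_measurable) auto
  finally show ?thesis .
qed

section \<open>Expansions of the normalizing integral, of the ratio and of the tail\<close>

lemma one_expansion:
  obtains C where "\<And>n. n \<ge> 12 \<Longrightarrow> cmod (of_real (sqrt n) * J n (\<lambda>_. 1) - of_real (sqrt (2 * pi / K2)) * (1 + \<alpha> 1 0 0 / n)) \<le> C / (real n)\<^sup>2"
proof -
  have "cmod (1 - (1 + 0 * of_real t + 0 * of_real t^2 + 0 * of_real t^3)) \<le> 0 * t^4" for t :: real by simp
  then obtain C' where "\<And>n. n \<ge> 12 \<Longrightarrow> cmod (of_real (sqrt n) * (\<integral>t. 1 * \<Phi> t ^ n \<partial>lborel)
       - of_real (sqrt (2 * pi / K2)) * (1 + \<alpha> 1 0 0 / n)) \<le> C' / (real n)\<^sup>2"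
    using J_expansion[OF borel_measurable_const] by metis
  thus ?thesis by (intro that[of C']) (simp add: J_def)
qed

definition \<gamma> :: "(nat \<Rightarrow> real) \<Rightarrow> real" where
  "\<gamma> w = (\<Sum>k<m. w k * d k / u k ^ 3 * ((K3 * u k - 4 * lam k * K2) / (2 * K2\<^sup>2)))"

text \<open>The part of \<open>\<alpha>\<close> proportional to its first argument is common to
  numerator and denominator and drops out of the \<open>1/n\<close> coefficient, which therefore
  involves only \<open>K2\<close> and the first power of \<open>K3\<close>.\<close>

lemma ratio_expansion:
  obtains C N where "N \<ge> 12" "\<And>n. n \<ge> N \<Longrightarrow> J n (\<lambda>_. 1) \<noteq> 0"
    "\<And>n. n \<ge> N \<Longrightarrow> \<bar>Re (J n (fB w) / J n (\<lambda>_. 1)) - ((\<Sum>k<m. w k * d k / u k * \<eta>) + \<gamma> w / n)\<bar> \<le> C / (real n)\<^sup>2"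
proof -
  define s where "s = complex_of_real (sqrt (2 * pi / K2))"
  have s: "s \<noteq> 0" using K2_pos by (simp add: s_def)
  define F0 where "F0 = (\<Sum>k<m. complex_of_real (w k * d k / u k) * of_real \<eta>)"
  define F1 where "F1 = (\<Sum>k<m. complex_of_real (w k * d k / u k) * (\<i> / u k))"
  define F2 where "F2 = (\<Sum>k<m. complex_of_real (w k * d k / u k) * (\<i> / u k * (2 * \<i> * lt k)))"
  obtain C1 where C1: "\<And>n. n \<ge> 12 \<Longrightarrow> cmod (of_real (sqrt n) * J n (fB w) - s * (F0 + \<alpha> F0 F1 F2 / n)) \<le> C1 / (real n)\<^sup>2"
    unfolding J_def s_def F0_def F1_def F2_def by (rule J_expansion[OF fB_measurable fB_taylor[of w]]) blast
  obtain C2 where C2: "\<And>n. n \<ge> 12 \<Longrightarrow> cmod (of_real (sqrt n) * J n (\<lambda>_. 1) - s * (1 + \<alpha> 1 0 0 / n)) \<le> C2 / (real n)\<^sup>2"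
    unfolding s_def by (rule one_expansion) blast
  \<comment> \<open>Both expansions are divided by their common Gaussian constant \<open>s\<close>,
    so that the denominator starts with 1.\<close>
  have sc: "cmod (x / s - y) \<le> C / cmod s / (real n)\<^sup>2" if "cmod (x - s * y) \<le> C / (real n)\<^sup>2" for x y C n
  proof -
    have "x / s - y = (x - s * y) / s" using s by (simp add: diff_divide_distrib)
    hence "cmod (x / s - y) = cmod (x - s * y) / cmod s" by (simp only: norm_divide)
    also have "\<dots> \<le> C / (real n)\<^sup>2 / cmod s" using that by (intro divide_right_mono) auto
    finally show ?thesis by (simp add: mult.commute)
  qed
  obtain C N where N: "N \<ge> 12" "N \<ge> 1" "\<And>n. n \<ge> N \<Longrightarrow> of_real (sqrt n) * J n (\<lambda>_. 1) / s \<noteq> 0"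
    "\<And>n. n \<ge> N \<Longrightarrow> cmod ((of_real (sqrt n) * J n (fB w) / s) / (of_real (sqrt n) * J n (\<lambda>_. 1) / s) - (F0 + (\<alpha> F0 F1 F2 - F0 * \<alpha> 1 0 0) / n)) \<le> C / (real n)\<^sup>2"
    by (rule quotient_expansion[OF sc[OF C1] sc[OF C2]]) auto
  have lead: "F0 = of_real (\<Sum>k<m. w k * d k / u k * \<eta>)" unfolding F0_def by simp
  have second: "\<alpha> F0 F1 F2 - F0 * \<alpha> 1 0 0 = of_real (\<gamma> w)"
  proof -
    have "\<alpha> F0 F1 F2 - F0 * \<alpha> 1 0 0 = F2 / K2 - \<i> * F1 * K3 / (2 * K2\<^sup>2)"
      unfolding \<alpha>_def by (simp add: algebra_simps)
    also have "\<dots> = (\<Sum>k<m. complex_of_real (w k * d k / u k) * (\<i> / u k * (2 * \<i> * lt k)) / K2 - \<i> * (complex_of_real (w k * d k / u k) * (\<i> / u k)) * K3 / (2 * K2\<^sup>2))"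
      unfolding F1_def F2_def by (simp only: sum_divide_distrib sum_distrib_left sum_distrib_right sum_subtractf)
    also have "\<dots> = of_real (\<gamma> w)"
      unfolding \<gamma>_def of_real_sum
    proof (intro sum.cong refl)
      fix k assume "k \<in> {..<m}"
      hence u0: "u k \<noteq> 0" using u_pos[of k] by simp
      have K0: "K2 \<noteq> 0" using K2_pos by simp
      have "complex_of_real (w k * d k / u k) * (\<i> / u k * (2 * \<i> * lt k)) / K2 - \<i> * (complex_of_real (w k * d k / u k) * (\<i> / u k)) * K3 / (2 * K2\<^sup>2)
        = of_real (w k * d k / u k * (- 2 * lt k / u k) / K2 + w k * d k / u k * (1 / u k) * K3 / (2 * K2\<^sup>2))"
      proof -
        have "a * (\<i> / U * (2 * \<i> * l)) / K - \<i> * (a * (\<i> / U)) * k3 / (2 * K\<^sup>2) = a * (- 2 * l / U) / K + a * (1 / U) * k3 / (2 * K\<^sup>2)"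
          for a U l K k3 :: complex by (simp add: algebra_simps)
        thus ?thesis by (simp only: of_real_add of_real_mult of_real_divide of_real_minus of_real_numeral of_real_power of_real_1)
      qed
      also have "w k * d k / u k * (- 2 * lt k / u k) / K2 + w k * d k / u k * (1 / u k) * K3 / (2 * K2\<^sup>2)
         = w k * d k / u k ^ 3 * ((K3 * u k - 4 * lam k * K2) / (2 * K2\<^sup>2))"
        using u0 K0 by (simp add: lt_def field_simps eval_nat_numeral)
      finally show "complex_of_real (w k * d k / u k) * (\<i> / u k * (2 * \<i> * lt k)) / K2 - \<i> * (complex_of_real (w k * d k / u k) * (\<i> / u k)) * K3 / (2 * K2\<^sup>2)
        = of_real (w k * d k / u k ^ 3 * ((K3 * u k - 4 * lam k * K2) / (2 * K2\<^sup>2)))" .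
    qed
    finally show ?thesis .
  qed
  show ?thesis
  proof (rule that[of N C])
    show "N \<ge> 12" by fact
    fix n assume n: "n \<ge> N"
    show J: "J n (\<lambda>_. 1) \<noteq> 0" using N(3)[OF n] by auto
    have "(of_real (sqrt n) * J n (fB w) / s) / (of_real (sqrt n) * J n (\<lambda>_. 1) / s) = J n (fB w) / J n (\<lambda>_. 1)"
      using s n N(2) by simp
    note q = this
    have v: "F0 + (\<alpha> F0 F1 F2 - F0 * \<alpha> 1 0 0) / n = of_real ((\<Sum>k<m. w k * d k / u k * \<eta>) + \<gamma> w / n)"
      unfolding second by (simp only: lead of_real_add of_real_divide of_real_of_nat_eq)
    from N(4)[OF n] have "cmod (J n (fB w) / J n (\<lambda>_. 1) - of_real ((\<Sum>k<m. w k * d k / u k * \<eta>) + \<gamma> w / n)) \<le> C / (real n)\<^sup>2"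
      unfolding q v .
    moreover have "\<bar>Re (J n (fB w) / J n (\<lambda>_. 1) - of_real ((\<Sum>k<m. w k * d k / u k * \<eta>) + \<gamma> w / n))\<bar> \<le> cmod (J n (fB w) / J n (\<lambda>_. 1) - of_real ((\<Sum>k<m. w k * d k / u k * \<eta>) + \<gamma> w / n))"
      by (rule abs_Re_le_cmod)
    ultimately show "\<bar>Re (J n (fB w) / J n (\<lambda>_. 1)) - ((\<Sum>k<m. w k * d k / u k * \<eta>) + \<gamma> w / n)\<bar> \<le> C / (real n)\<^sup>2"
      by simp
  qed
qed

text \<open>The value of \<open>\<alpha>\<close> for one coordinate of \<open>fh\<close>, whose
  Taylor coefficients relative to the leading one are powers of
  \<open>2 * \<i> * lt k\<close>.\<close>

definition \<beta> :: "nat \<Rightarrow> real" where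
  "\<beta> k = - 4 * (lt k)\<^sup>2 / K2 + lt k * K3 / K2\<^sup>2 + K4 / (8 * K2\<^sup>2) - 5 * K3\<^sup>2 / (24 * K2^3)"

text \<open>Only the numerator of the tail expectation is expanded. The error keeps the factor
  \<open>exp (n * \<kappa>0)\<close> and so stays relative to the Gaussian density in the final
  formula.\<close>

lemma tail_expansion:
  assumes \<eta>: "\<eta> \<noteq> 0"
  obtains C where "\<And>n. n \<ge> 12 \<Longrightarrow> \<bar>(\<integral>x. X w n x * indicator {x \<in> space M. S n x \<ge> 0} x \<partial>M)
     - exp (n * \<kappa>0) / sqrt (2 * pi) / (sqrt n * sqrt K2) * (\<Sum>k<m. w k * d k / u k * (1 + \<beta> k / n))\<bar>
       \<le> C * (exp (n * \<kappa>0) / sqrt (2 * pi) / sqrt n) * (1 / (real n)\<^sup>2)"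
proof -
  define s where "s = sqrt (2 * pi / K2)"
  define F0 where "F0 = (\<Sum>k<m. complex_of_real (w k * d k / u k))"
  define F1 where "F1 = (\<Sum>k<m. complex_of_real (w k * d k / u k) * (2 * \<i> * lt k))"
  define F2 where "F2 = (\<Sum>k<m. complex_of_real (w k * d k / u k) * (2 * \<i> * lt k)^2)"
  obtain C where C: "\<And>n. n \<ge> 12 \<Longrightarrow> cmod (of_real (sqrt n) * J n (fh w) - of_real s * (F0 + \<alpha> F0 F1 F2 / n)) \<le> C / (real n)\<^sup>2"
    unfolding J_def s_def F0_def F1_def F2_def by (rule J_expansion[OF fh_measurable fh_taylor[of w]]) blast
  have al: "F0 + \<alpha> F0 F1 F2 / n = of_real (\<Sum>k<m. w k * d k / u k * (1 + \<beta> k / n))" for n :: nat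
  proof -
    have "\<alpha> F0 F1 F2 = (\<Sum>k<m. complex_of_real (w k * d k / u k) * (2 * \<i> * lt k)^2 / K2 - \<i> * (complex_of_real (w k * d k / u k) * (2 * \<i> * lt k)) * K3 / (2 * K2\<^sup>2)
        + complex_of_real (w k * d k / u k) * (K4 / (8 * K2\<^sup>2) - 5 * K3\<^sup>2 / (24 * K2^3)))"
      unfolding \<alpha>_def F0_def F1_def F2_def by (simp only: sum_divide_distrib sum_distrib_left sum_distrib_right sum_subtractf sum.distrib)
    also have "\<dots> = (\<Sum>k<m. complex_of_real (w k * d k / u k * \<beta> k))"
    proof (intro sum.cong refl)
      fix k
      show "complex_of_real (w k * d k / u k) * (2 * \<i> * lt k)^2 / K2 - \<i> * (complex_of_real (w k * d k / u k) * (2 * \<i> * lt k)) * K3 / (2 * K2\<^sup>2)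
        + complex_of_real (w k * d k / u k) * (K4 / (8 * K2\<^sup>2) - 5 * K3\<^sup>2 / (24 * K2^3)) = complex_of_real (w k * d k / u k * \<beta> k)"
      proof -
        have "a * (2 * \<i> * l)^2 / K - \<i> * (a * (2 * \<i> * l)) * k3 / (2 * K\<^sup>2) + a * r = a * (- 4 * l\<^sup>2 / K + l * k3 / K\<^sup>2 + r)" for a l K k3 r :: complex
          by (simp add: power_mult_distrib algebra_simps add_divide_distrib)
        thus ?thesis unfolding \<beta>_def by (simp add: algebra_simps)
      qed
    qed
    finally have "F0 + \<alpha> F0 F1 F2 / n = (\<Sum>k<m. complex_of_real (w k * d k / u k) + complex_of_real (w k * d k / u k * \<beta> k) / n)"
      unfolding F0_def by (simp only: sum.distrib sum_divide_distrib)
    thus ?thesis by (simp add: algebra_simps)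
  qed
  show ?thesis
  proof (rule that[of "C / sqrt (2 * pi)"])
    fix n :: nat assume n: "n \<ge> 12"
    define T where "T = (\<integral>x. X w n x * indicator {x \<in> space M. S n x \<ge> 0} x \<partial>M)"
    define L where "L = (\<Sum>k<m. w k * d k / u k * (1 + \<beta> k / n))"
    define e where "e = exp (n * \<kappa>0)"
    have n0: "sqrt n > 0" using n by simp
    have "complex_of_real T = of_real (e / (2 * pi)) * J n (fh w)"
      unfolding T_def e_def by (rule tail_expectation[OF n \<eta>])
    hence "complex_of_real (T - e / (2 * pi) / sqrt n * (s * L)) = of_real (e / (2 * pi) / sqrt n) * (of_real (sqrt n) * J n (fh w) - of_real s * (F0 + \<alpha> F0 F1 F2 / n))"
      unfolding al L_def[symmetric] using n0 by (simp add: field_simps)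
    hence "\<bar>T - e / (2 * pi) / sqrt n * (s * L)\<bar> = e / (2 * pi) / sqrt n * cmod (of_real (sqrt n) * J n (fh w) - of_real s * (F0 + \<alpha> F0 F1 F2 / n))"
    proof -
      assume eq: "complex_of_real (T - e / (2 * pi) / sqrt n * (s * L)) = of_real (e / (2 * pi) / sqrt n) * (of_real (sqrt n) * J n (fh w) - of_real s * (F0 + \<alpha> F0 F1 F2 / n))"
      have "0 \<le> e / (2 * pi) / sqrt n" using n0 by (simp add: e_def)
      thus ?thesis using arg_cong[OF eq, of cmod] unfolding norm_mult norm_of_real by (simp only: abs_of_nonneg)
    qed
    also have "\<dots> \<le> e / (2 * pi) / sqrt n * (C / (real n)\<^sup>2)" using C[OF n] n0 by (intro mult_left_mono) (auto simp: e_def)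
    also have "\<dots> = C / sqrt (2 * pi) * (e / sqrt (2 * pi) / sqrt n) * (1 / (real n)\<^sup>2)"
    proof -
      have "2 * pi = sqrt (2 * pi) * sqrt (2 * pi)" by simp
      hence e2: "e / (2 * pi) = e / sqrt (2 * pi) / sqrt (2 * pi)" by (metis divide_divide_eq_left)
      show ?thesis unfolding e2 by (simp only: divide_inverse mult_ac mult_1_left)
    qed
    finally have "\<bar>T - e / (2 * pi) / sqrt n * (s * L)\<bar> \<le> C / sqrt (2 * pi) * (e / sqrt (2 * pi) / sqrt n) * (1 / (real n)\<^sup>2)" .
    moreover have "e / (2 * pi) / sqrt n * (s * L) = e / sqrt (2 * pi) / (sqrt n * sqrt K2) * L"
    proof -
      have "2 * pi = sqrt (2 * pi) * sqrt (2 * pi)" by simp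
      hence e2: "e / (2 * pi) = e / sqrt (2 * pi) / sqrt (2 * pi)" by (metis divide_divide_eq_left)
      have s2: "s = sqrt (2 * pi) / sqrt K2" unfolding s_def by (rule real_sqrt_divide)
      have gen: "a / r / r / p * (r / k * L) = a / r / (p * k) * L" if "r \<noteq> 0" for a r p k :: real
        using that by simp
      have "sqrt (2 * pi) \<noteq> 0" by simp
      thus ?thesis unfolding e2 s2 by (rule gen)
    qed
    ultimately show "\<bar>(\<integral>x. X w n x * indicator {x \<in> space M. S n x \<ge> 0} x \<partial>M)
     - exp (n * \<kappa>0) / sqrt (2 * pi) / (sqrt n * sqrt K2) * (\<Sum>k<m. w k * d k / u k * (1 + \<beta> k / n))\<bar>
       \<le> C / sqrt (2 * pi) * (exp (n * \<kappa>0) / sqrt (2 * pi) / sqrt n) * (1 / (real n)\<^sup>2)"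
      unfolding T_def e_def L_def by simp
  qed
qed

text \<open>Guarantees that the square root defining \<open>\<omega>\<close> squares back to its
  argument. Once the saddlepoint equation is inserted, each coordinate is nonpositive by
  \<open>ln x \<le> x - 1\<close> at \<open>x = 1 / u k\<close>.\<close>

lemma \<kappa>0_nonpos: "\<kappa>0 \<le> 0"
proof -
  have "\<eta> * b = (\<Sum>k<m. \<eta> * ((lam k * u k + (d k)\<^sup>2 * (1 - lam k * \<eta>) * \<eta>) / (u k)\<^sup>2))"
    unfolding saddle[symmetric] u_def sum_distrib_left ..
  hence "\<kappa>0 = (\<Sum>k<m. ((d k)\<^sup>2 * \<eta>\<^sup>2 / (2 * u k) - ln (u k) / 2) - \<eta> * ((lam k * u k + (d k)\<^sup>2 * (1 - lam k * \<eta>) * \<eta>) / (u k)\<^sup>2))"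
    unfolding \<kappa>0_def by (simp only: sum_subtractf)
  also have "\<dots> \<le> 0"
  proof (rule sum_nonpos)
    fix k assume "k \<in> {..<m}"
    hence u0: "u k > 0" using u_pos by simp
    have "ln (1 / u k) \<le> 1 / u k - 1" using u0 by (intro ln_le_minus_one) simp
    hence l: "- ln (u k) / 2 \<le> (1 / u k - 1) / 2" using u0 by (simp add: ln_div)
    have le: "\<eta> * lam k = (1 - u k) / 2" by (simp add: u_def)
    have "\<eta> * ((lam k * u k + (d k)\<^sup>2 * (1 - lam k * \<eta>) * \<eta>) / (u k)\<^sup>2) = (\<eta> * lam k) / u k + (d k)\<^sup>2 * \<eta>\<^sup>2 * (1 - \<eta> * lam k) / (u k)\<^sup>2"
      using u0 by (simp add: field_simps power2_eq_square)
    also have "\<dots> = (1 / u k - 1) / 2 + (d k)\<^sup>2 * \<eta>\<^sup>2 / (2 * u k) + (d k)\<^sup>2 * \<eta>\<^sup>2 / (2 * (u k)\<^sup>2)"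
      unfolding le using u0 by (simp add: field_simps power2_eq_square)
    finally have "\<eta> * ((lam k * u k + (d k)\<^sup>2 * (1 - lam k * \<eta>) * \<eta>) / (u k)\<^sup>2)
       = (1 / u k - 1) / 2 + (d k)\<^sup>2 * \<eta>\<^sup>2 / (2 * u k) + (d k)\<^sup>2 * \<eta>\<^sup>2 / (2 * (u k)\<^sup>2)" .
    moreover have "0 \<le> (d k)\<^sup>2 * \<eta>\<^sup>2 / (2 * (u k)\<^sup>2)" by simp
    ultimately show "(d k)\<^sup>2 * \<eta>\<^sup>2 / (2 * u k) - ln (u k) / 2 - \<eta> * ((lam k * u k + (d k)\<^sup>2 * (1 - lam k * \<eta>) * \<eta>) / (u k)\<^sup>2) \<le> 0"
      using l by linarith
  qed
  finally show ?thesis .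
qed

text \<open>Translates the correction in standardized cumulants into \<open>\<beta> k\<close>. With
  \<open>r = sqrt K2\<close> all half-integer powers become rational, and \<open>lam k\<close> is
  eliminated through \<open>u k = 1 - 2 * lam k * \<eta>\<close>, which needs a nonzero
  \<open>\<eta>\<close>.\<close>

lemma correction_term:
  assumes \<eta>: "\<eta> \<noteq> 0" and k: "k < m"
  defines "zh \<equiv> \<eta> * sqrt K2" and "\<rho>3 \<equiv> K3 / K2 powr (3/2)" and "\<rho>4 \<equiv> K4 / K2\<^sup>2"
  shows "(\<rho>4 / 8 - 5 * \<rho>3\<^sup>2 / 24 - \<rho>3 / (2 * zh) - 1 / zh\<^sup>2) * \<eta>
          + 1 / (sqrt K2 * u k) * (\<rho>3 / 2 + 1 / zh) - 4 * lam k / (2 * K2 * (u k)\<^sup>2) = \<eta> * \<beta> k"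
proof -
  define r where "r = sqrt K2"
  have r: "r > 0" using K2_pos by (simp add: r_def)
  have K: "K2 = r\<^sup>2" using K2_pos by (simp add: r_def)
  have "K2 powr (3/2) = (K2 powr (1/2)) powr 3" by (simp add: powr_powr)
  also have "\<dots> = r ^ 3" using r K2_pos by (simp add: powr_half_sqrt r_def powr_numeral)
  finally have p: "K2 powr (3/2) = r ^ 3" .
  have u0: "u k \<noteq> 0" using u_pos[OF k] by simp
  have le: "lam k = (1 - u k) / (2 * \<eta>)" using \<eta> by (simp add: u_def)
  show ?thesis
    unfolding zh_def \<rho>3_def \<rho>4_def \<beta>_def p r_def[symmetric] lt_def le unfolding K
    using r u0 \<eta> by (simp add: field_simps eval_nat_numeral)
qed

end

section \<open>Assembly of the two formulas\<close>

lemma shift_denominator: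
  fixes D e G x :: real
  assumes D: "D > 0" and x: "x \<ge> 1" "\<bar>e\<bar> \<le> x * D"
  shows "\<bar>G / (2 * D) / x - G / (2 * x * D + e)\<bar> \<le> \<bar>G * e\<bar> / (2 * D\<^sup>2) / x\<^sup>2"
proof -
  have xD: "x * D > 0" using D x by simp
  hence pos: "x * D \<le> 2 * x * D + e" "2 * x * D + e > 0" using x by linarith+
  have "G / (2 * D) / x - G / (2 * x * D + e) = G * e / (2 * (x * D) * (2 * x * D + e))"
    using D x pos(2) by (simp add: field_simps)
  hence "\<bar>G / (2 * D) / x - G / (2 * x * D + e)\<bar> = \<bar>G * e\<bar> / (2 * (x * D) * (2 * x * D + e))"
    using D x xD pos by (simp add: abs_mult)
  also have "\<dots> \<le> \<bar>G * e\<bar> / (2 * (x * D) * (x * D))"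
    using D x xD pos by (intro divide_left_mono mult_left_mono mult_pos_pos) auto
  also have "\<dots> = \<bar>G * e\<bar> / (2 * D\<^sup>2) / x\<^sup>2" by (simp add: power2_eq_square mult_ac)
  finally show ?thesis .
qed

theorem theorem5:
  fixes M :: "'a measure" and Z :: "nat \<Rightarrow> nat \<Rightarrow> 'a \<Rightarrow> real"
    and m :: nat and c w0 v \<eta> :: real and lam d w :: "nat \<Rightarrow> real"
  assumes "prob_space M"
    and "prob_space.indep_vars M (\<lambda>_. borel) (\<lambda>(j, k). Z j k) UNIV"
    and "\<And>j k. distributed M lborel (Z j k) std_normal_density"
    and nondeg: "\<exists>k<m. lam k \<noteq> 0 \<or> d k \<noteq> 0"
    and dom: "\<forall>k<m. 1 - 2 * lam k * \<eta> > 0"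
    and saddle: "(\<Sum>k<m. (lam k * (1 - 2 * lam k * \<eta>) + (d k)\<^sup>2 * (1 - lam k * \<eta>) * \<eta>)
                     / (1 - 2 * lam k * \<eta>)\<^sup>2) = v - c"
  defines "Y \<equiv> \<lambda>j x. c + (\<Sum>k<m. d k * Z j k x + lam k * (Z j k x)\<^sup>2)"
    and "W \<equiv> \<lambda>j x. w0 + (\<Sum>k<m. w k * Z j k x)"
    and "K \<equiv> cgf_Y m c lam d \<eta>"
    and "K2 \<equiv> cgf_deriv 2 m c lam d \<eta>"
    and "K3 \<equiv> cgf_deriv 3 m c lam d \<eta>"
    and "K4 \<equiv> cgf_deriv 4 m c lam d \<eta>"
  shows "let Ybar = (\<lambda>n x. (\<Sum>j<n. Y j x) / real n);
             Wbar = (\<lambda>n x. (\<Sum>j<n. W j x) / real n);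
             zh = \<eta> * sqrt K2;
             \<omega> = sgn \<eta> * sqrt (2 * (\<eta> * v - K));
             \<rho>3 = K3 / K2 powr (3/2);
             \<rho>4 = K4 / K2\<^sup>2;
             tail = (\<lambda>n. measure M {x \<in> space M. Ybar n x \<ge> v})
         in (\<exists>C N. \<forall>n\<ge>N. \<exists>L. has_cond_exp_at M (Wbar n) (Ybar n) v L \<and>
            \<bar>L - (w0 + (\<Sum>k<m. w k * d k / (1 - 2 * lam k * \<eta>)^3 *
               (\<eta> * (1 - 2 * lam k * \<eta>)\<^sup>2
                + (K3 * (1 - 2 * lam k * \<eta>) - 4 * lam k * K2)
                  / (2 * real n * K2\<^sup>2 + 1/4 * K4 - 5/12 * K3\<^sup>2 / K2))))\<bar>
            \<le> C / (real n)\<^sup>2)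
       \<and> (\<eta> \<noteq> 0 \<longrightarrow>
          (\<exists>C N. \<forall>n\<ge>N.
            \<bar>cond_exp_ge M (Wbar n) (Ybar n) v
              - (w0 + (\<Sum>k<m. std_normal_density (sqrt (real n) * \<omega>)
                         / (sqrt (real n) * zh * tail n)
                       * (w k * d k / (1 - 2 * lam k * \<eta>))
                       * (\<eta> + 1 / real n *
                           ((\<rho>4 / 8 - 5 * \<rho>3\<^sup>2 / 24 - \<rho>3 / (2 * zh) - 1 / zh\<^sup>2) * \<eta>
                            + 1 / (sqrt K2 * (1 - 2 * lam k * \<eta>)) * (\<rho>3 / 2 + 1 / zh)
                            - 4 * lam k / (2 * K2 * (1 - 2 * lam k * \<eta>)\<^sup>2)))))\<bar>
            \<le> C * (std_normal_density (sqrt (real n) * \<omega>) / (sqrt (real n) * tail n))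
                * (1 / (real n)\<^sup>2)))"
proof -
  interpret qg: quadratic_gaussian_sample M Z m \<eta> "v - c" lam d
    using assms(1-3) nondeg dom saddle
    by (intro quadratic_gaussian_sample.intro quadratic_gaussian_sample_axioms.intro) auto
  have K2: "K2 = qg.K2" and K3: "K3 = qg.K3" and K4: "K4 = qg.K4"
    unfolding K2_def K3_def K4_def by (rule qg.K_eq)+
  have u: "1 - 2 * lam k * \<eta> = qg.u k" for k by (simp add: qg.u_def)
  have K2_pos: "K2 > 0" unfolding K2 by (rule qg.K2_pos)
  define Ybar where "Ybar n x = (\<Sum>j<n. Y j x) / real n" for n x
  define Wbar where "Wbar n x = (\<Sum>j<n. W j x) / real n" for n x
  have S: "qg.S n x = real n * (Ybar n x - v)" if "n > 0" for n x
  proof -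
    have "real n * (Ybar n x - v) = (\<Sum>j<n. Y j x) - real n * v"
      using that by (simp add: Ybar_def right_diff_distrib)
    thus ?thesis by (simp add: qg.S_def Y_def sum.distrib sum_subtractf algebra_simps)
  qed
  have Wb: "Wbar n x = w0 + qg.X w n x" if "n > 0" for n x
    using that by (simp add: qg.X_def Wbar_def W_def sum.distrib add_divide_distrib)
  obtain C N where N: "N \<ge> 12" "\<And>n. n \<ge> N \<Longrightarrow> qg.J n (\<lambda>_. 1) \<noteq> 0"
    "\<And>n. n \<ge> N \<Longrightarrow> \<bar>Re (qg.J n (qg.fB w) / qg.J n (\<lambda>_. 1)) - ((\<Sum>k<m. w k * d k / qg.u k * \<eta>) + qg.\<gamma> w / n)\<bar> \<le> C / (real n)\<^sup>2"
    by (rule qg.ratio_expansion[of w]) blast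
  define G where "G = (\<Sum>k<m. w k * d k / qg.u k ^ 3 * (K3 * qg.u k - 4 * lam k * K2))"
  \<comment> \<open>This is \<open>2 * K2\<^sup>2\<close> times the \<open>1/n\<close> coefficient
    of the normalizing integral, as it arises on dividing by the two-term expansion of that
    integral.\<close>
  define e where "e = 1/4 * K4 - 5/12 * K3\<^sup>2 / K2"
  have part1: "\<exists>C N. \<forall>n\<ge>N. \<exists>L. has_cond_exp_at M (Wbar n) (Ybar n) v L \<and>
            \<bar>L - (w0 + (\<Sum>k<m. w k * d k / qg.u k ^ 3 * (\<eta> * (qg.u k)\<^sup>2
                + (K3 * qg.u k - 4 * lam k * K2) / (2 * real n * K2\<^sup>2 + 1/4 * K4 - 5/12 * K3\<^sup>2 / K2))))\<bar> \<le> C / (real n)\<^sup>2"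
  proof (intro exI allI impI)
    \<comment> \<open>The second bound gives \<open>\<bar>e\<bar> \<le> real n * K2\<^sup>2\<close>,
      so the full denominator is at least half of its leading term.\<close>
    fix n assume n: "n \<ge> max N (nat \<lceil>\<bar>e\<bar> / K2\<^sup>2\<rceil>)"
    hence nN: "n \<ge> N" and n12: "n \<ge> 12" and n0: "n > 0" using N(1) by auto
    have "\<bar>e\<bar> / K2\<^sup>2 \<le> real n" using n by simp
    hence ne: "\<bar>e\<bar> \<le> real n * K2\<^sup>2" using K2_pos by (simp add: divide_le_eq)
    show "has_cond_exp_at M (Wbar n) (Ybar n) v (w0 + Re (qg.J n (qg.fB w) / qg.J n (\<lambda>_. 1))) \<and>
      \<bar>w0 + Re (qg.J n (qg.fB w) / qg.J n (\<lambda>_. 1)) - (w0 + (\<Sum>k<m. w k * d k / qg.u k ^ 3 * (\<eta> * (qg.u k)\<^sup>2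
                + (K3 * qg.u k - 4 * lam k * K2) / (2 * real n * K2\<^sup>2 + 1/4 * K4 - 5/12 * K3\<^sup>2 / K2))))\<bar>
       \<le> (C + \<bar>G * e\<bar> / (2 * (K2\<^sup>2)\<^sup>2)) / (real n)\<^sup>2"
    proof
      show "has_cond_exp_at M (Wbar n) (Ybar n) v (w0 + Re (qg.J n (qg.fB w) / qg.J n (\<lambda>_. 1)))"
        by (rule qg.has_cond_exp_at_sample[OF n12 N(2)[OF nN] S[OF n0] Wb[OF n0]])
      have \<gamma>: "qg.\<gamma> w = G / (2 * K2\<^sup>2)"
        by (simp add: qg.\<gamma>_def G_def K2 K3 sum_divide_distrib)
      have "(\<Sum>k<m. w k * d k / qg.u k ^ 3 * (\<eta> * (qg.u k)\<^sup>2 + (K3 * qg.u k - 4 * lam k * K2) / (2 * real n * K2\<^sup>2 + e)))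
        = (\<Sum>k<m. w k * d k / qg.u k * \<eta> + w k * d k / qg.u k ^ 3 * (K3 * qg.u k - 4 * lam k * K2) / (2 * real n * K2\<^sup>2 + e))"
      proof (intro sum.cong refl)
        fix k assume "k \<in> {..<m}"
        hence "qg.u k \<noteq> 0" using qg.u_pos[of k] by simp
        thus "w k * d k / qg.u k ^ 3 * (\<eta> * (qg.u k)\<^sup>2 + (K3 * qg.u k - 4 * lam k * K2) / (2 * real n * K2\<^sup>2 + e))
          = w k * d k / qg.u k * \<eta> + w k * d k / qg.u k ^ 3 * (K3 * qg.u k - 4 * lam k * K2) / (2 * real n * K2\<^sup>2 + e)"
          by (simp add: distrib_left eval_nat_numeral)
      qed
      also have "\<dots> = (\<Sum>k<m. w k * d k / qg.u k * \<eta>) + G / (2 * real n * K2\<^sup>2 + e)"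
        unfolding G_def sum_divide_distrib sum.distrib ..
      finally have sum: "(\<Sum>k<m. w k * d k / qg.u k ^ 3 * (\<eta> * (qg.u k)\<^sup>2 + (K3 * qg.u k - 4 * lam k * K2) / (2 * real n * K2\<^sup>2 + e)))
        = (\<Sum>k<m. w k * d k / qg.u k * \<eta>) + G / (2 * real n * K2\<^sup>2 + e)" .
      have den: "2 * real n * K2\<^sup>2 + 1/4 * K4 - 5/12 * K3\<^sup>2 / K2 = 2 * real n * K2\<^sup>2 + e" by (simp add: e_def)
      \<comment> \<open>The expanded ratio has denominator \<open>2 * n * K2\<^sup>2\<close>; adding
        \<open>e\<close> to it is a relative change of order \<open>1/n\<close> in a term of order
        \<open>1/n\<close>.\<close>
      have "\<bar>G / (2 * K2\<^sup>2) / real n - G / (2 * real n * K2\<^sup>2 + e)\<bar> \<le> \<bar>G * e\<bar> / (2 * (K2\<^sup>2)\<^sup>2) / (real n)\<^sup>2"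
        by (rule shift_denominator) (use K2_pos n0 ne in auto)
      with N(3)[OF nN] show "\<bar>w0 + Re (qg.J n (qg.fB w) / qg.J n (\<lambda>_. 1)) - (w0 + (\<Sum>k<m. w k * d k / qg.u k ^ 3 * (\<eta> * (qg.u k)\<^sup>2
                + (K3 * qg.u k - 4 * lam k * K2) / (2 * real n * K2\<^sup>2 + 1/4 * K4 - 5/12 * K3\<^sup>2 / K2))))\<bar>
        \<le> (C + \<bar>G * e\<bar> / (2 * (K2\<^sup>2)\<^sup>2)) / (real n)\<^sup>2"
        unfolding den sum \<gamma> add_divide_distrib by linarith
    qed
  qed
  define zh \<omega> \<rho>3 \<rho>4 where "zh = \<eta> * sqrt K2" and "\<omega> = sgn \<eta> * sqrt (2 * (\<eta> * v - K))"
    and "\<rho>3 = K3 / K2 powr (3/2)" and "\<rho>4 = K4 / K2\<^sup>2"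
  define tail where "tail n = measure M {x \<in> space M. Ybar n x \<ge> v}" for n
  have part2: "\<exists>C N. \<forall>n\<ge>N.
            \<bar>cond_exp_ge M (Wbar n) (Ybar n) v
              - (w0 + (\<Sum>k<m. std_normal_density (sqrt (real n) * \<omega>) / (sqrt (real n) * zh * tail n)
                       * (w k * d k / qg.u k)
                       * (\<eta> + 1 / real n *
                           ((\<rho>4 / 8 - 5 * \<rho>3\<^sup>2 / 24 - \<rho>3 / (2 * zh) - 1 / zh\<^sup>2) * \<eta>
                            + 1 / (sqrt K2 * qg.u k) * (\<rho>3 / 2 + 1 / zh)
                            - 4 * lam k / (2 * K2 * (qg.u k)\<^sup>2)))))\<bar>
            \<le> C * (std_normal_density (sqrt (real n) * \<omega>) / (sqrt (real n) * tail n)) * (1 / (real n)\<^sup>2)"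
    if \<eta>: "\<eta> \<noteq> 0"
  proof -
    obtain D where D: "\<And>n. n \<ge> 12 \<Longrightarrow> \<bar>(\<integral>x. qg.X w n x * indicator {x \<in> space M. qg.S n x \<ge> 0} x \<partial>M)
       - exp (n * qg.\<kappa>0) / sqrt (2 * pi) / (sqrt n * sqrt qg.K2) * (\<Sum>k<m. w k * d k / qg.u k * (1 + qg.\<beta> k / n))\<bar>
         \<le> D * (exp (n * qg.\<kappa>0) / sqrt (2 * pi) / sqrt n) * (1 / (real n)\<^sup>2)"
      by (rule qg.tail_expansion[OF \<eta>, of w]) blast
    have \<kappa>: "\<eta> * v - K = - qg.\<kappa>0"
    proof -
      have "K = c * \<eta> + (\<Sum>k<m. (d k)\<^sup>2 * \<eta>\<^sup>2 / (2 * qg.u k) - ln (qg.u k) / 2)"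
        unfolding K_def cgf_Y_def u by (simp add: sum_subtractf sum_distrib_left)
      thus ?thesis by (simp add: qg.\<kappa>0_def algebra_simps)
    qed
    \<comment> \<open>The sign of \<open>\<eta>\<close> disappears in the square, and the radicand
      is nonnegative by \<open>\<kappa>0_nonpos\<close>. Hence the normal density at
      \<open>sqrt n * \<omega>\<close> is the prefactor of \<open>tail_expansion\<close>.\<close>
    have \<omega>: "\<omega>\<^sup>2 = - 2 * qg.\<kappa>0"
      using qg.\<kappa>0_nonpos \<eta> by (simp add: \<omega>_def \<kappa> power_mult_distrib sgn_if)
    have \<phi>: "std_normal_density (sqrt (real n) * \<omega>) = exp (n * qg.\<kappa>0) / sqrt (2 * pi)" for n
      by (simp add: std_normal_density_def power_mult_distrib \<omega>)
    show ?thesis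
    proof (intro exI allI impI)
      fix n assume nN: "n \<ge> N"
      hence n12: "n \<ge> 12" and n0: "n > 0" using N(1) by auto
      define A where "A = {x \<in> space M. qg.S n x \<ge> 0}"
      have AY: "{x \<in> space M. Ybar n x \<ge> v} = A"
        unfolding A_def S[OF n0] using n0 by (simp add: zero_le_mult_iff)
      have Am: "A \<in> sets M" unfolding A_def by (rule qg.event_measurable)
      have tp: "tail n > 0" unfolding tail_def AY A_def by (rule qg.tail_positive[OF n12 N(2)[OF nN]])
      define T where "T = (\<integral>x. qg.X w n x * indicator A x \<partial>M)"
      define \<phi>n where "\<phi>n = std_normal_density (sqrt (real n) * \<omega>)"
      define L where "L = (\<Sum>k<m. w k * d k / qg.u k * (1 + qg.\<beta> k / n))"
      have T: "\<bar>T - \<phi>n / (sqrt n * sqrt K2) * L\<bar> \<le> D * (\<phi>n / sqrt n) * (1 / (real n)\<^sup>2)"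
        using D[OF n12] unfolding T_def A_def \<phi>n_def \<phi> K2 L_def .
      have "integrable M (\<lambda>x. qg.X w n x * indicator A x)"
        by (rule Bochner_Integration.integrable_bound[OF qg.integrable_X[of w n]]) (use Am in \<open>auto split: split_indicator\<close>)
      moreover have "integrable M (indicator A :: 'a \<Rightarrow> real)"
        by (intro integrable_real_indicator Am) (simp add: qg.emeasure_eq_measure)
      ultimately have "(\<integral>x. w0 * indicator A x + qg.X w n x * indicator A x \<partial>M) = w0 * tail n + T"
        by (subst Bochner_Integration.integral_add) (use Am in \<open>auto simp: T_def tail_def AY Int_absorb2 sets.sets_into_space\<close>)
      hence ce: "cond_exp_ge M (Wbar n) (Ybar n) v = w0 + T / tail n"
        unfolding cond_exp_ge_def AY tail_def[symmetric] Wb[OF n0] using tp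
        by (simp add: distrib_right add_divide_distrib tail_def AY)
      have "(\<Sum>k<m. \<phi>n / (sqrt (real n) * zh * tail n) * (w k * d k / qg.u k)
                       * (\<eta> + 1 / real n *
                           ((\<rho>4 / 8 - 5 * \<rho>3\<^sup>2 / 24 - \<rho>3 / (2 * zh) - 1 / zh\<^sup>2) * \<eta>
                            + 1 / (sqrt K2 * qg.u k) * (\<rho>3 / 2 + 1 / zh)
                            - 4 * lam k / (2 * K2 * (qg.u k)\<^sup>2))))
         = (\<Sum>k<m. \<phi>n / (sqrt n * sqrt K2) / tail n * (w k * d k / qg.u k * (1 + qg.\<beta> k / n)))"
      proof (intro sum.cong refl)
        fix k assume "k \<in> {..<m}"
        hence k: "k < m" by simp
        \<comment> \<open>The factor \<open>\<eta>\<close> hidden in \<open>zh\<close> cancels the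
          one common to the whole bracket, so the expression agrees with the expansion, in which no
          such factor occurs.\<close>
        have "p / (x * (\<eta> * y) * t) * a * (\<eta> + 1 / z * (\<eta> * bt)) = p / (x * y) / t * (a * (1 + bt / z))" for p x y t a z bt :: real
        proof -
          have "\<eta> + 1 / z * (\<eta> * bt) = \<eta> * (1 + bt / z)" by (simp add: distrib_left)
          thus ?thesis using \<eta> by simp
        qed
        thus "\<phi>n / (sqrt (real n) * zh * tail n) * (w k * d k / qg.u k)
                       * (\<eta> + 1 / real n *
                           ((\<rho>4 / 8 - 5 * \<rho>3\<^sup>2 / 24 - \<rho>3 / (2 * zh) - 1 / zh\<^sup>2) * \<eta>
                            + 1 / (sqrt K2 * qg.u k) * (\<rho>3 / 2 + 1 / zh)
                            - 4 * lam k / (2 * K2 * (qg.u k)\<^sup>2)))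
         = \<phi>n / (sqrt n * sqrt K2) / tail n * (w k * d k / qg.u k * (1 + qg.\<beta> k / n))"
          unfolding qg.correction_term[OF \<eta> k, folded K2 K3 K4, folded zh_def \<rho>3_def \<rho>4_def] unfolding zh_def .
      qed
      also have "\<dots> = (\<phi>n / (sqrt n * sqrt K2) * L) / tail n"
        unfolding L_def sum_distrib_left sum_divide_distrib by (intro sum.cong refl) (simp only: divide_inverse mult_ac)
      finally have rhs: "(\<Sum>k<m. \<phi>n / (sqrt (real n) * zh * tail n) * (w k * d k / qg.u k)
                       * (\<eta> + 1 / real n *
                           ((\<rho>4 / 8 - 5 * \<rho>3\<^sup>2 / 24 - \<rho>3 / (2 * zh) - 1 / zh\<^sup>2) * \<eta>
                            + 1 / (sqrt K2 * qg.u k) * (\<rho>3 / 2 + 1 / zh)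
                            - 4 * lam k / (2 * K2 * (qg.u k)\<^sup>2)))) = (\<phi>n / (sqrt n * sqrt K2) * L) / tail n" .
      have "\<bar>w0 + T / tail n - (w0 + (\<phi>n / (sqrt n * sqrt K2) * L) / tail n)\<bar> = \<bar>T - \<phi>n / (sqrt n * sqrt K2) * L\<bar> / tail n"
      proof -
        have "w0 + T / tail n - (w0 + Q / tail n) = (T - Q) / tail n" for Q by (simp add: diff_divide_distrib)
        thus ?thesis using tp by (simp only: abs_divide abs_of_pos)
      qed
      also have "\<dots> \<le> D * (\<phi>n / sqrt n) * (1 / (real n)\<^sup>2) / tail n"
        using T tp by (intro divide_right_mono) auto
      also have "\<dots> = D * (\<phi>n / (sqrt n * tail n)) * (1 / (real n)\<^sup>2)" by (simp add: mult_ac)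
      finally show "\<bar>cond_exp_ge M (Wbar n) (Ybar n) v
              - (w0 + (\<Sum>k<m. std_normal_density (sqrt (real n) * \<omega>) / (sqrt (real n) * zh * tail n)
                       * (w k * d k / qg.u k)
                       * (\<eta> + 1 / real n *
                           ((\<rho>4 / 8 - 5 * \<rho>3\<^sup>2 / 24 - \<rho>3 / (2 * zh) - 1 / zh\<^sup>2) * \<eta>
                            + 1 / (sqrt K2 * qg.u k) * (\<rho>3 / 2 + 1 / zh)
                            - 4 * lam k / (2 * K2 * (qg.u k)\<^sup>2)))))\<bar>
            \<le> D * (std_normal_density (sqrt (real n) * \<omega>) / (sqrt (real n) * tail n)) * (1 / (real n)\<^sup>2)"
        unfolding \<phi>n_def[symmetric] rhs ce .
    qed
  qed
  show ?thesis
    unfolding Let_def u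
    using part1 part2 unfolding Wbar_def[abs_def] Ybar_def[abs_def] zh_def \<omega>_def \<rho>3_def \<rho>4_def tail_def by blast
qed

end
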